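(* Let $c\in\mathbb C$. The restricted $\mathcal F_4$ Calogero-Moser system for a stratum of type $\mathcal A_1$ (i.e. the orbit of the mirror of a root whose orbit has multiplicity $1/2$, the other orbit of roots having multiplicity $c$) has, in suitable orthonormal coordinates $x_1,x_2,x_3$ on the mirror, the form $$H=\Delta-\sum_{i=1}^3\frac{(4c+1)\partial_i}{x_i}-\sum_{1\le i<j\le3}\ \sum_{\pm}\frac{2c(\partial_i\pm\partial_j)}{x_i\pm x_j}-\sum_{\epsilon_2,\epsilon_3\in\{1,-1\}}\frac{2(\partial_1+\epsilon_2\partial_2+\epsilon_3\partial_3)}{x_1+\epsilon_2x_2+\epsilon_3x_3},$$ where $\Delta=\partial_1^2+\partial_2^2+\partial_3^2$, $\partial_i=\partial/\partial x_i$, and in the double sum for each pair $i<j$ both signs are taken (the same sign in numerator and denominator). In particular, the operator $H$ is quantum integrable.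
   Context: The root system $\mathcal F_4\subset\mathbb C^4$ consists of the vectors $\pm e_i$, $\tfrac12(\pm e_1\pm e_2\pm e_3\pm e_4)$ and $\pm e_i\pm e_j$ ($i<j$); its Coxeter group $W$ has two orbits of roots, and a $W$-invariant multiplicity function takes one value on each orbit. With $\mathcal R=\mathcal F_4$, $N=4$, multiplicity $\alpha\mapsto c_\alpha$, the Dunkl operators are $$\nabla_\xi=\partial_\xi-\sum_{\alpha\in\mathcal R_+}\frac{c_\alpha(\alpha,\xi)}{(\alpha,x)}(1-s_\alpha),\qquad \nabla_i=\nabla_{e_i},$$ where $(\cdot,\cdot)$ is the standard bilinear scalar product and $s_\alpha$ is the orthogonal reflection in $(\alpha,x)=0$. If $\pi$ is the mirror of a root whose orbit has multiplicity $1/2$, the ideal of polynomials vanishing on $D=\bigcup_{w\in W}w(\pi)$ is preserved by all Dunkl operators. The restricted Calogero-Moser system (operator) is $\big(\sum_{i=1}^N\nabla_i^2\big)^{Res_\pi}$, defined as follows. Let $x_0\in\pi$ be generic, $U\subset\pi$ a small neighbourhood of $x_0$ in $\pi$. An analytic function $f_\pi$ on $U$ determines a $W$-invariant function $f$ on $\bigcup_{w\in W}w(U)$; let $\bar f$ be any $W$-invariant analytic extension of $f$ to $\bigcup_{w\in W}w(\tilde U)$, with $\tilde U\supset U$ a small neighbourhood of $x_0$ in $\mathbb C^N$. Then the operator maps $f_\pi$ to $\big(\sum_i\nabla_i^2\bar f\big)|_U$, which is independent of the extension. A differential operator $L$ acting in $n$-dimensional space is quantum integrable if there exist $n$ pairwise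 commuting differential operators $L_1=L,L_2,\dots,L_n$ which are algebraically independent. *)

theory Defs
  imports "HOL-Analysis.Analysis" "HOL-Library.Poly_Mapping"
begin

type_synonym 'n func = "complex ^ 'n \<Rightarrow> complex"


(* The complex bilinear (not sesquilinear) form; the library inner product on
   complex ^ 'n is a real one. *)
definition bilin :: "complex ^ 'n \<Rightarrow> complex ^ 'n \<Rightarrow> complex" where
  "bilin x y = (\<Sum>i\<in>UNIV. x $ i * y $ i)"

definition reflection :: "complex ^ 'n \<Rightarrow> complex ^ 'n \<Rightarrow> complex ^ 'n" where
  "reflection \<alpha> x = x - (2 * bilin \<alpha> x / bilin \<alpha> \<alpha>) *s \<alpha>"

definition mirror :: "complex ^ 'n \<Rightarrow> (complex ^ 'n) set" where
  "mirror \<alpha> = {x. bilin \<alpha> x = 0}"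

inductive_set coxeter_group :: "(complex ^ 'n) set \<Rightarrow> (complex ^ 'n \<Rightarrow> complex ^ 'n) set"
  for R :: "(complex ^ 'n) set" where
  one: "id \<in> coxeter_group R"
| step: "\<alpha> \<in> R \<Longrightarrow> w \<in> coxeter_group R \<Longrightarrow> reflection \<alpha> \<circ> w \<in> coxeter_group R"

definition root_orbit :: "(complex ^ 'n) set \<Rightarrow> complex ^ 'n \<Rightarrow> (complex ^ 'n) set" where
  "root_orbit R \<alpha> = {w \<alpha> | w. w \<in> coxeter_group R}"

definition multiplicity_function :: "(complex ^ 'n) set \<Rightarrow> (complex ^ 'n \<Rightarrow> complex) \<Rightarrow> bool" where
  "multiplicity_function R m \<longleftrightarrow> (\<forall>w\<in>coxeter_group R. \<forall>\<alpha>\<in>R. m (w \<alpha>) = m \<alpha>)"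

(* Only meant for root systems consisting of vectors with real coordinates. *)
definition positive_system :: "(complex ^ 'n) set \<Rightarrow> (complex ^ 'n) set \<Rightarrow> bool" where
  "positive_system R Rp \<longleftrightarrow>
     (\<exists>v :: real ^ 'n. (\<forall>\<alpha>\<in>R. (\<Sum>i\<in>UNIV. Re (\<alpha> $ i) * v $ i) \<noteq> 0) \<and>
        Rp = {\<alpha>\<in>R. (\<Sum>i\<in>UNIV. Re (\<alpha> $ i) * v $ i) > 0})"

definition F4 :: "(complex ^ 4) set" where
  "F4 = {axis i s | i s. s \<in> {1, -1}}
      \<union> {\<chi> i. s i / 2 | s. \<forall>i. s i \<in> {1, -1}}
      \<union> {axis i s + axis j t | i j s t. i \<noteq> j \<and> s \<in> {1, -1} \<and> t \<in> {1, -1}}"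


(* Analyticity in several complex variables, as complex Frechet differentiability on
   an open set. *)
definition analytic_open :: "'n func \<Rightarrow> (complex ^ 'n) set \<Rightarrow> bool" where
  "analytic_open f V \<longleftrightarrow> open V \<and>
     (\<forall>x\<in>V. \<exists>D. (f has_derivative D) (at x) \<and> (\<forall>a v. D (a *s v) = a * D v))"

(* Analytic functions on a subset that need not be open, such as a piece of a mirror:
   locally restrictions of analytic functions on the ambient space. *)
definition analytic_sub :: "'n func \<Rightarrow> (complex ^ 'n) set \<Rightarrow> bool" where
  "analytic_sub f U \<longleftrightarrow>
     (\<forall>x\<in>U. \<exists>V g. x \<in> V \<and> analytic_open g V \<and> (\<forall>y\<in>U \<inter> V. g y = f y))"

definition dir_deriv :: "complex ^ 'n \<Rightarrow> 'n func \<Rightarrow> 'n func" where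
  "dir_deriv \<xi> f x = deriv (\<lambda>t. f (x + t *s \<xi>)) 0"

definition partial :: "'n::finite \<Rightarrow> 'n func \<Rightarrow> 'n func" where
  "partial i = dir_deriv (axis i 1)"


definition regular_points :: "(complex ^ 'n) set \<Rightarrow> (complex ^ 'n) set" where
  "regular_points R = {x. \<forall>\<alpha>\<in>R. bilin \<alpha> x \<noteq> 0}"

(* For analytic f the singularities of the Dunkl operator on the mirrors are removable;
   the limit gives the value of the analytic continuation there, and the value of the
   expression itself at regular points. *)
definition dunkl :: "(complex ^ 'n) set \<Rightarrow> (complex ^ 'n) set \<Rightarrow> (complex ^ 'n \<Rightarrow> complex) \<Rightarrow>
    complex ^ 'n \<Rightarrow> 'n func \<Rightarrow> 'n func" where
  "dunkl R Rp m \<xi> f x = Lim (at x within regular_points R)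
     (\<lambda>y. dir_deriv \<xi> f y -
        (\<Sum>\<alpha>\<in>Rp. m \<alpha> * bilin \<alpha> \<xi> / bilin \<alpha> y * (f y - f (reflection \<alpha> y))))"

definition dunkl_laplacian :: "(complex ^ 'n) set \<Rightarrow> (complex ^ 'n) set \<Rightarrow>
    (complex ^ 'n \<Rightarrow> complex) \<Rightarrow> 'n func \<Rightarrow> 'n func" where
  "dunkl_laplacian R Rp m f x =
     (\<Sum>i\<in>UNIV. dunkl R Rp m (axis i 1) (dunkl R Rp m (axis i 1) f) x)"

definition invariant_extension :: "(complex ^ 'n) set \<Rightarrow> (complex ^ 'n) set \<Rightarrow> 'n func \<Rightarrow>
    (complex ^ 'n) set \<Rightarrow> 'n func \<Rightarrow> bool" where
  "invariant_extension R U f U' F \<longleftrightarrow>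
     open U' \<and> U \<subseteq> U' \<and>
     analytic_open F (\<Union>w\<in>coxeter_group R. w ` U') \<and>
     (\<forall>w\<in>coxeter_group R. \<forall>x\<in>(\<Union>w\<in>coxeter_group R. w ` U'). F (w x) = F x) \<and>
     (\<forall>x\<in>U. F x = f x)"

(* The restriction of the Dunkl Laplacian to U maps f to g: invariant analytic extensions
   of f exist, and every one of them produces g. *)
definition restricted_maps :: "(complex ^ 'n) set \<Rightarrow> (complex ^ 'n) set \<Rightarrow>
    (complex ^ 'n \<Rightarrow> complex) \<Rightarrow> (complex ^ 'n) set \<Rightarrow> 'n func \<Rightarrow> 'n func \<Rightarrow> bool" where
  "restricted_maps R Rp m U f g \<longleftrightarrow>
     (\<exists>U' F. invariant_extension R U f U' F) \<and>
     (\<forall>U' F. invariant_extension R U f U' F \<longrightarrow> (\<forall>x\<in>U. dunkl_laplacian R Rp m F x = g x))"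

definition generic_points :: "(complex ^ 'n) set \<Rightarrow> complex ^ 'n \<Rightarrow> (complex ^ 'n) set" where
  "generic_points R \<beta> =
     {x \<in> mirror \<beta>. \<forall>\<alpha>\<in>R. x \<in> mirror \<alpha> \<longrightarrow> mirror \<alpha> = mirror \<beta>}"

definition orthonormal_coordinates ::
    "(complex ^ 'k \<Rightarrow> complex ^ 'n) \<Rightarrow> (complex ^ 'n) set \<Rightarrow> bool" where
  "orthonormal_coordinates \<phi> P \<longleftrightarrow>
     Vector_Spaces.linear (*s) (*s) \<phi> \<and> (\<forall>u v. bilin (\<phi> u) (\<phi> v) = bilin u v) \<and> range \<phi> = P"

(* In the coordinates phi on the mirror of beta, the restricted Calogero-Moser operator
   is the operator L. *)
definition restricted_operator_has_form :: "(complex ^ 'n) set \<Rightarrow> (complex ^ 'n) set \<Rightarrow>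
    (complex ^ 'n \<Rightarrow> complex) \<Rightarrow> complex ^ 'n \<Rightarrow> (complex ^ 'k \<Rightarrow> complex ^ 'n) \<Rightarrow>
    ('k func \<Rightarrow> 'k func) \<Rightarrow> bool" where
  "restricted_operator_has_form R Rp m \<beta> \<phi> L \<longleftrightarrow>
     (\<forall>x0\<in>generic_points R \<beta>. \<exists>e>0. \<forall>U f.
        x0 \<in> U \<and> openin (top_of_set (mirror \<beta>)) U \<and> U \<subseteq> ball x0 e \<and> analytic_sub f U \<longrightarrow>
        restricted_maps R Rp m U f (\<lambda>x. L (f \<circ> \<phi>) (inv \<phi> x)))"


(* Operators are total functions on functions; as operators on an open set A only their
   action on analytic functions on open subsets of A matters. *)
definition op_eq_on :: "(complex ^ 'n) set \<Rightarrow> ('n func \<Rightarrow> 'n func) \<Rightarrow> ('n func \<Rightarrow> 'n func) \<Rightarrow> bool"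
  where
  "op_eq_on A L M \<longleftrightarrow> (\<forall>V f. V \<subseteq> A \<and> analytic_open f V \<longrightarrow> (\<forall>x\<in>V. L f x = M f x))"

(* The index lists k encode the monomials in the partial derivatives. *)
definition diff_op_on :: "(complex ^ 'n) set \<Rightarrow> ('n func \<Rightarrow> 'n func) \<Rightarrow> bool" where
  "diff_op_on A L \<longleftrightarrow>
     (\<exists>(K :: 'n list set) a. finite K \<and> (\<forall>k\<in>K. analytic_open (a k) A) \<and>
        op_eq_on A L (\<lambda>f x. \<Sum>k\<in>K. a k x * foldr partial k f x))"

definition op_monomial :: "(nat \<Rightarrow> 'n func \<Rightarrow> 'n func) \<Rightarrow> nat \<Rightarrow> (nat \<Rightarrow> nat) \<Rightarrow> 'n func \<Rightarrow> 'n func"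
  where
  "op_monomial L n k = foldr (\<lambda>i T. (L i ^^ k i) \<circ> T) [0..<n] id"

definition algebraically_independent_ops ::
    "(complex ^ 'n) set \<Rightarrow> nat \<Rightarrow> (nat \<Rightarrow> 'n func \<Rightarrow> 'n func) \<Rightarrow> bool" where
  "algebraically_independent_ops A n L \<longleftrightarrow>
     (\<forall>P :: (nat \<Rightarrow>\<^sub>0 nat) \<Rightarrow>\<^sub>0 complex.
        (\<forall>k\<in>Poly_Mapping.keys P. Poly_Mapping.keys k \<subseteq> {..<n}) \<and>
        op_eq_on A
          (\<lambda>f x. \<Sum>k\<in>Poly_Mapping.keys P.
              Poly_Mapping.lookup P k * op_monomial L n (Poly_Mapping.lookup k) f x)
          (\<lambda>f x. 0)
        \<longrightarrow> P = 0)"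

definition quantum_integrable_on ::
    "(complex ^ 'n) set \<Rightarrow> ('n func \<Rightarrow> 'n func) \<Rightarrow> bool" where
  "quantum_integrable_on A L \<longleftrightarrow>
     (\<exists>Ls :: nat \<Rightarrow> 'n func \<Rightarrow> 'n func. Ls 0 = L \<and>
        (\<forall>i<CARD('n). diff_op_on A (Ls i)) \<and>
        (\<forall>i<CARD('n). \<forall>j<CARD('n). op_eq_on A (Ls i \<circ> Ls j) (Ls j \<circ> Ls i)) \<and>
        algebraically_independent_ops A CARD('n) Ls)"


(* In the type 3 the numeral 3 denotes the same index as 0, so 1, 2, 3 are the three
   distinct indices. *)
definition H_op :: "complex \<Rightarrow> 3 func \<Rightarrow> 3 func" where
  "H_op c f x =
     (\<Sum>i\<in>UNIV. partial i (partial i f) x)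
   - (\<Sum>i\<in>UNIV. (4 * c + 1) * partial i f x / x $ i)
   - (\<Sum>(i, j)\<in>{(1, 2), (1, 3), (2, 3)}. \<Sum>s\<in>{1, -1}.
        2 * c * (partial i f x + s * partial j f x) / (x $ i + s * x $ j))
   - (\<Sum>e2\<in>{1, -1}. \<Sum>e3\<in>{1, -1}.
        2 * (partial 1 f x + e2 * partial 2 f x + e3 * partial 3 f x)
          / (x $ 1 + e2 * x $ 2 + e3 * x $ 3))"

definition H_domain :: "(complex ^ 3) set" where
  "H_domain = {x. (\<forall>i. x $ i \<noteq> 0) \<and>
     (\<forall>(i, j)\<in>{(1, 2), (1, 3), (2, 3)}. \<forall>s\<in>{1, -1}. x $ i + s * x $ j \<noteq> 0) \<and>
     (\<forall>e2\<in>{1, -1}. \<forall>e3\<in>{1, -1}. x $ 1 + e2 * x $ 2 + e3 * x $ 3 \<noteq> 0)}"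

end

theory Submission imports Defs "HOL-Complex_Analysis.Complex_Analysis" begin

text \<open>On \<open>W\<close>-invariant functions the Dunkl Laplacian is a differential operator with first order
  poles along the mirrors. Restricted to the mirror of \<open>\<beta>\<close>, the normal second derivative cancels
  against the singular term of \<open>\<beta>\<close> itself because its multiplicity is \<open>1/2\<close>; the other roots contribute
  the terms of \<open>H\<close> through their projections to the mirror, in coordinates obtained from an
  isometry that carries the short roots to multiples of the orbit of \<open>\<beta>\<close>.

  For integrability, let \<open>p_d\<close> be the sum of \<open>d\<close>-th powers of the (rescaled) roots in that orbit, and \<open>D_d\<close> the
  same expression in the Dunkl operators. The Dunkl operators commute and the commutator of the
  Dunkl Laplacian with a coordinate is twice a Dunkl operator, so the \<open>d\<close>-fold commutator of the
  Laplacian with multiplication by \<open>p_d\<close> is \<open>2^d d! D_d\<close>. Hence the \<open>d\<close>-fold commutator of \<open>H\<close> with the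
  restriction of \<open>p_d\<close> is, up to this factor, a differential operator that acts as \<open>D_d\<close> on restrictions of invariant
  polynomials. Invariant polynomials realise every jet at a point of the mirror that lies on no
  other mirror, so identities between the \<open>D_d\<close> descend to differential operators; in particular
  \<open>H\<close> and the operators for \<open>d = 6, 8\<close> commute. Repeated commutators with multiplication by
  \<open>(x, x) / 2\<close> turn a polynomial relation between them into one between the restrictions of
  \<open>(x, x)\<close>, \<open>p_6\<close> and \<open>p_8\<close>; these map complex 3-space onto itself, so the relation is trivial.\<close>

text \<open>The obstacle is that \<open>DD d\<close> involves reflections and is defined on
  polynomials in four variables, whereas integrability asks for differential operators on all
  holomorphic functions on open subsets of the domain, and such a function need not be the
  restriction of a global invariant. An iterated commutator of \<open>H_op\<close> with a
  multiplication is a differential operator by construction; the Dunkl operators only serve to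
  compute its values on restrictions of invariants. Since a differential operator sees a finite jet,
  these test functions suffice, and the algebra can be done in a ring of operators on polynomials,
  where the poles of the Dunkl operators always cancel. The two commutator processes undo each other
  up to sign: the Laplacian turns coordinates into Dunkl operators, and \<open>(x, x) / 2\<close>
  turns Dunkl operators back into coordinates. The second one thus extracts a leading symbol
  although the operators contain reflections. Independence of the symbols then follows from solving
  for prescribed values of the three invariants, by taking square roots and roots of a quadratic and
  a cubic.\<close>

no_notation fps_nth (infixl "$" 75)

section \<open>Holomorphic functions of several variables\<close>

lemma bilin_add_left: "bilin (x + y) z = bilin x z + bilin y z"
  and bilin_add_right: "bilin z (x + y) = bilin z x + bilin z y"
  and bilin_diff_left: "bilin (x - y) z = bilin x z - bilin y z"
  and bilin_diff_right: "bilin z (x - y) = bilin z x - bilin z y"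
  and bilin_minus_left: "bilin (- x) z = - bilin x z"
  and bilin_minus_right: "bilin z (- x) = - bilin z x"
  and bilin_scale_left: "bilin (a *s x) z = a * bilin x z"
  and bilin_scale_right: "bilin z (a *s x) = a * bilin z x"
  and bilin_zero_left: "bilin 0 z = 0"
  and bilin_zero_right: "bilin z 0 = 0"
  by (simp_all add: bilin_def sum.distrib sum_subtractf sum_negf sum_distrib_left algebra_simps)

lemma bilin_commute: "bilin x y = bilin y x"
  by (simp add: bilin_def mult.commute)

lemmas bilin_simps = bilin_add_left bilin_add_right bilin_diff_left bilin_diff_right
  bilin_minus_left bilin_minus_right bilin_scale_left bilin_scale_right bilin_zero_left bilin_zero_right

lemma bilin_axis_right: "bilin x (axis i 1) = x $ i"
  by (simp add: bilin_def axis_def if_distrib cong: if_cong)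

lemma bilin_axis_left: "bilin (axis i 1) x = x $ i"
  by (simp add: bilin_commute[of "axis i 1"] bilin_axis_right)

lemma vec_expand: "(x :: complex ^ 'n) = (\<Sum>i\<in>UNIV. x $ i *s axis i 1)"
  by (simp add: vec_eq_iff axis_def if_distrib cong: if_cong)

lemma bounded_linear_bilin: "bounded_linear (bilin a)"
proof -
  have "linear (bilin a)"
    by (rule linearI) (simp_all add: bilin_def scaleR_sum_right sum.distrib algebra_simps)
  then show ?thesis by (rule linear_conv_bounded_linear[THEN iffD1])
qed

lemma bounded_linear_scale_vec: "bounded_linear (\<lambda>t::complex. t *s (v :: complex ^ 'n))"
proof -
  have "linear (\<lambda>t::complex. t *s v)"
    by (rule linearI) (simp_all add: vec_eq_iff algebra_simps)
  then show ?thesis by (rule linear_conv_bounded_linear[THEN iffD1])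
qed

lemma continuous_on_scale_vec [continuous_intros]:
  "continuous_on S f \<Longrightarrow> continuous_on S g \<Longrightarrow> continuous_on S (\<lambda>x. f x *s (g x :: complex ^ 'n))"
  unfolding vector_scalar_mult_def by (intro continuous_intros)

lemma analytic_openI:
  assumes "open V" "\<And>x. x \<in> V \<Longrightarrow> (f has_derivative D x) (at x)" "\<And>x a v. x \<in> V \<Longrightarrow> D x (a *s v) = a * D x v"
  shows "analytic_open f V"
  using assms unfolding analytic_open_def by blast

lemma analytic_open_open: "analytic_open f V \<Longrightarrow> open V"
  by (simp add: analytic_open_def)

text \<open>Restriction to the complex line in direction \<open>v\<close> identifies the anonymous
  derivative of the definition with \<open>dir_deriv\<close>, so that later arguments can name
  it.\<close>

lemma analytic_open_deriv:
  assumes "analytic_open f V" "x \<in> V"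
  shows "(f has_derivative (\<lambda>v. dir_deriv v f x)) (at x)"
    and "dir_deriv (a *s v) f x = a * dir_deriv v f x"
    and "((\<lambda>t. f (x + t *s v)) has_field_derivative dir_deriv v f x) (at 0)"
proof -
  obtain D where D: "(f has_derivative D) (at x)" and l: "\<And>a v. D (a *s v) = a * D v"
    using assms unfolding analytic_open_def by blast
  have h: "((\<lambda>t. f (x + t *s v)) has_field_derivative D v) (at 0)" for v
  proof -
    have "((\<lambda>t. x + t *s v) has_derivative (\<lambda>t. t *s v)) (at 0)"
      using bounded_linear_imp_has_derivative[OF bounded_linear_scale_vec, of v "at 0"]
      by (auto intro!: derivative_eq_intros)
    moreover have "(f has_derivative D) (at (x + 0 *s v))" using D by simp
    ultimately have "((\<lambda>t. f (x + t *s v)) has_derivative (\<lambda>t. D (t *s v))) (at 0)"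
      by (rule has_derivative_compose)
    then show ?thesis unfolding has_field_derivative_def
      by (rule has_derivative_eq_rhs) (simp add: fun_eq_iff l mult.commute)
  qed
  have eq: "dir_deriv v f x = D v" for v
    unfolding dir_deriv_def using h by (rule DERIV_imp_deriv)
  show "(f has_derivative (\<lambda>v. dir_deriv v f x)) (at x)" using D by (simp add: eq)
  show "dir_deriv (a *s v) f x = a * dir_deriv v f x" by (simp add: eq l)
  show "((\<lambda>t. f (x + t *s v)) has_field_derivative dir_deriv v f x) (at 0)" using h by (simp add: eq)
qed

lemma has_derivative_imp_dir_deriv:
  assumes "(f has_derivative D) (at x)" "\<And>a v. D (a *s v) = a * D v"
  shows "dir_deriv v f x = D v"
proof -
  have "((\<lambda>t. x + t *s v) has_derivative (\<lambda>t. t *s v)) (at 0)"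
    using bounded_linear_imp_has_derivative[OF bounded_linear_scale_vec, of v "at 0"]
    by (auto intro!: derivative_eq_intros)
  moreover have "(f has_derivative D) (at (x + 0 *s v))" using assms by simp
  ultimately have "((\<lambda>t. f (x + t *s v)) has_derivative (\<lambda>t. D (t *s v))) (at 0)"
    by (rule has_derivative_compose)
  then have "((\<lambda>t. f (x + t *s v)) has_field_derivative D v) (at 0)"
    unfolding has_field_derivative_def
    by (rule has_derivative_eq_rhs) (simp add: fun_eq_iff assms mult.commute)
  then show ?thesis unfolding dir_deriv_def by (rule DERIV_imp_deriv)
qed

lemma dir_deriv_add_vec:
  assumes "analytic_open f V" "x \<in> V"
  shows "dir_deriv (v + w) f x = dir_deriv v f x + dir_deriv w f x"
  using has_derivative_linear[OF analytic_open_deriv(1)[OF assms]] by (rule linear_add)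

lemma dir_deriv_minus_vec:
  assumes "analytic_open f V" "x \<in> V"
  shows "dir_deriv (- v) f x = - dir_deriv v f x"
  using has_derivative_linear[OF analytic_open_deriv(1)[OF assms]] by (rule linear_neg)

lemma dir_deriv_diff_vec:
  assumes "analytic_open f V" "x \<in> V"
  shows "dir_deriv (v - w) f x = dir_deriv v f x - dir_deriv w f x"
  using has_derivative_linear[OF analytic_open_deriv(1)[OF assms]] by (rule linear_diff)

lemma dir_deriv_sum_vec:
  assumes "analytic_open f V" "x \<in> V"
  shows "dir_deriv (\<Sum>i\<in>I. v i) f x = (\<Sum>i\<in>I. dir_deriv (v i) f x)"
  using has_derivative_linear[OF analytic_open_deriv(1)[OF assms]] by (rule linear_sum)

lemma dir_deriv_expand:
  assumes "analytic_open f V" "x \<in> V"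
  shows "dir_deriv v f x = (\<Sum>i\<in>UNIV. v $ i * partial i f x)"
  by (subst vec_expand[of v])
    (simp only: dir_deriv_sum_vec[OF assms] analytic_open_deriv(2)[OF assms] partial_def)

lemma analytic_open_subset: "analytic_open f V \<Longrightarrow> open U \<Longrightarrow> U \<subseteq> V \<Longrightarrow> analytic_open f U"
  unfolding analytic_open_def by blast

lemma analytic_open_Union:
  assumes "\<And>x. x \<in> V \<Longrightarrow> \<exists>U. x \<in> U \<and> U \<subseteq> V \<and> analytic_open f U"
  shows "analytic_open f V"
proof -
  have "open V" using assms openI by (metis analytic_open_open open_contains_ball subset_trans)
  then show ?thesis using assms unfolding analytic_open_def by blast
qed

lemma analytic_open_continuous_on: "analytic_open f V \<Longrightarrow> continuous_on V f"
  by (metis analytic_open_deriv(1) continuous_at_imp_continuous_on has_derivative_continuous)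

lemma dir_deriv_cong_open:
  assumes "open V" "x \<in> V" "\<And>y. y \<in> V \<Longrightarrow> f y = g y"
  shows "dir_deriv v f x = dir_deriv v g x"
proof -
  have "continuous_on UNIV (\<lambda>t::complex. x + t *s v)" by (intro continuous_intros)
  then have "open ((\<lambda>t::complex. x + t *s v) -` V)" by (rule open_vimage[OF assms(1)])
  moreover have "0 \<in> (\<lambda>t::complex. x + t *s v) -` V" using assms by simp
  ultimately have "\<forall>\<^sub>F t in nhds 0. x + t *s v \<in> V"
    unfolding eventually_nhds by blast
  then have "\<forall>\<^sub>F t in nhds 0. f (x + t *s v) = g (x + t *s v)"
    by (rule eventually_mono) (rule assms(3))
  then show ?thesis unfolding dir_deriv_def by (rule deriv_cong_ev) simp
qed

lemma partial_cong_open: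
  "open V \<Longrightarrow> x \<in> V \<Longrightarrow> (\<And>y. y \<in> V \<Longrightarrow> f y = g y) \<Longrightarrow> partial i f x = partial i g x"
  unfolding partial_def by (rule dir_deriv_cong_open)

lemma analytic_open_cong:
  assumes "\<And>x. x \<in> V \<Longrightarrow> f x = g x" "analytic_open f V"
  shows "analytic_open g V"
proof -
  have "open V" using assms(2) by (rule analytic_open_open)
  have "(g has_derivative D) (at x)" if "x \<in> V" "(f has_derivative D) (at x)" for x D
    using has_derivative_transform_within_open[OF that(2) \<open>open V\<close> that(1)] assms(1) by blast
  then show ?thesis using assms(2) unfolding analytic_open_def by blast
qed

lemma analytic_open_const: "open V \<Longrightarrow> analytic_open (\<lambda>x. k) V"
  by (rule analytic_openI[where D = "\<lambda>_ _. 0"]) auto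

lemma analytic_open_bilin: "open V \<Longrightarrow> analytic_open (bilin a) V"
  by (rule analytic_openI[where D = "\<lambda>_. bilin a"])
    (auto intro: bounded_linear_imp_has_derivative bounded_linear_bilin simp: bilin_simps)

lemma dir_deriv_bilin: "dir_deriv v (bilin a) x = bilin a v"
  by (rule has_derivative_imp_dir_deriv)
    (auto intro: bounded_linear_imp_has_derivative bounded_linear_bilin simp: bilin_simps)

lemma analytic_open_nth: "open V \<Longrightarrow> analytic_open (\<lambda>x. x $ i) V"
  using analytic_open_bilin[of V "axis i 1"] by (simp add: bilin_axis_left[abs_def])

lemma dir_deriv_nth: "dir_deriv v (\<lambda>x. x $ i) x = v $ i"
  using dir_deriv_bilin[of v "axis i 1" x] by (simp add: bilin_axis_left[abs_def])

lemma dir_deriv_const: "dir_deriv v (\<lambda>x. k) x = 0"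
  by (rule has_derivative_imp_dir_deriv) auto

context
  fixes f g :: "'n::finite func" and V :: "(complex ^ 'n) set"
  assumes f: "analytic_open f V" and g: "analytic_open g V"
begin

lemma analytic_open_add: "analytic_open (\<lambda>x. f x + g x) V"
  by (rule analytic_openI[where D = "\<lambda>x v. dir_deriv v f x + dir_deriv v g x"])
    (auto intro: analytic_open_open[OF f] has_derivative_add analytic_open_deriv(1)[OF f] analytic_open_deriv(1)[OF g]
     simp: analytic_open_deriv(2)[OF f] analytic_open_deriv(2)[OF g] algebra_simps)

lemma analytic_open_diff: "analytic_open (\<lambda>x. f x - g x) V"
  by (rule analytic_openI[where D = "\<lambda>x v. dir_deriv v f x - dir_deriv v g x"])
    (auto intro: analytic_open_open[OF f] has_derivative_diff analytic_open_deriv(1)[OF f] analytic_open_deriv(1)[OF g]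
     simp: analytic_open_deriv(2)[OF f] analytic_open_deriv(2)[OF g] algebra_simps)

lemma analytic_open_mult: "analytic_open (\<lambda>x. f x * g x) V"
  by (rule analytic_openI[where D = "\<lambda>x v. f x * dir_deriv v g x + dir_deriv v f x * g x"])
    (auto intro: analytic_open_open[OF f] has_derivative_mult analytic_open_deriv(1)[OF f] analytic_open_deriv(1)[OF g]
     simp: analytic_open_deriv(2)[OF f] analytic_open_deriv(2)[OF g] distrib_left mult.left_commute mult.assoc)

lemma dir_deriv_add: "x \<in> V \<Longrightarrow> dir_deriv v (\<lambda>x. f x + g x) x = dir_deriv v f x + dir_deriv v g x"
  by (rule has_derivative_imp_dir_deriv[OF has_derivative_add[OF analytic_open_deriv(1)[OF f] analytic_open_deriv(1)[OF g]]])
    (auto simp: analytic_open_deriv(2)[OF f] analytic_open_deriv(2)[OF g] algebra_simps)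

lemma dir_deriv_diff: "x \<in> V \<Longrightarrow> dir_deriv v (\<lambda>x. f x - g x) x = dir_deriv v f x - dir_deriv v g x"
  by (rule has_derivative_imp_dir_deriv[OF has_derivative_diff[OF analytic_open_deriv(1)[OF f] analytic_open_deriv(1)[OF g]]])
    (auto simp: analytic_open_deriv(2)[OF f] analytic_open_deriv(2)[OF g] algebra_simps)

lemma dir_deriv_mult:
  "x \<in> V \<Longrightarrow> dir_deriv v (\<lambda>x. f x * g x) x = f x * dir_deriv v g x + dir_deriv v f x * g x"
  by (rule has_derivative_imp_dir_deriv[OF has_derivative_mult[OF analytic_open_deriv(1)[OF f] analytic_open_deriv(1)[OF g]]])
    (auto simp: analytic_open_deriv(2)[OF f] analytic_open_deriv(2)[OF g] algebra_simps)

end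

lemma analytic_open_inverse:
  assumes "analytic_open f V" "\<And>x. x \<in> V \<Longrightarrow> f x \<noteq> 0"
  shows "analytic_open (\<lambda>x. 1 / f x) V"
proof (rule analytic_openI[where D = "\<lambda>x v. - (inverse (f x) * dir_deriv v f x * inverse (f x))"])
  show "open V" using assms(1) by (rule analytic_open_open)
  show "((\<lambda>x. 1 / f x) has_derivative (\<lambda>v. - (inverse (f x) * dir_deriv v f x * inverse (f x)))) (at x)"
    if "x \<in> V" for x
    using Deriv.has_derivative_inverse[OF assms(2)[OF that] analytic_open_deriv(1)[OF assms(1) that]]
    by (simp add: inverse_eq_divide)
qed (simp add: analytic_open_deriv(2)[OF assms(1)])

lemma analytic_open_divide:
  assumes "analytic_open f V" "analytic_open g V" "\<And>x. x \<in> V \<Longrightarrow> g x \<noteq> 0"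
  shows "analytic_open (\<lambda>x. f x / g x) V"
  using analytic_open_mult[OF assms(1) analytic_open_inverse[OF assms(2,3)]] by simp

lemma analytic_open_sum:
  assumes "open V" "\<And>i. i \<in> I \<Longrightarrow> analytic_open (f i) V"
  shows "analytic_open (\<lambda>x. \<Sum>i\<in>I. f i x) V"
  using assms(2)
  by (induction I rule: infinite_finite_induct) (auto intro: analytic_open_const assms(1) analytic_open_add)

lemma dir_deriv_sum:
  assumes "open V" "x \<in> V" "\<And>i. i \<in> I \<Longrightarrow> analytic_open (f i) V"
  shows "dir_deriv v (\<lambda>x. \<Sum>i\<in>I. f i x) x = (\<Sum>i\<in>I. dir_deriv v (f i) x)"
  using assms(3)
proof (induction I rule: infinite_finite_induct)
  case (insert i I)
  then show ?case
    using dir_deriv_add[OF _ analytic_open_sum[OF assms(1)] assms(2), of "f i" I f v]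
    by simp
qed (auto simp: dir_deriv_const)

lemma clinear_bounded:
  assumes "Vector_Spaces.linear (*s) (*s) (h :: complex ^ 'k \<Rightarrow> complex ^ 'n)"
  shows "bounded_linear h"
proof -
  interpret Vector_Spaces.linear "(*s)" "(*s)" h by fact
  have "linear h"
  proof (rule linearI)
    show "h (x + y) = h x + h y" for x y by (rule add)
    show "h (r *\<^sub>R b) = r *\<^sub>R h b" for r b
      using scale[of "complex_of_real r" b] by (simp add: vector_scalar_mult_def scaleR_vec_def scaleR_conv_of_real)
  qed
  then show ?thesis by (rule linear_conv_bounded_linear[THEN iffD1])
qed

lemma clinear_scale: "Vector_Spaces.linear (*s) (*s) h \<Longrightarrow> h (a *s (v::complex ^ 'k)) = a *s (h v :: complex ^ 'n)"
  by (simp add: Vector_Spaces.linear_iff)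

lemma has_derivative_affine:
  assumes "Vector_Spaces.linear (*s) (*s) (h :: complex ^ 'k \<Rightarrow> complex ^ 'n)"
  shows "((\<lambda>u. b + h u) has_derivative h) (at u)"
  using bounded_linear_imp_has_derivative[OF clinear_bounded[OF assms], of "at u"]
  by (auto intro!: derivative_eq_intros)

lemma analytic_open_affine:
  assumes "analytic_open f V" "Vector_Spaces.linear (*s) (*s) (h :: complex ^ 'k \<Rightarrow> complex ^ 'n)"
    "open U" "\<And>u. u \<in> U \<Longrightarrow> b + h u \<in> V"
  shows "analytic_open (\<lambda>u. f (b + h u)) U"
  by (rule analytic_openI[where D = "\<lambda>u v. dir_deriv (h v) f (b + h u)"])
    (use assms in \<open>auto intro!: has_derivative_compose[OF has_derivative_affine[OF assms(2)] analytic_open_deriv(1)]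
      simp: clinear_scale analytic_open_deriv(2)[OF assms(1)]\<close>)

lemma dir_deriv_affine:
  assumes "analytic_open f V" "Vector_Spaces.linear (*s) (*s) (h :: complex ^ 'k \<Rightarrow> complex ^ 'n)"
    "b + h u \<in> V"
  shows "dir_deriv v (\<lambda>u. f (b + h u)) u = dir_deriv (h v) f (b + h u)"
  by (rule has_derivative_imp_dir_deriv[OF has_derivative_compose[OF has_derivative_affine[OF assms(2)] analytic_open_deriv(1)[OF assms(1,3)]]])
    (simp add: clinear_scale[OF assms(2)] analytic_open_deriv(2)[OF assms(1,3)])

lemmas analytic_open_linear = analytic_open_affine[where b = 0, simplified]
lemmas dir_deriv_linear = dir_deriv_affine[where b = 0, simplified]

lemma DERIV_along_line:
  assumes "analytic_open f V" "x + t *s v \<in> V"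
  shows "((\<lambda>t. f (x + t *s v)) has_field_derivative dir_deriv v f (x + t *s v)) (at t)"
proof -
  have "((\<lambda>s. f ((x + t *s v) + s *s v)) has_field_derivative dir_deriv v f (x + t *s v)) (at 0)"
    by (rule analytic_open_deriv(3)[OF assms])
  then have "((\<lambda>s. f (x + (s + t) *s v)) has_field_derivative dir_deriv v f (x + t *s v)) (at 0)"
    by (simp add: vector_sadd_rdistrib algebra_simps)
  then show ?thesis using DERIV_shift[of "\<lambda>s. f (x + s *s v)" _ 0 t] by simp
qed

text \<open>Cauchy's formula on the circle \<open>x + \<rho> e^{2 \<pi> i t} \<xi>\<close>, written as a parameter integral over
  \<open>[0, 1]\<close>, so that it can be differentiated under the integral sign.\<close>

definition circ :: "real \<Rightarrow> real \<Rightarrow> complex" where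
  "circ \<rho> t = of_real \<rho> * exp (2 * of_real pi * \<i> * of_real t)"

lemma dir_deriv_cauchy:
  assumes "analytic_open f V" "\<rho> > 0" "\<And>t. norm t \<le> \<rho> \<Longrightarrow> x + t *s v \<in> V"
  shows "dir_deriv v f x = integral (cbox 0 1) (\<lambda>t. f (x + circ \<rho> t *s v) / circ \<rho> t)"
    (is "_ = integral _ ?g")
proof -
  let ?h = "\<lambda>t. f (x + t *s v)"
  have d: "(?h has_field_derivative dir_deriv v f (x + t *s v)) (at t)" if "norm t \<le> \<rho>" for t
    using DERIV_along_line[OF assms(1) assms(3)[OF that]] .
  have c: "continuous_on (cball 0 \<rho>) ?h"
    by (intro continuous_at_imp_continuous_on) (auto intro: DERIV_isCont[OF d])
  have hol: "?h holomorphic_on ball 0 \<rho>"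
    unfolding holomorphic_on_def
    by (auto simp: field_differentiable_def intro!: exI has_field_derivative_at_within[OF d])
  have "(?h has_field_derivative (1 / (2 * of_real pi * \<i>) * contour_integral (circlepath 0 \<rho>) (\<lambda>u. ?h u / (u - 0)^2))) (at 0)"
    using Cauchy_derivative_integral_circlepath(2)[OF c hol, of 0] assms(2) by simp
  then have e: "dir_deriv v f x = 1 / (2 * of_real pi * \<i>) * contour_integral (circlepath 0 \<rho>) (\<lambda>u. ?h u / u^2)"
    using d[of 0] assms(2) DERIV_unique by fastforce
  have vd: "vector_derivative (circlepath 0 \<rho>) (at t) = 2 * of_real pi * \<i> * circ \<rho> t" for t
    by (simp add: vector_derivative_circlepath circ_def)
  have cp: "circlepath 0 \<rho> t = circ \<rho> t" for t by (simp add: circlepath circ_def)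
  have nz: "circ \<rho> t \<noteq> 0" for t using assms(2) by (simp add: circ_def)
  have "contour_integral (circlepath 0 \<rho>) (\<lambda>u. ?h u / u^2)
      = integral (cbox 0 1) (\<lambda>t. (2 * of_real pi * \<i>) * ?g t)"
    unfolding contour_integral_integral vd cp
    using nz by (simp add: power2_eq_square field_simps)
  also have "\<dots> = (2 * of_real pi * \<i>) * integral (cbox 0 1) ?g" by (rule integral_mult_right)
  finally show ?thesis unfolding e by simp
qed

section \<open>Directional derivatives of holomorphic functions are holomorphic and commute\<close>

lemma continuous_on_circ [continuous_intros]:
  "continuous_on S f \<Longrightarrow> continuous_on S (\<lambda>x. circ \<rho> (f x))"
  unfolding circ_def by (intro continuous_intros)

lemma circ_nz: "\<rho> > 0 \<Longrightarrow> circ \<rho> t \<noteq> 0"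
  by (simp add: circ_def)

lemma norm_circ: "\<rho> > 0 \<Longrightarrow> norm (circ \<rho> t) = \<rho>"
  by (simp add: circ_def norm_mult exp_eq_polar)

text \<open>Cauchy's formula has to hold with one radius for all points near \<open>x0\<close>;
  otherwise the integral could not be differentiated in the base point.\<close>

lemma local_circle:
  assumes "open V" "x0 \<in> V"
  obtains r \<rho> where "r > 0" "\<rho> > 0"
    "\<And>x t. x \<in> ball x0 r \<Longrightarrow> norm t \<le> \<rho> \<Longrightarrow> x + t *s (v :: complex ^ 'n) \<in> V"
proof -
  obtain e where e: "e > 0" "ball x0 e \<subseteq> V" using assms openE by blast
  obtain B where B: "B > 0" "\<And>t::complex. norm (t *s v) \<le> norm t * B"
    using bounded_linear.pos_bounded[OF bounded_linear_scale_vec] by blast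
  show thesis
  proof (rule that[of "e / 2" "e / (2 * B)"])
    fix x and t :: complex assume "x \<in> ball x0 (e / 2)" "norm t \<le> e / (2 * B)"
    then have "dist x0 x < e / 2" "norm (t *s v) \<le> e / 2"
      using B(2)[of t] mult_right_mono[of "norm t" "e / (2*B)" B] B(1) by auto
    then have "dist x0 (x + t *s v) < e"
      by (smt (verit) dist_norm norm_minus_commute norm_triangle_ineq dist_triangle add_diff_cancel_left' dist_commute field_sum_of_halves)
    then show "x + t *s v \<in> V" using e by auto
  qed (use e B in auto)
qed

text \<open>\<open>analytic_open\<close> only asks for a complex derivative at each point. Cauchy's
  integral depends continuously on its centre, which yields continuity of the derivative.\<close>

lemma dir_deriv_continuous_on:
  assumes "analytic_open f V"
  shows "continuous_on V (dir_deriv v f)"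
proof (rule continuous_at_imp_continuous_on, rule ballI)
  fix x0 assume x0: "x0 \<in> V"
  obtain r \<rho> where r: "r > 0" "\<rho> > 0" and in_V: "\<And>x t. x \<in> ball x0 r \<Longrightarrow> norm t \<le> \<rho> \<Longrightarrow> x + t *s v \<in> V"
    using local_circle[OF analytic_open_open[OF assms] x0] by metis
  have "continuous_on (ball x0 r \<times> cbox 0 1) (\<lambda>(x, t). f (x + circ \<rho> t *s v) / circ \<rho> t)"
    unfolding case_prod_beta
    by (intro continuous_intros continuous_on_compose2[OF analytic_open_continuous_on[OF assms]])
      (auto simp: circ_nz r norm_circ intro!: in_V)
  then have "continuous_on (ball x0 r) (\<lambda>x. integral (cbox 0 1) (\<lambda>t. f (x + circ \<rho> t *s v) / circ \<rho> t))"
    by (rule integral_continuous_on_param)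
  then have "continuous_on (ball x0 r) (dir_deriv v f)"
    using dir_deriv_cauchy[OF assms r(2) in_V] by (simp cong: continuous_on_cong_simp)
  then show "isCont (dir_deriv v f) x0"
    using r(1) continuous_on_eq_continuous_at[OF open_ball] centre_in_ball by blast
qed

text \<open>The Leibniz rule for parameter integrals wants the derivative as a
  \<open>blinfun\<close>. Spelled out through \<open>partial\<close>, the map is bounded linear at
  every point, even where \<open>f\<close> is not differentiable.\<close>

definition grad_blinfun :: "'n::finite func \<Rightarrow> complex ^ 'n \<Rightarrow> (complex ^ 'n) \<Rightarrow>\<^sub>L complex" where
  "grad_blinfun f x = Blinfun (\<lambda>v. \<Sum>i\<in>UNIV. v $ i * partial i f x)"

lemma grad_blinfun_apply: "blinfun_apply (grad_blinfun f x) v = (\<Sum>i\<in>UNIV. v $ i * partial i f x)"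
proof -
  have "bounded_linear (\<lambda>v. \<Sum>i\<in>UNIV. v $ i * partial i f x)"
    by (intro bounded_linear_sum bounded_linear_mult_const bounded_linear_vec_nth)
  then show ?thesis unfolding grad_blinfun_def by (simp add: bounded_linear_Blinfun_apply)
qed

lemma grad_blinfun:
  assumes "analytic_open f V" "x \<in> V"
  shows "blinfun_apply (grad_blinfun f x) = (\<lambda>v. dir_deriv v f x)"
  by (simp add: fun_eq_iff grad_blinfun_apply dir_deriv_expand[OF assms])

lemma continuous_on_grad_blinfun:
  assumes "analytic_open f V"
  shows "continuous_on V (grad_blinfun f)"
proof (rule continuous_on_blinfun_componentwise)
  fix b :: "complex ^ 'a"
  have "continuous_on V (partial i f)" for i
    unfolding partial_def by (rule dir_deriv_continuous_on[OF assms])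
  then show "continuous_on V (\<lambda>x. blinfun_apply (grad_blinfun f x) b)"
    unfolding grad_blinfun_apply by (intro continuous_intros)
qed

text \<open>This is the Leibniz rule applied to Cauchy's formula. The derivative in direction
  \<open>w\<close> is again a Cauchy integral, now of \<open>dir_deriv w f\<close>; complex
  linearity in \<open>w\<close> and the symmetry of second derivatives are both read off from
  it.\<close>

lemma dir_deriv_under_integral:
  assumes f: "analytic_open f V" and x0: "x0 \<in> V"
  obtains D \<rho> where "\<rho> > 0" "\<And>t. norm t \<le> \<rho> \<Longrightarrow> x0 + t *s v \<in> V"
    "(dir_deriv v f has_derivative D) (at x0)"
    "\<And>w. D w = integral (cbox 0 1) (\<lambda>t. dir_deriv w f (x0 + circ \<rho> t *s v) / circ \<rho> t)"
proof -
  obtain r \<rho> where r: "r > 0" "\<rho> > 0" and in_V: "\<And>x t. x \<in> ball x0 r \<Longrightarrow> norm t \<le> \<rho> \<Longrightarrow> x + t *s v \<in> V"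
    using local_circle[OF analytic_open_open[OF f] x0] by metis
  have in_V': "x + circ \<rho> t *s v \<in> V" if "x \<in> ball x0 r" for x t
    using in_V[OF that, of "circ \<rho> t"] by (simp add: norm_circ r)
  let ?F = "\<lambda>x t. f (x + circ \<rho> t *s v) / circ \<rho> t"
  define D where "D = (\<lambda>x t. blinfun_mult_right (1 / circ \<rho> t) o\<^sub>L grad_blinfun f (x + circ \<rho> t *s v))"
  have Dap: "blinfun_apply (D x t) w = dir_deriv w f (x + circ \<rho> t *s v) / circ \<rho> t"
    if "x \<in> ball x0 r" for x t w
    unfolding D_def using grad_blinfun[OF f in_V'[OF that, of t]] by simp
  have 1: "((\<lambda>x. ?F x t) has_derivative blinfun_apply (D x t)) (at x within ball x0 r)"
    if x: "x \<in> ball x0 r" for x t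
  proof -
    have "((\<lambda>x. x + circ \<rho> t *s v) has_derivative (\<lambda>w. w)) (at x)"
      by (auto intro!: derivative_eq_intros)
    from has_derivative_compose[OF this analytic_open_deriv(1)[OF f in_V'[OF x]]]
    have "((\<lambda>x. f (x + circ \<rho> t *s v)) has_derivative (\<lambda>w. dir_deriv w f (x + circ \<rho> t *s v))) (at x)" .
    from has_derivative_mult_right[OF this, of "1 / circ \<rho> t"]
    have "((\<lambda>x. ?F x t) has_derivative (\<lambda>w. dir_deriv w f (x + circ \<rho> t *s v) / circ \<rho> t)) (at x)"
      by simp
    then show ?thesis
      using Dap[OF x] by (metis (no_types, lifting) ext has_derivative_at_withinI)
  qed
  have 2: "continuous_on (ball x0 r \<times> cbox 0 1) (\<lambda>(x, t). D x t)"
    unfolding case_prod_beta D_def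
    by (intro continuous_intros continuous_on_compose2[OF continuous_on_grad_blinfun[OF f]]
        bounded_linear.continuous_on[OF bounded_linear_blinfun_mult_right])
      (auto simp: circ_nz r norm_circ intro!: in_V)
  have cD: "continuous_on (cbox 0 1) (D x0)"
  proof -
    have "continuous_on (cbox 0 1) (\<lambda>t. (\<lambda>(x, t). D x t) (x0, t))"
      by (rule continuous_on_compose2[OF 2]) (auto intro!: continuous_intros simp: r)
    then show ?thesis by simp
  qed
  have 3: "?F x integrable_on cbox 0 1" if "x \<in> ball x0 r" for x
    by (intro integrable_continuous continuous_intros continuous_on_compose2[OF analytic_open_continuous_on[OF f]])
      (auto simp: circ_nz r intro: in_V'[OF that])
  have "((\<lambda>x. integral (cbox 0 1) (?F x)) has_derivative integral (cbox 0 1) (D x0)) (at x0 within ball x0 r)"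
    by (rule leibniz_rule[OF 1 3 2]) (auto simp: r)
  then have "((\<lambda>x. integral (cbox 0 1) (?F x)) has_derivative integral (cbox 0 1) (D x0)) (at x0)"
    using at_within_open[OF _ open_ball, of x0 x0 r] r(1) by simp
  then have "(dir_deriv v f has_derivative integral (cbox 0 1) (D x0)) (at x0)"
    by (rule has_derivative_transform_within_open[OF _ open_ball, of _ _ _ _ x0 r])
      (auto simp: r dir_deriv_cauchy[OF f r(2) in_V])
  moreover have "blinfun_apply (integral (cbox 0 1) (D x0)) w
      = integral (cbox 0 1) (\<lambda>t. dir_deriv w f (x0 + circ \<rho> t *s v) / circ \<rho> t)" for w
    using blinfun_apply_integral[OF integrable_continuous[OF cD], of w] Dap[of x0] r(1) by simp
  moreover have "x0 + t *s v \<in> V" if "norm t \<le> \<rho>" for t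
    using in_V[of x0] that r(1) by simp
  ultimately show thesis using that r(2) by blast
qed

lemma analytic_open_dir_deriv:
  assumes f: "analytic_open f V"
  shows "analytic_open (dir_deriv v f) V"
proof -
  have "\<exists>D. (dir_deriv v f has_derivative D) (at x) \<and> (\<forall>a w. D (a *s w) = a * D w)" if x: "x \<in> V" for x
  proof (rule dir_deriv_under_integral[OF f x, of v])
    fix D \<rho>
    assume r: "\<rho> > 0" and V: "\<And>t. norm t \<le> \<rho> \<Longrightarrow> x + t *s v \<in> V"
      and D: "(dir_deriv v f has_derivative D) (at x)"
        "\<And>w. D w = integral (cbox 0 1) (\<lambda>t. dir_deriv w f (x + circ \<rho> t *s v) / circ \<rho> t)"
    have "D (a *s w) = integral (cbox 0 1) (\<lambda>t. a * (dir_deriv w f (x + circ \<rho> t *s v) / circ \<rho> t))" for a w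
      unfolding D(2) using analytic_open_deriv(2)[OF f V] r by (simp add: norm_circ)
    then have "D (a *s w) = a * D w" for a w unfolding D(2)[of w] by (simp only: integral_mult_right)
    then show ?thesis using D(1) by auto
  qed
  then show ?thesis unfolding analytic_open_def using analytic_open_open[OF f] by blast
qed

text \<open>The integral for the derivative of \<open>dir_deriv v f\<close> in direction
  \<open>w\<close> is at the same time Cauchy's formula for the derivative of
  \<open>dir_deriv w f\<close> in direction \<open>v\<close>.\<close>

lemma dir_deriv_commute:
  assumes f: "analytic_open f V" and x: "x \<in> V"
  shows "dir_deriv w (dir_deriv v f) x = dir_deriv v (dir_deriv w f) x"
proof (rule dir_deriv_under_integral[OF f x, of v])
  fix D \<rho>
  assume r: "\<rho> > 0" and V: "\<And>t. norm t \<le> \<rho> \<Longrightarrow> x + t *s v \<in> V"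
    and D: "(dir_deriv v f has_derivative D) (at x)"
      "\<And>w. D w = integral (cbox 0 1) (\<lambda>t. dir_deriv w f (x + circ \<rho> t *s v) / circ \<rho> t)"
  have "D = (\<lambda>w. dir_deriv w (dir_deriv v f) x)"
    using has_derivative_unique[OF D(1) analytic_open_deriv(1)[OF analytic_open_dir_deriv[OF f] x]] .
  then have "dir_deriv w (dir_deriv v f) x = D w" by (rule fun_cong[OF sym])
  also note D(2)
  also have "integral (cbox 0 1) (\<lambda>t. dir_deriv w f (x + circ \<rho> t *s v) / circ \<rho> t) = dir_deriv v (dir_deriv w f) x"
    by (rule dir_deriv_cauchy[symmetric, OF analytic_open_dir_deriv[OF f] r V])
  finally show "dir_deriv w (dir_deriv v f) x = dir_deriv v (dir_deriv w f) x" .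
qed

lemma analytic_open_partial: "analytic_open f V \<Longrightarrow> analytic_open (partial i f) V"
  unfolding partial_def by (rule analytic_open_dir_deriv)

lemma partial_commute: "analytic_open f V \<Longrightarrow> x \<in> V \<Longrightarrow> partial i (partial j f) x = partial j (partial i f) x"
  unfolding partial_def by (rule dir_deriv_commute)

text \<open>Base point and increment move together here, so differentiability at \<open>x\<close> is
  not enough; continuity of \<open>dir_deriv v f\<close> near \<open>x\<close> gives the uniform
  estimate. It will be applied with \<open>z - h z *s v\<close> the mirror image of
  \<open>z\<close>.\<close>

lemma tendsto_difference_quotient:
  assumes f: "analytic_open f V" and x: "x \<in> V"
    and h: "(h \<longlongrightarrow> 0) (at x within S)" "\<forall>\<^sub>F z in at x within S. h z \<noteq> 0"
  shows "((\<lambda>z. (f z - f (z - h z *s v)) / h z) \<longlongrightarrow> dir_deriv v f x) (at x within S)"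
proof (rule tendstoI)
  fix e :: real assume e: "e > 0"
  let ?L = "dir_deriv v f x"
  have "isCont (dir_deriv v f) x"
    using dir_deriv_continuous_on[OF f] analytic_open_open[OF f] x continuous_on_eq_continuous_at by blast
  then obtain d1 where d1: "d1 > 0" "\<And>y. dist y x < d1 \<Longrightarrow> dist (dir_deriv v f y) ?L < e / 2"
    unfolding continuous_at_eps_delta using half_gt_zero[OF e] by metis
  have op: "open (V \<inter> ball x d1)" "x \<in> V \<inter> ball x d1"
    using analytic_open_open[OF f] x d1(1) by auto
  obtain r \<rho> where r: "r > 0" "\<rho> > 0" and V: "\<And>y t. y \<in> ball x r \<Longrightarrow> norm t \<le> \<rho> \<Longrightarrow> y + t *s v \<in> V \<inter> ball x d1"
    using local_circle[OF op] by metis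
  have "\<forall>\<^sub>F z in at x within S. dist z x < r" using r(1) by (auto simp: eventually_at)
  moreover have "\<forall>\<^sub>F z in at x within S. dist (h z) 0 < \<rho>" using h(1) r(2) by (rule tendstoD)
  ultimately show "\<forall>\<^sub>F z in at x within S. dist ((f z - f (z - h z *s v)) / h z) ?L < e" using h(2)
  proof eventually_elim
    case (elim z)
    \<comment> \<open>Subtracting the linear part leaves a function of \<open>t\<close> whose
      derivative is at most \<open>e / 2\<close> on the disc, so the mean value estimate
      applies.\<close>
    let ?k = "\<lambda>t::complex. f (z + t *s v) - t * ?L"
    have inV: "z + t *s v \<in> V" "dist (z + t *s v) x < d1" if "norm t \<le> norm (h z)" for t :: complex
      using V[of z t] that elim by (auto simp: dist_commute)
    have "norm (?k 0 - ?k (- h z)) \<le> (e / 2) * norm (0 - (- h z))"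
    proof (rule field_differentiable_bound[where S = "cball (0::complex) (norm (h z))"])
      fix t :: complex assume t: "t \<in> cball 0 (norm (h z))"
      show "(?k has_field_derivative dir_deriv v f (z + t *s v) - ?L) (at t within cball 0 (norm (h z)))"
        by (rule has_field_derivative_at_within, rule DERIV_diff[OF DERIV_along_line[OF f inV(1)]])
          (use t in \<open>auto intro!: derivative_eq_intros\<close>)
      show "norm (dir_deriv v f (z + t *s v) - ?L) \<le> e / 2"
        using d1(2)[OF inV(2), of t] t by (simp add: dist_norm)
    qed auto
    then have "norm (f z - f (z - h z *s v) - h z * ?L) \<le> (e / 2) * norm (h z)"
      by (simp add: algebra_simps)
    then have "norm ((f z - f (z - h z *s v) - h z * ?L) / h z) \<le> e / 2"
      using elim by (simp add: norm_divide field_simps)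
    then have "norm ((f z - f (z - h z *s v)) / h z - ?L) \<le> e / 2"
      using elim by (simp add: diff_divide_distrib)
    then show ?case using e by (simp add: dist_norm)
  qed
qed

section \<open>The root system and its reflection group\<close>

text \<open>Roots are encoded by their doubled coordinates.\<close>

type_synonym int4 = "int \<times> int \<times> int \<times> int"

fun root_vec :: "int4 \<Rightarrow> complex ^ 4" where
  "root_vec (a, b, c, d) = (\<chi> i. (if i = 1 then of_int a else if i = 2 then of_int b
     else if i = 3 then of_int c else of_int d) / 2)"

lemma root_vec_nth:
  "root_vec (a, b, c, d) $ 1 = of_int a / 2" "root_vec (a, b, c, d) $ 2 = of_int b / 2"
  "root_vec (a, b, c, d) $ 3 = of_int c / 2" "root_vec (a, b, c, d) $ 4 = of_int d / 2"
  by simp_all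

declare root_vec.simps [simp del]

fun neg4 :: "int4 \<Rightarrow> int4" where "neg4 (a, b, c, d) = (- a, - b, - c, - d)"

fun dot4 :: "int4 \<Rightarrow> int4 \<Rightarrow> int" where
  "dot4 (a, b, c, d) (a', b', c', d') = a * a' + b * b' + c * c' + d * d'"

text \<open>The Cartan number \<open>k\<close> is unchanged by the doubling of the coordinates. On
  pairs of roots \<open>div\<close> is exact; this is the divisibility part of
  \<open>refl4_closed\<close>.\<close>

fun refl4 :: "int4 \<Rightarrow> int4 \<Rightarrow> int4" where
  "refl4 (a, b, c, d) (a', b', c', d') =
     (let k = 2 * dot4 (a, b, c, d) (a', b', c', d') div dot4 (a, b, c, d) (a, b, c, d)
      in (a' - k * a, b' - k * b, c' - k * c, d' - k * d))"

text \<open>One root from each opposite pair, the one whose first nonzero coordinate is positive;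
  likewise in \<open>long4\<close>. Hence finite checks are stated up to
  \<open>neg4\<close>.\<close>

definition short4 :: "int4 list" where
  "short4 = [(2,0,0,0), (0,2,0,0), (0,0,2,0), (0,0,0,2),
     (1,1,1,1), (1,1,1,-1), (1,1,-1,1), (1,1,-1,-1), (1,-1,1,1), (1,-1,1,-1), (1,-1,-1,1), (1,-1,-1,-1)]"

definition long4 :: "int4 list" where
  "long4 = [(2,2,0,0), (2,-2,0,0), (2,0,2,0), (2,0,-2,0), (2,0,0,2), (2,0,0,-2),
     (0,2,2,0), (0,2,-2,0), (0,2,0,2), (0,2,0,-2), (0,0,2,2), (0,0,2,-2)]"

definition short_roots :: "(complex ^ 4) set" where
  "short_roots = root_vec ` set short4 \<union> uminus ` root_vec ` set short4"

definition long_roots :: "(complex ^ 4) set" where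
  "long_roots = root_vec ` set long4 \<union> uminus ` root_vec ` set long4"

lemma root_vec_neg: "root_vec (neg4 t) = - root_vec t"
  by (cases t) (simp add: vec_eq_iff forall_4 root_vec_nth)

lemma bilin_4: "bilin x (y :: complex ^ 4) = x $ 1 * y $ 1 + x $ 2 * y $ 2 + x $ 3 * y $ 3 + x $ 4 * y $ 4"
  by (simp add: bilin_def sum_4)

lemma bilin_root_vec: "bilin (root_vec s) (root_vec t) = of_int (dot4 s t) / 4"
  by (cases s; cases t) (simp add: bilin_4 root_vec_nth field_simps)

lemma inj_root_vec: "inj root_vec"
proof (rule injI)
  fix s t assume "root_vec s = root_vec t"
  then show "s = t" by (cases s; cases t) (simp add: vec_eq_iff forall_4 root_vec_nth)
qed

lemma reflection_root_vec:
  assumes "dot4 s s \<noteq> 0" "dot4 s s dvd 2 * dot4 s t"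
  shows "reflection (root_vec s) (root_vec t) = root_vec (refl4 s t)"
proof -
  define k where "k = 2 * dot4 s t div dot4 s s"
  have "2 * dot4 s t = k * dot4 s s" using assms(2) by (simp add: k_def)
  then have "(2 * of_int (dot4 s t) :: complex) = of_int k * of_int (dot4 s s)"
    by (metis of_int_mult of_int_numeral)
  then have "2 * bilin (root_vec s) (root_vec t) / bilin (root_vec s) (root_vec s) = of_int k"
    using assms(1) by (simp add: bilin_root_vec field_simps)
  then show ?thesis
    unfolding reflection_def
    by (cases s; cases t) (simp add: vec_eq_iff forall_4 root_vec_nth k_def Let_def field_simps)
qed

lemma axis_root_vec:
  "axis 1 1 = root_vec (2,0,0,0)" "axis 2 1 = root_vec (0,2,0,0)"
  "axis 3 1 = root_vec (0,0,2,0)" "axis 4 1 = root_vec (0,0,0,2)"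
  by (simp_all add: vec_eq_iff forall_4 root_vec_nth axis_def)

lemma axis_minus: "axis i (- 1) = - (axis i 1 :: complex ^ 4)"
  by (simp add: vec_eq_iff axis_def)

lemma short_roots_eq:
  "short_roots = {axis i s | i s. s \<in> {1, -1}} \<union> {\<chi> i. s i / 2 | s. \<forall>i. s i \<in> {1, -1}}" (is "_ = ?A \<union> ?B")
proof (intro equalityI subsetI)
  fix x assume "x \<in> ?A \<union> ?B"
  have mem: "root_vec u \<in> short_roots" if "u \<in> set short4 \<or> neg4 u \<in> set short4" for u
    using that unfolding short_roots_def by (metis UnI1 UnI2 image_eqI minus_minus root_vec_neg)
  from \<open>x \<in> ?A \<union> ?B\<close> show "x \<in> short_roots"
  proof
    assume "x \<in> ?A"
    then obtain i s where x: "x = axis i s" "s \<in> {1, -1}" by blast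
    have "axis i (1::complex) \<in> root_vec ` set short4"
      using exhaust_4[of i] by (elim disjE) (simp_all add: axis_root_vec short4_def)
    then show ?thesis using x(2) unfolding short_roots_def x(1)
      by (elim insertE emptyE) (simp_all add: axis_minus)
  next
    assume "x \<in> ?B"
    then obtain s where s: "x = (\<chi> i. s i / 2)" "\<And>i. s i \<in> {1, -1}" by blast
    have x: "x = root_vec (a, b, c, d)" if "s 1 = of_int a" "s 2 = of_int b" "s 3 = of_int c" "s 4 = of_int d" for a b c d
      using that by (simp add: s vec_eq_iff forall_4 root_vec_nth)
    have "\<exists>a\<in>{1,-1}. s i = of_int a" for i using s(2)[of i] by auto
    note ex = this
    obtain a where a: "a \<in> {1,-1}" "s 1 = of_int a" using ex[of 1] by (elim bexE)
    obtain b where b: "b \<in> {1,-1}" "s 2 = of_int b" using ex[of 2] by (elim bexE)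
    obtain c where c: "c \<in> {1,-1}" "s 3 = of_int c" using ex[of 3] by (elim bexE)
    obtain d where d: "d \<in> {1,-1}" "s 4 = of_int d" using ex[of 4] by (elim bexE)
    have "\<forall>a\<in>{1,-1}. \<forall>b\<in>{1,-1}. \<forall>c\<in>{1,-1}. \<forall>d\<in>{1,-1}.
        (a, b, c, d) \<in> set short4 \<or> neg4 (a, b, c, d) \<in> set short4"
      by code_simp
    from bspec[OF bspec[OF bspec[OF bspec[OF this a(1)] b(1)] c(1)] d(1)] show ?thesis
      unfolding x[OF a(2) b(2) c(2) d(2)] by (rule mem)
  qed
next
  have B: "root_vec (a, b, c, d) \<in> ?B" if "a \<in> {1,-1}" "b \<in> {1,-1}" "c \<in> {1,-1}" "d \<in> {1,-1}" for a b c d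
  proof -
    let ?s = "\<lambda>i::4. (if i = 1 then of_int a else if i = 2 then of_int b
     else if i = 3 then of_int c else of_int d) :: complex"
    have "(of_int k :: complex) \<in> {1, -1}" if "k \<in> {1, -1}" for k :: int using that by auto
    then have "\<forall>i. ?s i \<in> {1, -1}" using that by presburger
    moreover have "root_vec (a, b, c, d) = (\<chi> i. ?s i / 2)" by (simp only: root_vec.simps)
    ultimately show ?thesis by (intro CollectI exI[of _ ?s] conjI)
  qed
  have A: "axis i 1 \<in> ?A" "axis i (-1) \<in> ?A" for i by blast+
  have rt: "root_vec t \<in> ?A \<union> ?B" if t: "t \<in> set short4" for t
  proof -
    have "\<forall>t\<in>set short4. t \<in> {(2,0,0,0), (0,2,0,0), (0,0,2,0), (0,0,0,2)} \<or>
      (\<exists>a\<in>{1,-1}. \<exists>b\<in>{1,-1}. \<exists>c\<in>{1,-1}. \<exists>d\<in>{1,-1}. t = (a,b,c,d))"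
      by code_simp
    from bspec[OF this t] show ?thesis
    proof
      assume "t \<in> {(2,0,0,0), (0,2,0,0), (0,0,2,0), (0,0,0,2)}"
      then have "\<exists>i. root_vec t = axis i 1"
        using axis_root_vec by (elim insertE emptyE) metis+
      then show ?thesis using A(1) by (elim exE) (simp only: Un_iff simp_thms)
    next
      assume "\<exists>a\<in>{1,-1}. \<exists>b\<in>{1,-1}. \<exists>c\<in>{1,-1}. \<exists>d\<in>{1,-1}. t = (a,b,c,d)"
      then show ?thesis using B by (elim bexE) (simp only: Un_iff simp_thms)
    qed
  qed
  have ng: "- x \<in> ?A \<union> ?B" if x: "x \<in> ?A \<union> ?B" for x
    using x
  proof
    assume "x \<in> ?A"
    then obtain i s where "x = axis i s" "s \<in> {1, -1}" by blast
    then have "- x = axis i (-1) \<or> - x = axis i 1" by (auto simp: axis_minus)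
    then show ?thesis using A by (elim disjE) (simp_all only: Un_iff simp_thms)
  next
    assume "x \<in> ?B"
    then obtain s where s: "x = (\<chi> i. s i / 2)" "\<forall>i. s i \<in> {1, -1}" by blast
    have "- x = (\<chi> i. (- s i) / 2)" by (simp add: s(1) vec_eq_iff)
    moreover have "\<forall>i. - s i \<in> {1, -1}" using s(2) by auto
    ultimately have "- x \<in> ?B" by (intro CollectI exI[of _ "\<lambda>i. - s i"] conjI)
    then show ?thesis by (rule UnI2)
  qed
  fix x assume "x \<in> short_roots"
  then consider t where "t \<in> set short4" "x = root_vec t" | t where "t \<in> set short4" "x = - root_vec t"
    unfolding short_roots_def by (elim UnE imageE) metis+
  then show "x \<in> ?A \<union> ?B"
  proof cases
    case (1 t)
    show ?thesis unfolding 1(2) by (rule rt[OF 1(1)])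
  next
    case (2 t)
    show ?thesis unfolding 2(2) by (rule ng[OF rt[OF 2(1)]])
  qed
qed

lemma long_roots_eq:
  "long_roots = {axis i s + axis j t | i j s t. i \<noteq> j \<and> s \<in> {1, -1} \<and> t \<in> {1, -1}}" (is "_ = ?A")
proof (intro equalityI subsetI)
  have e: "axis 1 s + axis 2 t = root_vec (a, b, 0, 0)"
    "axis 1 s + axis 3 t = root_vec (a, 0, b, 0)"
    "axis 1 s + axis 4 t = root_vec (a, 0, 0, b)"
    "axis 2 s + axis 3 t = root_vec (0, a, b, 0)"
    "axis 2 s + axis 4 t = root_vec (0, a, 0, b)"
    "axis 3 s + axis 4 t = root_vec (0, 0, a, b)"
    if "s = of_int a / 2" "t = of_int b / 2" for a b s t
    using that by (simp_all add: vec_eq_iff forall_4 root_vec_nth axis_def)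
  {
    fix x assume "x \<in> ?A"
    then obtain i j s t where x: "x = axis i s + axis j t" "i \<noteq> j" "s \<in> {1, -1}" "t \<in> {1, -1}" by blast
    obtain a b :: int where ab: "s = of_int a / 2" "t = of_int b / 2" "a \<in> {2, -2}" "b \<in> {2, -2}"
    proof -
      have "\<exists>a::int. s = of_int a / 2 \<and> a \<in> {2, -2}"
        using x(3) by (auto intro: exI[of _ 2] exI[of _ "-2"])
      moreover have "\<exists>a::int. t = of_int a / 2 \<and> a \<in> {2, -2}"
        using x(4) by (auto intro: exI[of _ 2] exI[of _ "-2"])
      ultimately show thesis using that by blast
    qed
    have mem: "root_vec u \<in> long_roots" if "u \<in> set long4 \<or> neg4 u \<in> set long4" for u
      using that unfolding long_roots_def by (metis UnI1 UnI2 image_eqI minus_minus root_vec_neg)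
    have m: "axis 1 s + axis 2 t \<in> long_roots" "axis 1 s + axis 3 t \<in> long_roots"
      "axis 1 s + axis 4 t \<in> long_roots" "axis 2 s + axis 3 t \<in> long_roots"
      "axis 2 s + axis 4 t \<in> long_roots" "axis 3 s + axis 4 t \<in> long_roots"
      if "s = of_int a / 2" "t = of_int b / 2" "a \<in> {2, -2}" "b \<in> {2, -2}" for a b s t
      unfolding e[OF that(1,2)] using that(3,4) by (intro mem; auto simp: long4_def)+
    show "x \<in> long_roots"
      using exhaust_4[of i] exhaust_4[of j] x(2) m[OF ab] m[OF ab(2,1,4,3)]
      unfolding x(1) by (elim disjE) (simp_all add: add.commute)
  }
  have rt: "root_vec t \<in> ?A" if t: "t \<in> set long4" for t
  proof -
    have A: "axis i (of_int a / 2) + axis j (of_int b / 2) \<in> ?A" if "i \<noteq> j" "a \<in> {2, -2}" "b \<in> {2, -2}"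
      for i j and a b :: int
    proof -
      have "(of_int a / 2 :: complex) \<in> {1, -1}" "(of_int b / 2 :: complex) \<in> {1, -1}" using that by auto
      then show ?thesis using that(1) by blast
    qed
    have "\<forall>t\<in>set long4. \<exists>a\<in>{2,-2}. \<exists>b\<in>{2,-2}.
        t \<in> {(a,b,0,0), (a,0,b,0), (a,0,0,b), (0,a,b,0), (0,a,0,b), (0,0,a,b)}"
      by code_simp
    from bspec[OF this t] obtain a b where ab: "a \<in> {2,-2}" "b \<in> {2,-2}"
      and "t \<in> {(a,b,0,0), (a,0,b,0), (a,0,0,b), (0,a,b,0), (0,a,0,b), (0,0,a,b)}" by (elim bexE)
    then show ?thesis
      using A[of 1 2 a b] A[of 1 3 a b] A[of 1 4 a b] A[of 2 3 a b] A[of 2 4 a b] A[of 3 4 a b]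
      unfolding e[OF refl refl] insert_iff empty_iff by (elim disjE FalseE) (simp_all only: ab, simp_all)
  qed
  have ng: "- x \<in> ?A" if "x \<in> ?A" for x
  proof -
    from that obtain i j s t where x: "x = axis i s + axis j t" "i \<noteq> j" "s \<in> {1, -1}" "t \<in> {1, -1}" by blast
    have "- x = axis i (- s) + axis j (- t)" by (simp add: x vec_eq_iff axis_def)
    moreover have "- s \<in> {1, -1}" "- t \<in> {1, -1}" using x by auto
    ultimately show ?thesis using x(2) by blast
  qed
  fix x assume "x \<in> long_roots"
  then consider t where "t \<in> set long4" "x = root_vec t" | t where "t \<in> set long4" "x = - root_vec t"
    unfolding long_roots_def by (elim UnE imageE) metis+
  then show "x \<in> ?A"
  proof cases
    case (1 t)
    show ?thesis unfolding 1(2) by (rule rt[OF 1(1)])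
  next
    case (2 t)
    show ?thesis unfolding 2(2) by (rule ng[OF rt[OF 2(1)]])
  qed
qed

lemma F4_eq: "F4 = short_roots \<union> long_roots"
  unfolding F4_def short_roots_eq long_roots_eq ..

lemma refl4_closed:
  "\<forall>s\<in>set (short4 @ long4). \<forall>t\<in>set short4. dot4 s s dvd 2 * dot4 s t \<and>
     (refl4 s t \<in> set short4 \<or> neg4 (refl4 s t) \<in> set short4)"
  "\<forall>s\<in>set (short4 @ long4). \<forall>t\<in>set long4. dot4 s s dvd 2 * dot4 s t \<and>
     (refl4 s t \<in> set long4 \<or> neg4 (refl4 s t) \<in> set long4)"
  by code_simp+

lemma refl4_transitive_short:
  "\<forall>t\<in>set short4. t = (0,0,0,2) \<or> (\<exists>s\<in>set (short4 @ long4). refl4 s (0,0,0,2) = t \<or> refl4 s (0,0,0,2) = neg4 t)"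
  by code_simp

lemma refl4_transitive_long:
  "\<forall>t\<in>set long4. \<exists>s\<in>set (short4 @ long4). \<exists>s'\<in>set (short4 @ long4).
     refl4 s (refl4 s' (0,0,2,-2)) = t \<or> refl4 s (refl4 s' (0,0,2,-2)) = neg4 t"
  by code_simp

section \<open>Reflections and the groups they generate\<close>

lemma clinearI:
  assumes "\<And>x y. h (x + y) = h x + h (y :: complex ^ 'k)" "\<And>a x. h (a *s x) = a *s (h x :: complex ^ 'n)"
  shows "Vector_Spaces.linear (*s) (*s) h"
  using assms by (simp add: Vector_Spaces.linear_iff vec.vector_space_axioms)

lemma clinear_minus:
  assumes "Vector_Spaces.linear (*s) (*s) (h :: complex ^ 'k \<Rightarrow> complex ^ 'n)"
  shows "h (- x) = - h x"
proof -
  have "(-1) *s x = - x" "(-1) *s h x = - h x" by (simp_all add: vec_eq_iff)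
  then show ?thesis using clinear_scale[OF assms, of "-1" x] by simp
qed

lemma reflection_linear: "Vector_Spaces.linear (*s) (*s) (reflection \<alpha>)"
  by (rule clinearI) (simp_all add: reflection_def bilin_simps vec_eq_iff algebra_simps add_divide_distrib)

lemma reflection_reflection:
  assumes "bilin \<alpha> \<alpha> \<noteq> 0"
  shows "reflection \<alpha> (reflection \<alpha> x) = x"
  using assms by (simp add: reflection_def bilin_simps vec_eq_iff field_simps)

lemma bilin_reflection_left: "bilin (reflection \<alpha> x) y = bilin x (reflection \<alpha> y)"
  by (simp add: reflection_def bilin_simps bilin_commute[of x \<alpha>])

lemma bilin_reflection:
  assumes "bilin \<alpha> \<alpha> \<noteq> 0"
  shows "bilin (reflection \<alpha> x) (reflection \<alpha> y) = bilin x y"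
  by (simp add: bilin_reflection_left reflection_reflection assms)

lemma reflection_self: "bilin \<alpha> \<alpha> \<noteq> 0 \<Longrightarrow> reflection \<alpha> \<alpha> = - \<alpha>"
  by (simp add: reflection_def vec_eq_iff)

lemma reflection_minus_root: "reflection (- \<alpha>) x = reflection \<alpha> x"
  by (simp add: reflection_def bilin_simps vec_eq_iff)

lemma reflection_minus: "reflection \<alpha> (- x) = - reflection \<alpha> x"
  by (simp add: reflection_def bilin_simps vec_eq_iff)

lemma reflection_fix: "bilin \<alpha> x = 0 \<Longrightarrow> reflection \<alpha> x = x"
  by (simp add: reflection_def)

lemma coxeter_group_comp: "u \<in> coxeter_group R \<Longrightarrow> w \<in> coxeter_group R \<Longrightarrow> u \<circ> w \<in> coxeter_group R"
  by (induction u rule: coxeter_group.induct) (auto simp: comp_assoc intro: coxeter_group.step)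

lemma coxeter_group_reflection: "\<alpha> \<in> R \<Longrightarrow> reflection \<alpha> \<in> coxeter_group R"
  using coxeter_group.step[OF _ coxeter_group.one] by fastforce

lemma coxeter_group_linear: "w \<in> coxeter_group R \<Longrightarrow> Vector_Spaces.linear (*s) (*s) w"
proof (induction w rule: coxeter_group.induct)
  case one
  show ?case by (rule clinearI) simp_all
next
  case (step \<alpha> w)
  then show ?case using Vector_Spaces.linear_compose[OF _ reflection_linear] by blast
qed

locale reflection_stable =
  fixes R :: "(complex ^ 'n) set"
  assumes finite_R: "finite R"
    and nonisotropic: "\<alpha> \<in> R \<Longrightarrow> bilin \<alpha> \<alpha> \<noteq> 0"
    and stable: "\<alpha> \<in> R \<Longrightarrow> \<gamma> \<in> R \<Longrightarrow> reflection \<alpha> \<gamma> \<in> R"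
begin

lemma neg_root: "\<alpha> \<in> R \<Longrightarrow> - \<alpha> \<in> R"
  using stable[of \<alpha> \<alpha>] reflection_self[of \<alpha>] nonisotropic by simp

lemma coxeter_group_bilin: "w \<in> coxeter_group R \<Longrightarrow> bilin (w x) (w y) = bilin x y"
  by (induction w rule: coxeter_group.induct) (simp_all add: bilin_reflection nonisotropic)

lemma coxeter_group_root: "w \<in> coxeter_group R \<Longrightarrow> \<alpha> \<in> R \<Longrightarrow> w \<alpha> \<in> R"
  by (induction w rule: coxeter_group.induct) (simp_all add: stable)

lemma coxeter_group_inverse:
  assumes "w \<in> coxeter_group R"
  obtains w' where "w' \<in> coxeter_group R" "\<And>x. w' (w x) = x" "\<And>x. w (w' x) = x"
proof -
  have "\<exists>w'\<in>coxeter_group R. (\<forall>x. w' (w x) = x) \<and> (\<forall>x. w (w' x) = x)"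
    using assms
  proof (induction w rule: coxeter_group.induct)
    case one
    then show ?case using coxeter_group.one by (intro bexI[of _ id]) auto
  next
    case (step \<alpha> w)
    then obtain w' where w': "w' \<in> coxeter_group R" "\<forall>x. w' (w x) = x" "\<forall>x. w (w' x) = x" by blast
    show ?case
      by (rule bexI[of _ "w' \<circ> reflection \<alpha>"])
        (use w' step nonisotropic in \<open>auto simp: reflection_reflection
          intro: coxeter_group_comp coxeter_group_reflection\<close>)
  qed
  then show thesis using that by blast
qed

lemma coxeter_group_bij_root: assumes "w \<in> coxeter_group R" shows "bij_betw w R R"
proof -
  obtain w' where w': "w' \<in> coxeter_group R" "\<And>x. w' (w x) = x" "\<And>x. w (w' x) = x"
    using coxeter_group_inverse[OF assms] by metis
  show ?thesis
    by (rule bij_betwI[where g = w']) (use w' assms coxeter_group_root in auto)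
qed

text \<open>A linear map is determined by the images of the standard basis vectors; these are roots,
  and so are their images.\<close>

lemma finite_coxeter_group:
  assumes axis: "\<And>i. axis i 1 \<in> R"
  shows "finite (coxeter_group R)"
proof -
  let ?f = "\<lambda>w i. w (axis i (1::complex)) :: complex ^ 'n"
  have "inj_on ?f (coxeter_group R)"
  proof (rule inj_onI, rule ext)
    fix u w x assume u: "u \<in> coxeter_group R" and w: "w \<in> coxeter_group R" and eq: "?f u = ?f w"
    interpret u: Vector_Spaces.linear "(*s)" "(*s)" u using coxeter_group_linear[OF u] .
    interpret w: Vector_Spaces.linear "(*s)" "(*s)" w using coxeter_group_linear[OF w] .
    have "u (axis i 1) = w (axis i 1)" for i using fun_cong[OF eq, of i] by simp
    then show "u x = w x"
      by (subst (1 2) vec_expand[of x]) (simp add: u.sum w.sum u.scale w.scale)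
  qed
  moreover have "?f ` coxeter_group R \<subseteq> PiE UNIV (\<lambda>_. R)"
    using axis coxeter_group_root by (auto simp: PiE_UNIV_domain)
  moreover have "finite (PiE (UNIV :: 'n set) (\<lambda>_. R))" by (intro finite_PiE finite_R) simp
  ultimately show ?thesis using finite_imageD finite_subset by blast
qed

end

lemma short_root_cases:
  assumes "\<alpha> \<in> short_roots"
  obtains t where "t \<in> set short4" "\<alpha> = root_vec t \<or> \<alpha> = - root_vec t"
  using assms unfolding short_roots_def by (elim UnE imageE) metis+

lemma long_root_cases:
  assumes "\<alpha> \<in> long_roots"
  obtains t where "t \<in> set long4" "\<alpha> = root_vec t \<or> \<alpha> = - root_vec t"
  using assms unfolding long_roots_def by (elim UnE imageE) metis+

lemma F4_root_cases:
  assumes "\<alpha> \<in> F4"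
  obtains t where "t \<in> set (short4 @ long4)" "\<alpha> = root_vec t \<or> \<alpha> = - root_vec t"
proof -
  consider "\<alpha> \<in> short_roots" | "\<alpha> \<in> long_roots" using assms unfolding F4_eq by (elim UnE)
  then show thesis
  proof cases
    case 1 from short_root_cases[OF this] that show thesis by (metis UnCI set_append)
  next
    case 2 from long_root_cases[OF this] that show thesis by (metis UnCI set_append)
  qed
qed

lemma short_rootI: "t \<in> set short4 \<or> neg4 t \<in> set short4 \<Longrightarrow> root_vec t \<in> short_roots"
  unfolding short_roots_def by (metis UnI1 UnI2 image_eqI minus_minus root_vec_neg)

lemma long_rootI: "t \<in> set long4 \<or> neg4 t \<in> set long4 \<Longrightarrow> root_vec t \<in> long_roots"
  unfolding long_roots_def by (metis UnI1 UnI2 image_eqI minus_minus root_vec_neg)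

lemma uminus_short: "\<alpha> \<in> short_roots \<Longrightarrow> - \<alpha> \<in> short_roots"
  unfolding short_roots_def by (elim UnE imageE) auto

lemma uminus_long: "\<alpha> \<in> long_roots \<Longrightarrow> - \<alpha> \<in> long_roots"
  unfolding long_roots_def by (elim UnE imageE) auto

lemma norm_root4: "\<forall>t\<in>set short4. dot4 t t = 4" "\<forall>t\<in>set long4. dot4 t t = 8"
  by code_simp+

lemma bilin_short: "\<alpha> \<in> short_roots \<Longrightarrow> bilin \<alpha> \<alpha> = 1"
  by (elim short_root_cases disjE) (simp_all add: bilin_simps bilin_root_vec norm_root4)

lemma bilin_long: "\<alpha> \<in> long_roots \<Longrightarrow> bilin \<alpha> \<alpha> = 2"
  by (elim long_root_cases disjE) (simp_all add: bilin_simps bilin_root_vec norm_root4)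

lemma short_long_disjoint: "short_roots \<inter> long_roots = {}"
  using bilin_short bilin_long by fastforce

lemma reflection_short:
  assumes "\<alpha> \<in> F4" "\<gamma> \<in> short_roots"
  shows "reflection \<alpha> \<gamma> \<in> short_roots"
proof (rule F4_root_cases[OF assms(1)], rule short_root_cases[OF assms(2)])
  fix s t assume s: "s \<in> set (short4 @ long4)" "\<alpha> = root_vec s \<or> \<alpha> = - root_vec s"
    and t: "t \<in> set short4" "\<gamma> = root_vec t \<or> \<gamma> = - root_vec t"
  note cl = bspec[OF bspec[OF refl4_closed(1) s(1)] t(1)]
  have nz: "dot4 s s \<noteq> 0" using s(1) norm_root4 by auto
  have "reflection (root_vec s) (root_vec t) \<in> short_roots"
    unfolding reflection_root_vec[OF nz conjunct1[OF cl]] by (rule short_rootI[OF conjunct2[OF cl]])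
  then show ?thesis using s(2) t(2) uminus_short by (auto simp: reflection_minus_root reflection_minus)
qed

lemma reflection_long:
  assumes "\<alpha> \<in> F4" "\<gamma> \<in> long_roots"
  shows "reflection \<alpha> \<gamma> \<in> long_roots"
proof (rule F4_root_cases[OF assms(1)], rule long_root_cases[OF assms(2)])
  fix s t assume s: "s \<in> set (short4 @ long4)" "\<alpha> = root_vec s \<or> \<alpha> = - root_vec s"
    and t: "t \<in> set long4" "\<gamma> = root_vec t \<or> \<gamma> = - root_vec t"
  note cl = bspec[OF bspec[OF refl4_closed(2) s(1)] t(1)]
  have nz: "dot4 s s \<noteq> 0" using s(1) norm_root4 by auto
  have "reflection (root_vec s) (root_vec t) \<in> long_roots"
    unfolding reflection_root_vec[OF nz conjunct1[OF cl]] by (rule long_rootI[OF conjunct2[OF cl]])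
  then show ?thesis using s(2) t(2) uminus_long by (auto simp: reflection_minus_root reflection_minus)
qed

interpretation F4: reflection_stable F4
proof
  show "finite F4" unfolding F4_eq short_roots_def long_roots_def by simp
  show "bilin \<alpha> \<alpha> \<noteq> 0" if "\<alpha> \<in> F4" for \<alpha>
    using that unfolding F4_eq by (elim UnE) (simp_all add: bilin_short bilin_long)
  show "reflection \<alpha> \<gamma> \<in> F4" if "\<alpha> \<in> F4" "\<gamma> \<in> F4" for \<alpha> \<gamma>
    using that(2) reflection_short[OF that(1)] reflection_long[OF that(1)] unfolding F4_eq by blast
qed

lemma axis_short: "axis i 1 \<in> short_roots"
  unfolding short_roots_eq by blast

lemma axis_F4: "axis i 1 \<in> F4"
  using axis_short F4_eq by blast

lemma finite_W: "finite (coxeter_group F4)"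
  by (rule F4.finite_coxeter_group[OF axis_F4])

lemma W_short: "w \<in> coxeter_group F4 \<Longrightarrow> \<alpha> \<in> short_roots \<Longrightarrow> w \<alpha> \<in> short_roots"
  by (induction w rule: coxeter_group.induct) (simp_all add: reflection_short)

lemma W_long: "w \<in> coxeter_group F4 \<Longrightarrow> \<alpha> \<in> long_roots \<Longrightarrow> w \<alpha> \<in> long_roots"
  by (induction w rule: coxeter_group.induct) (simp_all add: reflection_long)

text \<open>Equality case of the triangle inequality: expanding the sum of the squares of
  \<open>norm (f j - z)\<close> bounds it by zero.\<close>

lemma sum_extremal:
  fixes z :: complex
  assumes "finite J" "\<And>j. j \<in> J \<Longrightarrow> norm (f j) \<le> norm z" "(\<Sum>j\<in>J. f j) = of_nat (card J) * z" "j \<in> J"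
  shows "f j = z"
proof -
  have e: "(norm (f j - z))^2 = (norm (f j))^2 - 2 * Re (f j * cnj z) + (norm z)^2" for j
    by (simp add: cmod_power2) (simp add: power2_eq_square algebra_simps)
  have "Re ((\<Sum>j\<in>J. f j) * cnj z) = real (card J) * (norm z)^2"
    unfolding assms(3) by (simp add: cmod_power2) (simp add: power2_eq_square algebra_simps)
  then have s: "(\<Sum>j\<in>J. Re (f j * cnj z)) = real (card J) * (norm z)^2"
    by (simp only: sum_distrib_right Re_sum)
  have "(\<Sum>j\<in>J. (norm (f j - z))^2) = (\<Sum>j\<in>J. (norm (f j))^2) - 2 * (\<Sum>j\<in>J. Re (f j * cnj z)) + real (card J) * (norm z)^2"
    unfolding e by (simp add: sum.distrib sum_subtractf sum_distrib_left)
  also have "\<dots> \<le> 0"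
  proof -
    have "(\<Sum>j\<in>J. (norm (f j))^2) \<le> (\<Sum>j\<in>J. (norm z)^2)"
      by (intro sum_mono power_mono assms) auto
    then show ?thesis unfolding s by simp
  qed
  finally have "(\<Sum>j\<in>J. (norm (f j - z))^2) \<le> 0" .
  then have "\<forall>j\<in>J. (norm (f j - z))^2 = 0"
    using sum_nonneg_eq_0_iff[OF assms(1), of "\<lambda>j. (norm (f j - z))^2"]
    by (metis antisym sum_nonneg zero_le_power2)
  then show ?thesis using assms(4) by simp
qed

text \<open>An isometry preserving the short roots that fixes a regular vector \<open>v\<close> is trivial. Choose the
  coordinate \<open>i\<close> with \<open>norm (v $ i)\<close> maximal: if \<open>axis i 1\<close> were mapped to a root with all coordinates
  equal to \<open>1/2\<close> or \<open>-1/2\<close>, then \<open>3 * v $ i\<close> would be a signed sum of the other coordinates, which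
  forces them to be equal up to sign.\<close>

lemma regular_fixed_imp_id:
  assumes lin: "Vector_Spaces.linear (*s) (*s) w" and bil: "\<And>x y. bilin (w x) (w y) = bilin x y"
    and short: "\<And>\<alpha>. \<alpha> \<in> short_roots \<Longrightarrow> w \<alpha> \<in> short_roots"
    and reg: "\<And>\<alpha>. \<alpha> \<in> F4 \<Longrightarrow> bilin \<alpha> v \<noteq> 0" and fixed: "w v = v"
  shows "w = id"
proof -
  have vi: "v $ i = bilin (w (axis i 1)) v" for i
    using bil[of "axis i 1" v] fixed by (simp add: bilin_axis_left)
  have nz: "v $ i \<noteq> 0" for i
    using reg[OF axis_F4[of i]] by (simp add: bilin_axis_left)
  have ax: "bilin (axis i s) v = s * v $ i" for i s
  proof -
    have "axis i s = s *s axis i 1" by (simp add: vec_eq_iff axis_def)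
    then show ?thesis by (simp add: bilin_simps bilin_axis_left)
  qed
  have pair: "v $ i \<noteq> s * v $ k" if "i \<noteq> k" "s \<in> {1, -1}" for i k s
  proof -
    have "- s \<in> {1, -1}" "1 \<in> {1, -1 :: complex}" using that by auto
    then have "axis i 1 + axis k (- s) \<in> long_roots" unfolding long_roots_eq using that(1) by blast
    then have "bilin (axis i 1 + axis k (- s)) v \<noteq> 0" using reg F4_eq by blast
    then show ?thesis by (simp add: bilin_simps ax)
  qed
  have axis_case: "w (axis i 1) = axis i 1" if "w (axis i 1) = axis k s" "s \<in> {1, -1}" for i k s
  proof -
    have e: "v $ i = s * v $ k" using vi[of i] by (simp add: that(1) ax)
    then have "k = i" using pair[of i k s] that(2) by blast
    moreover have "s = 1" using e nz[of i] that(2) \<open>k = i\<close> by auto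
    ultimately show ?thesis using that(1) by simp
  qed
  have half_case: "\<exists>j. norm (v $ j) > norm (v $ i)"
    if h: "w (axis i 1) = (\<chi> j. s j / 2)" "\<forall>j. s j \<in> {1, -1}" for i s
  proof (rule ccontr)
    assume "\<not> ?thesis"
    then have le: "norm (v $ j) \<le> norm (v $ i)" for j by (meson not_le)
    have ns: "norm (s j) = 1" for j using h(2) by (auto dest: spec[of _ j])
    have sum: "2 * v $ i = s i * v $ i + (\<Sum>j\<in>-{i}. s j * v $ j)"
    proof -
      have "2 * v $ i = (\<Sum>j\<in>UNIV. s j * v $ j)"
        using vi[of i] by (simp add: h(1) bilin_def mult.commute flip: sum_divide_distrib)
      also have "\<dots> = s i * v $ i + (\<Sum>j\<in>UNIV-{i}. s j * v $ j)"
        by (rule sum.remove) simp_all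
      finally show ?thesis by (simp add: Compl_eq_Diff_UNIV)
    qed
    \<comment> \<open>With a plus sign at \<open>i\<close>, changing it to minus would give a short
      root orthogonal to \<open>v\<close>, against regularity.\<close>
    have "s i \<noteq> 1"
    proof
      assume s1: "s i = 1"
      let ?s = "\<lambda>j. if j = i then -1 else s j"
      have "\<forall>j. ?s j \<in> {1, -1}" using h(2) by simp
      then have "(\<chi> j. ?s j / 2) \<in> short_roots"
        unfolding short_roots_eq by (intro UnI2 CollectI exI[of _ ?s] conjI refl)
      then have "bilin (\<chi> j. ?s j / 2) v \<noteq> 0" using reg F4_eq by blast
      moreover have "bilin (\<chi> j. ?s j / 2) v = (\<Sum>j\<in>UNIV. ?s j * v $ j) / 2"
        by (simp add: bilin_def sum_divide_distrib cong: if_cong)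
      moreover have "(\<Sum>j\<in>UNIV. ?s j * v $ j) = ?s i * v $ i + (\<Sum>j\<in>UNIV-{i}. ?s j * v $ j)"
        by (rule sum.remove) simp_all
      moreover have "(\<Sum>j\<in>UNIV-{i}. ?s j * v $ j) = (\<Sum>j\<in>-{i}. s j * v $ j)"
        by (rule sum.cong) auto
      ultimately show False using sum s1 by simp
    qed
    then have "s i = -1" using h(2) by blast
    moreover have "card (- {i}) = 3" by (simp add: Compl_eq_Diff_UNIV card_Diff_singleton)
    ultimately have "(\<Sum>j\<in>-{i}. s j * v $ j) = of_nat (card (-{i})) * v $ i"
      using sum by (simp add: algebra_simps)
    moreover have "norm (s j * v $ j) \<le> norm (v $ i)" for j
      using le[of j] ns[of j] by (simp add: norm_mult)
    ultimately have eq: "s j * v $ j = v $ i" if "j \<noteq> i" for j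
      using that sum_extremal[of "-{i}" "\<lambda>j. s j * v $ j" "v $ i" j] by simp
    obtain j where "j \<noteq> i" by (metis one_neq_zero)
    then show False using eq[of j] pair[of i j "s j"] h(2) by auto
  qed
  have split: "(\<exists>k s. w (axis i 1) = axis k s \<and> s \<in> {1, -1}) \<or>
      (\<exists>s. w (axis i 1) = (\<chi> j. s j / 2) \<and> (\<forall>j. s j \<in> {1, -1}))" for i
    using short[OF axis_short[of i]] unfolding short_roots_eq by blast
  obtain i where i: "\<And>j. norm (v $ j) \<le> norm (v $ i)"
  proof -
    let ?M = "Max (range (\<lambda>j. norm (v $ j)))"
    have "?M \<in> range (\<lambda>j. norm (v $ j))" by (rule Max_in) auto
    then obtain i where "norm (v $ i) = ?M" by force
    then show thesis using that[of i] Max_ge[of "range (\<lambda>j. norm (v $ j))"] by simp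
  qed
  have wi: "w (axis i 1) = axis i 1"
    using split[of i] axis_case[of i] half_case[of i] i by (metis not_le)
  \<comment> \<open>Size excludes the half roots only for the maximal coordinate. For the other axes
    the image is orthogonal to \<open>axis i 1\<close>, whereas a half root has no vanishing
    coordinate.\<close>
  have wj: "w (axis j 1) = axis j 1" for j
  proof (cases "j = i")
    case False
    then have "bilin (axis j 1) (axis i (1::complex)) = 0"
      unfolding bilin_axis_right by (simp add: axis_def)
    then have "bilin (w (axis j 1)) (axis i 1) = 0"
      using bil[of "axis j 1" "axis i 1"] wi by simp
    then have z: "w (axis j 1) $ i = 0" by (simp add: bilin_axis_right)
    have "\<not> (\<exists>s. w (axis j 1) = (\<chi> j. s j / 2) \<and> (\<forall>j. s j \<in> {1, -1}))"
    proof clarify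
      fix s assume "w (axis j 1) = (\<chi> j. s j / 2)" "\<forall>j. s j \<in> {1, -1::complex}"
      moreover from this have "s i = 0" using z by simp
      ultimately have "(0::complex) \<in> {1, -1}" by metis
      then show False by simp
    qed
    then show ?thesis using split[of j] axis_case[of j] by blast
  qed (simp add: wi)
  interpret Vector_Spaces.linear "(*s)" "(*s)" w by fact
  show ?thesis
  proof
    fix x show "w x = id x" by (subst (1 2) vec_expand[of x]) (simp add: sum scale wj)
  qed
qed

text \<open>Equality in Cauchy-Schwarz means that the roots are proportional, and the lists contain
  at most one root on each line.\<close>

lemma parallel4: "\<forall>s\<in>set (short4 @ long4). \<forall>t\<in>set (short4 @ long4). dot4 s t * dot4 s t = dot4 s s * dot4 t t \<longrightarrow> s = t"
  by code_simp

lemma mirror_eq_imp: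
  assumes "\<alpha> \<in> F4" "\<beta> \<in> F4" "mirror \<alpha> = mirror \<beta>"
  shows "\<alpha> = \<beta> \<or> \<alpha> = - \<beta>"
proof (rule F4_root_cases[OF assms(1)], rule F4_root_cases[OF assms(2)])
  fix s t assume s: "s \<in> set (short4 @ long4)" "\<alpha> = root_vec s \<or> \<alpha> = - root_vec s"
    and t: "t \<in> set (short4 @ long4)" "\<beta> = root_vec t \<or> \<beta> = - root_vec t"
  \<comment> \<open>The component of \<alpha> orthogonal to \<beta> lies in the mirror of \<beta>,
    hence in that of \<alpha>; this forces equality in Cauchy-Schwarz.\<close>
  let ?g = "\<alpha> - (bilin \<alpha> \<beta> / bilin \<beta> \<beta>) *s \<beta>"
  have "bilin \<beta> ?g = 0"
    using F4.nonisotropic[OF assms(2)] by (simp add: bilin_simps bilin_commute[of \<beta> \<alpha>])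
  then have "bilin \<alpha> ?g = 0" using assms(3) unfolding mirror_def by blast
  then have "bilin \<alpha> \<beta> * bilin \<alpha> \<beta> = bilin \<alpha> \<alpha> * bilin \<beta> \<beta>"
    using F4.nonisotropic[OF assms(2)] by (simp add: bilin_simps field_simps)
  then have "of_int (dot4 s t * dot4 s t) = (of_int (dot4 s s * dot4 t t) :: complex)"
    using s(2) t(2) by (auto simp: bilin_simps bilin_root_vec field_simps)
  then have "dot4 s t * dot4 s t = dot4 s s * dot4 t t" by (simp only: of_int_eq_iff)
  then have "s = t" using parallel4 s(1) t(1) by blast
  then show ?thesis using s(2) t(2) by auto
qed

lemma generic_pointsD:
  assumes "x \<in> generic_points F4 \<beta>" "\<alpha> \<in> F4" "bilin \<alpha> x = 0" "\<beta> \<in> F4"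
  shows "\<alpha> = \<beta> \<or> \<alpha> = - \<beta>"
  using assms mirror_eq_imp unfolding generic_points_def mirror_def by blast

text \<open>A group element that fixes \<open>x\<close> and \<beta> also fixes
  \<open>x + t *s \<beta>\<close>. For all but finitely many \<open>t\<close> this vector lies on no
  mirror, and \<open>regular_fixed_imp_id\<close> applies. An arbitrary element of the stabilizer
  maps \<beta> to a root orthogonal to \<open>x\<close>, hence to \<beta> or its negative, and the
  reflection in \<beta> corrects the sign.\<close>

lemma stabilizer:
  assumes \<beta>: "\<beta> \<in> F4" and x: "bilin \<beta> x = 0" "\<And>\<alpha>. \<alpha> \<in> F4 \<Longrightarrow> bilin \<alpha> x = 0 \<Longrightarrow> \<alpha> = \<beta> \<or> \<alpha> = - \<beta>"
    and w: "w \<in> coxeter_group F4" "w x = x"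
  shows "w = id \<or> w = reflection \<beta>"
proof -
  have key: "u = id" if u: "u \<in> coxeter_group F4" "u x = x" "u \<beta> = \<beta>" for u
  proof -
    have "finite ((\<lambda>\<alpha>. - bilin \<alpha> x / bilin \<alpha> \<beta>) ` F4 \<union> {0})" using F4.finite_R by simp
    then obtain t where t: "t \<notin> (\<lambda>\<alpha>. - bilin \<alpha> x / bilin \<alpha> \<beta>) ` F4 \<union> {0}"
      using ex_new_if_finite infinite_UNIV_char_0 by blast
    have lin: "Vector_Spaces.linear (*s) (*s) u" using coxeter_group_linear[OF u(1)] .
    show ?thesis
    proof (rule regular_fixed_imp_id[OF lin, of "x + t *s \<beta>"])
      show "u (x + t *s \<beta>) = x + t *s \<beta>"
        using lin u(2,3) by (simp add: Vector_Spaces.linear_iff)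
      show "bilin \<alpha> (x + t *s \<beta>) \<noteq> 0" if "\<alpha> \<in> F4" for \<alpha>
      proof
        assume 0: "bilin \<alpha> (x + t *s \<beta>) = 0"
        show False
        proof (cases "bilin \<alpha> \<beta> = 0")
          case True
          then have "bilin \<alpha> x = 0" using 0 by (simp add: bilin_simps)
          then have "\<alpha> = \<beta> \<or> \<alpha> = - \<beta>" using x(2) that by blast
          then show False using True F4.nonisotropic[OF \<beta>] by (auto simp: bilin_simps)
        next
          case False
          then have "t = - bilin \<alpha> x / bilin \<alpha> \<beta>"
            using 0 by (simp add: bilin_simps field_simps eq_neg_iff_add_eq_0)
          then show False using t that by blast
        qed
      qed
    qed (use u(1) F4.coxeter_group_bilin W_short in auto)
  qed
  have "bilin (w \<beta>) x = 0" using F4.coxeter_group_bilin[OF w(1), of \<beta> x] w(2) x(1) by simp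
  then consider "w \<beta> = \<beta>" | "w \<beta> = - \<beta>" using x(2) F4.coxeter_group_root[OF w(1) \<beta>] by blast
  then show ?thesis
  proof cases
    case 1
    then show ?thesis using key w by blast
  next
    case 2
    have "reflection \<beta> \<circ> w = id"
      using 2 w x(1) \<beta> F4.nonisotropic[OF \<beta>]
      by (intro key) (auto intro: coxeter_group.step simp: reflection_fix reflection_minus reflection_self)
    then have "reflection \<beta> (w y) = y" for y by (metis comp_apply id_apply)
    then have "w = reflection \<beta>" using reflection_reflection[OF F4.nonisotropic[OF \<beta>]] by (metis ext)
    then show ?thesis ..
  qed
qed

text \<open>The identity or a single reflection reaches \<gamma> up to sign; a wrong sign is
  repaired by first reflecting in \<open>axis 4 1\<close>, which negates it.\<close>

lemma short_transitive_from_axis: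
  assumes "\<gamma> \<in> short_roots"
  obtains w where "w \<in> coxeter_group F4" "w (axis 4 1) = \<gamma>"
proof -
  obtain t where t: "t \<in> set short4" "\<gamma> = root_vec t \<or> \<gamma> = - root_vec t"
    using assms by (rule short_root_cases)
  have "\<exists>w\<in>coxeter_group F4. w (axis 4 1) = root_vec t \<or> w (axis 4 1) = - root_vec t"
  proof (cases "t = (0,0,0,2)")
    case True
    then show ?thesis using coxeter_group.one by (intro bexI[of _ id]) (simp_all add: axis_root_vec)
  next
    case False
    then obtain s where s: "s \<in> set (short4 @ long4)" "refl4 s (0,0,0,2) = t \<or> refl4 s (0,0,0,2) = neg4 t"
      using refl4_transitive_short t(1) by blast
    have m: "(0,0,0,2) \<in> set short4" by (simp add: short4_def)
    have nz: "dot4 s s \<noteq> 0" using s(1) norm_root4 by auto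
    have "root_vec s \<in> F4" using s(1) unfolding F4_eq short_roots_def long_roots_def by auto
    moreover have "reflection (root_vec s) (axis 4 1) = root_vec (refl4 s (0,0,0,2))"
      unfolding axis_root_vec
      using reflection_root_vec[OF nz] bspec[OF bspec[OF refl4_closed(1) s(1)] m] by blast
    ultimately show ?thesis
      using s(2) root_vec_neg by (metis coxeter_group_reflection)
  qed
  then obtain w where w: "w \<in> coxeter_group F4" "w (axis 4 1) = \<gamma> \<or> w (axis 4 1) = - \<gamma>"
    using t(2) by (metis minus_minus)
  show thesis
  proof (cases "w (axis 4 1) = \<gamma>")
    case False
    then have "w (axis 4 1) = - \<gamma>" using w(2) by blast
    moreover have "w (- axis 4 1) = - w (axis 4 1)"
      using coxeter_group_linear[OF w(1)] by (rule clinear_minus)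
    ultimately have "(w \<circ> reflection (axis 4 1)) (axis 4 1) = \<gamma>"
      by (simp add: reflection_self F4.nonisotropic axis_F4)
    then show thesis using that coxeter_group_comp[OF w(1) coxeter_group_reflection[OF axis_F4]] by blast
  qed (use that w in blast)
qed

text \<open>The base root is \<open>sqrt2 *s duality (axis 4 1)\<close>; this choice lets the two
  lengths share the coordinates of \<open>F4_frame\<close>.\<close>

lemma long_transitive_from_root:
  assumes "\<gamma> \<in> long_roots"
  obtains w where "w \<in> coxeter_group F4" "w (root_vec (0,0,2,-2)) = \<gamma>"
proof -
  let ?r = "root_vec (0,0,2,-2)"
  have r: "?r \<in> long_roots" by (rule long_rootI) (simp add: long4_def)
  then have rF: "?r \<in> F4" using F4_eq by blast
  obtain t where t: "t \<in> set long4" "\<gamma> = root_vec t \<or> \<gamma> = - root_vec t"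
    using assms by (rule long_root_cases)
  obtain s s' where s: "s \<in> set (short4 @ long4)" "s' \<in> set (short4 @ long4)"
      "refl4 s (refl4 s' (0,0,2,-2)) = t \<or> refl4 s (refl4 s' (0,0,2,-2)) = neg4 t"
    using refl4_transitive_long t(1) by blast
  have nz: "dot4 s s \<noteq> 0" "dot4 s' s' \<noteq> 0" using s(1,2) norm_root4 by auto
  have sF: "root_vec s \<in> F4" "root_vec s' \<in> F4"
    using s(1,2) unfolding F4_eq short_roots_def long_roots_def by auto
  have m: "(0,0,2,-2) \<in> set long4" by (simp add: long4_def)
  define u where "u = refl4 s' (0,0,2,-2)"
  note cl = bspec[OF bspec[OF refl4_closed(2) s(2)] m, folded u_def]
  have 1: "reflection (root_vec s') ?r = root_vec u"
    unfolding u_def using reflection_root_vec[OF nz(2)] conjunct1[OF cl] by blast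
  have "dot4 s s dvd 2 * dot4 s u"
  proof (cases "u \<in> set long4")
    case True
    then show ?thesis using bspec[OF bspec[OF refl4_closed(2) s(1)]] by blast
  next
    case False
    then have "neg4 u \<in> set long4" using cl by blast
    then have "dot4 s s dvd 2 * dot4 s (neg4 u)" using bspec[OF bspec[OF refl4_closed(2) s(1)]] by blast
    moreover have "2 * dot4 s (neg4 u) = - (2 * dot4 s u)" by (cases s; cases u) simp
    ultimately show ?thesis by simp
  qed
  then have "reflection (root_vec s) (root_vec u) = root_vec (refl4 s u)"
    by (rule reflection_root_vec[OF nz(1)])
  then have e: "(reflection (root_vec s) \<circ> reflection (root_vec s')) ?r = root_vec (refl4 s u)"
    using 1 by simp
  have "reflection (root_vec s) \<circ> reflection (root_vec s') \<in> coxeter_group F4"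
    by (intro coxeter_group_comp coxeter_group_reflection sF)
  then obtain w where w: "w \<in> coxeter_group F4" "w ?r = \<gamma> \<or> w ?r = - \<gamma>"
    using e s(3) t(2) root_vec_neg unfolding u_def by (metis minus_minus)
  show thesis
  proof (cases "w ?r = \<gamma>")
    case False
    then have "w ?r = - \<gamma>" using w(2) by blast
    moreover have "w (- ?r) = - w ?r"
      using coxeter_group_linear[OF w(1)] by (rule clinear_minus)
    ultimately have "(w \<circ> reflection ?r) ?r = \<gamma>"
      by (simp add: reflection_self F4.nonisotropic rF)
    then show thesis using that coxeter_group_comp[OF w(1) coxeter_group_reflection[OF rF]] by blast
  qed (use that w in blast)
qed

lemma root_orbit_short: assumes "\<beta> \<in> short_roots" shows "root_orbit F4 \<beta> = short_roots"
proof (intro equalityI subsetI)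
  fix \<gamma> assume "\<gamma> \<in> short_roots"
  obtain u where u: "u \<in> coxeter_group F4" "u (axis 4 1) = \<beta>" using assms by (rule short_transitive_from_axis)
  obtain w where w: "w \<in> coxeter_group F4" "w (axis 4 1) = \<gamma>" using \<open>\<gamma> \<in> short_roots\<close> by (rule short_transitive_from_axis)
  obtain u' where u': "u' \<in> coxeter_group F4" "\<And>x. u' (u x) = x" using u(1) by (rule F4.coxeter_group_inverse) blast
  have "(w \<circ> u') \<beta> = \<gamma>" using u(2) u'(2) w(2) by auto
  then show "\<gamma> \<in> root_orbit F4 \<beta>"
    unfolding root_orbit_def using coxeter_group_comp[OF w(1) u'(1)] by blast
qed (use W_short[OF _ assms] in \<open>auto simp: root_orbit_def\<close>)

lemma root_orbit_long: assumes "\<beta> \<in> long_roots" shows "root_orbit F4 \<beta> = long_roots"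
proof (intro equalityI subsetI)
  fix \<gamma> assume "\<gamma> \<in> long_roots"
  obtain u where u: "u \<in> coxeter_group F4" "u (root_vec (0,0,2,-2)) = \<beta>" using assms by (rule long_transitive_from_root)
  obtain w where w: "w \<in> coxeter_group F4" "w (root_vec (0,0,2,-2)) = \<gamma>" using \<open>\<gamma> \<in> long_roots\<close> by (rule long_transitive_from_root)
  obtain u' where u': "u' \<in> coxeter_group F4" "\<And>x. u' (u x) = x" using u(1) by (rule F4.coxeter_group_inverse) blast
  have "(w \<circ> u') \<beta> = \<gamma>" using u(2) u'(2) w(2) by auto
  then show "\<gamma> \<in> root_orbit F4 \<beta>"
    unfolding root_orbit_def using coxeter_group_comp[OF w(1) u'(1)] by blast
qed (use W_long[OF _ assms] in \<open>auto simp: root_orbit_def\<close>)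

text \<open>The isometry \<open>duality\<close> interchanges the two lengths up to the scaling by the square root of 2.\<close>

definition sqrt2 :: complex where "sqrt2 = of_real (sqrt 2)"

lemma sqrt2: "sqrt2 * sqrt2 = 2" "sqrt2 * (sqrt2 * a) = 2 * a" "sqrt2 \<noteq> 0"
proof -
  show "sqrt2 * sqrt2 = 2" "sqrt2 \<noteq> 0" unfolding sqrt2_def by (simp_all flip: of_real_mult)
  then show "sqrt2 * (sqrt2 * a) = 2 * a" by (metis mult.assoc)
qed

definition duality :: "complex ^ 4 \<Rightarrow> complex ^ 4" where
  "duality x = (\<chi> i. sqrt2 / 2 * (if i = 1 then x $ 1 + x $ 2 else if i = 2 then x $ 1 - x $ 2
     else if i = 3 then x $ 3 + x $ 4 else x $ 3 - x $ 4))"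

lemma duality_nth: "duality x $ 1 = sqrt2 / 2 * (x $ 1 + x $ 2)" "duality x $ 2 = sqrt2 / 2 * (x $ 1 - x $ 2)"
  "duality x $ 3 = sqrt2 / 2 * (x $ 3 + x $ 4)" "duality x $ 4 = sqrt2 / 2 * (x $ 3 - x $ 4)"
  by (simp_all add: duality_def)

lemma duality_linear: "Vector_Spaces.linear (*s) (*s) duality"
  by (rule clinearI) (simp_all add: vec_eq_iff forall_4 duality_nth algebra_simps)

lemma duality_duality: "duality (duality x) = x"
  by (simp add: vec_eq_iff forall_4 duality_nth sqrt2 field_simps)

lemma bilin_duality: "bilin (duality x) (duality y) = bilin x y"
proof -
  have "(sqrt2 / 2 * a) * (sqrt2 / 2 * b) = a * b / 2" for a b by (simp add: sqrt2 field_simps)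
  then show ?thesis unfolding bilin_4 duality_nth by (simp add: sqrt2 field_simps)
qed

fun dual4 :: "int4 \<Rightarrow> int4" where "dual4 (a, b, c, d) = (a + b, a - b, c + d, c - d)"
fun half4 :: "int4 \<Rightarrow> int4" where "half4 (a, b, c, d) = (a div 2, b div 2, c div 2, d div 2)"
fun dbl4 :: "int4 \<Rightarrow> int4" where "dbl4 (a, b, c, d) = (2 * a, 2 * b, 2 * c, 2 * d)"

lemma duality_root: "duality (root_vec t) = (sqrt2 / 2) *s root_vec (dual4 t)"
  by (cases t) (simp add: vec_eq_iff forall_4 duality_nth root_vec_nth field_simps)

lemma root_dbl: "root_vec (dbl4 t) = 2 *s root_vec t"
  by (cases t) (simp add: vec_eq_iff forall_4 root_vec_nth)

lemma dual4_short: "\<forall>t\<in>set short4. dual4 t \<in> set long4 \<or> neg4 (dual4 t) \<in> set long4"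
  by code_simp

lemma dual4_long: "\<forall>t\<in>set long4. dbl4 (half4 (dual4 t)) = dual4 t \<and>
  (half4 (dual4 t) \<in> set short4 \<or> neg4 (half4 (dual4 t)) \<in> set short4)"
  by code_simp

lemma duality_minus: "duality (- x) = - duality x"
  by (simp add: vec_eq_iff forall_4 duality_nth field_simps sqrt2)

lemma duality_scale: "duality (a *s x) = a *s duality x"
  using duality_linear by (rule clinear_scale)

lemma duality_short: "\<alpha> \<in> short_roots \<Longrightarrow> sqrt2 *s duality \<alpha> \<in> long_roots"
proof (elim short_root_cases)
  fix t assume t: "t \<in> set short4" "\<alpha> = root_vec t \<or> \<alpha> = - root_vec t"
  have "sqrt2 *s duality (root_vec t) = root_vec (dual4 t)"
    by (simp add: duality_root sqrt2 vector_smult_assoc)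
  moreover have "root_vec (dual4 t) \<in> long_roots" using dual4_short t(1) by (blast intro: long_rootI)
  ultimately show ?thesis using t(2) uminus_long by (auto simp: duality_minus vector_smult_rneg)
qed

lemma duality_long: "\<alpha> \<in> long_roots \<Longrightarrow> (sqrt2 / 2) *s duality \<alpha> \<in> short_roots"
proof (elim long_root_cases)
  fix t assume t: "t \<in> set long4" "\<alpha> = root_vec t \<or> \<alpha> = - root_vec t"
  have "(sqrt2 / 2) *s duality (root_vec t) = (sqrt2 / 2 * (sqrt2 / 2)) *s root_vec (dbl4 (half4 (dual4 t)))"
    using dual4_long t(1) by (simp add: duality_root vector_smult_assoc)
  also have "\<dots> = root_vec (half4 (dual4 t))"
    by (simp add: root_dbl vector_smult_assoc sqrt2)
  finally have "(sqrt2 / 2) *s duality (root_vec t) = root_vec (half4 (dual4 t))" .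
  moreover have "root_vec (half4 (dual4 t)) \<in> short_roots" using dual4_long t(1) by (blast intro: short_rootI)
  ultimately show ?thesis using t(2) uminus_short by (auto simp: duality_minus vector_smult_rneg)
qed

text \<open>Puts both lengths of \<beta> into one normal form: in the frame \<open>A\<close> the
  orbit of \<beta> looks like the short roots and \<beta> like \<open>axis 4 1\<close>. The scalars
  \<open>p\<close> and \<open>q\<close> only rescale roots, to which reflections, mirrors and the
  terms of a Dunkl operator are insensitive.\<close>

locale F4_frame =
  fixes \<beta> :: "complex ^ 4" and A :: "complex ^ 4 \<Rightarrow> complex ^ 4" and p q :: complex
  assumes lin: "Vector_Spaces.linear (*s) (*s) A"
    and bil: "bilin (A x) (A y) = bilin x y"
    and surjA: "surj A"
    and pq: "p \<noteq> 0" "q \<noteq> 0"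
    and orbit: "root_orbit F4 \<beta> = (\<lambda>\<alpha>. p *s A \<alpha>) ` short_roots"
    and other: "F4 - root_orbit F4 \<beta> = (\<lambda>\<alpha>. q *s A \<alpha>) ` long_roots"
    and root: "\<beta> = p *s A (axis 4 1)"

lemma F4_frame_exists:
  assumes "\<beta> \<in> F4"
  obtains A p q where "F4_frame \<beta> A p q"
proof (cases "\<beta> \<in> short_roots")
  case True
  obtain w where w: "w \<in> coxeter_group F4" "w (axis 4 1) = \<beta>" using True by (rule short_transitive_from_axis)
  obtain w' where w': "w' \<in> coxeter_group F4" "\<And>x. w' (w x) = x" "\<And>x. w (w' x) = x"
    using w(1) by (rule F4.coxeter_group_inverse) blast
  have o: "root_orbit F4 \<beta> = short_roots" using True by (rule root_orbit_short)
  have "F4_frame \<beta> w 1 1"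
  proof (rule F4_frame.intro)
    show "root_orbit F4 \<beta> = (\<lambda>\<alpha>. 1 *s w \<alpha>) ` short_roots"
      unfolding o using w w' W_short by (auto simp: image_iff) metis
    have "F4 - root_orbit F4 \<beta> = long_roots" unfolding o using short_long_disjoint F4_eq by blast
    then show "F4 - root_orbit F4 \<beta> = (\<lambda>\<alpha>. 1 *s w \<alpha>) ` long_roots"
      using w w' W_long by (auto simp: image_iff) metis
    show "surj w" using w'(3) by (metis surjI)
  qed (simp_all add: w(2) coxeter_group_linear[OF w(1)] F4.coxeter_group_bilin[OF w(1)])
  then show thesis by (rule that)
next
  case False
  then have long: "\<beta> \<in> long_roots" using assms F4_eq by blast
  obtain w where w: "w \<in> coxeter_group F4" "w (root_vec (0,0,2,-2)) = \<beta>" using long by (rule long_transitive_from_root)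
  obtain w' where w': "w' \<in> coxeter_group F4" "\<And>x. w' (w x) = x" "\<And>x. w (w' x) = x"
    using w(1) by (rule F4.coxeter_group_inverse) blast
  have o: "root_orbit F4 \<beta> = long_roots" using long by (rule root_orbit_long)
  have sc: "w (a *s x) = a *s w x" for a x using coxeter_group_linear[OF w(1)] by (rule clinear_scale)
  \<comment> \<open>\<open>duality\<close> preserves length, so images of short roots are stretched
    by \<open>sqrt2\<close> to become long roots, and images of long roots shrunk by the same ratio,
    \<open>sqrt2 / 2\<close>, to become short ones.\<close>
  have "F4_frame \<beta> (w \<circ> duality) sqrt2 (sqrt2 / 2)"
  proof (rule F4_frame.intro)
    show "Vector_Spaces.linear (*s) (*s) (w \<circ> duality)"
      by (rule Vector_Spaces.linear_compose[OF duality_linear coxeter_group_linear[OF w(1)]])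
    show "bilin ((w \<circ> duality) x) ((w \<circ> duality) y) = bilin x y" for x y
      by (simp add: F4.coxeter_group_bilin[OF w(1)] bilin_duality)
    show "surj (w \<circ> duality)" by (rule surjI[of _ "duality \<circ> w'"]) (simp add: duality_duality w'(3))
    show "root_orbit F4 \<beta> = (\<lambda>\<alpha>. sqrt2 *s (w \<circ> duality) \<alpha>) ` short_roots"
    proof (intro equalityI subsetI)
      fix \<gamma> assume "\<gamma> \<in> root_orbit F4 \<beta>"
      then have "(sqrt2 / 2) *s duality (w' \<gamma>) \<in> short_roots"
        unfolding o using W_long[OF w'(1)] duality_long by blast
      moreover have "\<gamma> = sqrt2 *s (w \<circ> duality) ((sqrt2 / 2) *s duality (w' \<gamma>))"
        by (simp add: duality_scale duality_duality sc w'(3) vector_smult_assoc sqrt2)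
      ultimately show "\<gamma> \<in> (\<lambda>\<alpha>. sqrt2 *s (w \<circ> duality) \<alpha>) ` short_roots" by blast
    next
      fix \<gamma> assume "\<gamma> \<in> (\<lambda>\<alpha>. sqrt2 *s (w \<circ> duality) \<alpha>) ` short_roots"
      then show "\<gamma> \<in> root_orbit F4 \<beta>"
        unfolding o using W_long[OF w(1) duality_short] by (auto simp: sc)
    qed
    have "F4 - root_orbit F4 \<beta> = short_roots" unfolding o using short_long_disjoint F4_eq by blast
    moreover have "short_roots = (\<lambda>\<alpha>. (sqrt2 / 2) *s (w \<circ> duality) \<alpha>) ` long_roots"
    proof (intro equalityI subsetI)
      fix \<gamma> assume "\<gamma> \<in> short_roots"
      then have "sqrt2 *s duality (w' \<gamma>) \<in> long_roots"
        using W_short[OF w'(1)] duality_short by blast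
      moreover have "\<gamma> = (sqrt2 / 2) *s (w \<circ> duality) (sqrt2 *s duality (w' \<gamma>))"
        by (simp add: duality_scale duality_duality sc w'(3) vector_smult_assoc sqrt2)
      ultimately show "\<gamma> \<in> (\<lambda>\<alpha>. (sqrt2 / 2) *s (w \<circ> duality) \<alpha>) ` long_roots" by blast
    next
      fix \<gamma> assume "\<gamma> \<in> (\<lambda>\<alpha>. (sqrt2 / 2) *s (w \<circ> duality) \<alpha>) ` long_roots"
      then show "\<gamma> \<in> short_roots" using W_short[OF w(1) duality_long] by (auto simp: sc)
    qed
    ultimately show "F4 - root_orbit F4 \<beta> = (\<lambda>\<alpha>. (sqrt2 / 2) *s (w \<circ> duality) \<alpha>) ` long_roots" by simp
    have "dual4 (0,0,0,2) = (0,0,2,-2)" by simp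
    then have "duality (axis 4 1) = (sqrt2 / 2) *s root_vec (0,0,2,-2)"
      by (simp only: axis_root_vec duality_root)
    then show "\<beta> = sqrt2 *s (w \<circ> duality) (axis 4 1)"
      by (simp add: sc w(2) vector_smult_assoc sqrt2)
  qed (use sqrt2 in auto)
  then show thesis by (rule that)
qed

section \<open>Restriction of the Dunkl Laplacian\<close>

text \<open>\<open>regular_exists\<close> makes the regular points dense, so that the limit in
  \<open>dunkl\<close> is taken along a nontrivial filter; \<open>R_ne\<close> guarantees that a
  regular vector is nonzero.\<close>

locale dunkl_system = reflection_stable R
  for R :: "(complex ^ 'n) set" +
  fixes Rp :: "(complex ^ 'n) set" and m :: "complex ^ 'n \<Rightarrow> complex"
  assumes R_ne: "R \<noteq> {}"
    and Rp_sub: "Rp \<subseteq> R"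
    and Rp_half: "\<alpha> \<in> R \<Longrightarrow> - \<alpha> \<in> Rp \<longleftrightarrow> \<alpha> \<notin> Rp"
    and m_inv: "\<alpha> \<in> R \<Longrightarrow> \<gamma> \<in> R \<Longrightarrow> m (reflection \<alpha> \<gamma>) = m \<gamma>"
    and regular_exists: "\<exists>v. \<forall>\<alpha>\<in>R. bilin \<alpha> v \<noteq> 0"
begin

lemma finite_Rp: "finite Rp"
  using finite_R Rp_sub finite_subset by blast

lemma m_minus: "\<alpha> \<in> R \<Longrightarrow> m (- \<alpha>) = m \<alpha>"
  using m_inv[of \<alpha> \<alpha>] reflection_self[OF nonisotropic] by metis

lemma sum_positive:
  fixes g :: "complex ^ 'n \<Rightarrow> complex"
  assumes "\<And>\<alpha>. \<alpha> \<in> R \<Longrightarrow> g (- \<alpha>) = g \<alpha>"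
  shows "(\<Sum>\<alpha>\<in>R. g \<alpha>) = 2 * (\<Sum>\<alpha>\<in>Rp. g \<alpha>)"
proof -
  have "R = Rp \<union> uminus ` Rp"
  proof (intro equalityI subsetI)
    fix \<alpha> assume "\<alpha> \<in> R"
    then show "\<alpha> \<in> Rp \<union> uminus ` Rp" using Rp_half by (metis UnCI image_eqI minus_minus)
  qed (use Rp_sub neg_root in auto)
  moreover have "Rp \<inter> uminus ` Rp = {}" using Rp_half Rp_sub by blast
  ultimately have "(\<Sum>\<alpha>\<in>R. g \<alpha>) = (\<Sum>\<alpha>\<in>Rp. g \<alpha>) + (\<Sum>\<alpha>\<in>uminus ` Rp. g \<alpha>)"
    using sum.union_disjoint[of Rp "uminus ` Rp" g] finite_Rp by simp
  also have "(\<Sum>\<alpha>\<in>uminus ` Rp. g \<alpha>) = (\<Sum>\<alpha>\<in>Rp. g (- \<alpha>))"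
    by (subst sum.reindex) (auto simp: inj_on_def)
  also have "\<dots> = (\<Sum>\<alpha>\<in>Rp. g \<alpha>)" using Rp_sub assms by (intro sum.cong) auto
  finally show ?thesis by simp
qed

text \<open>A line \<open>x + t *s v\<close> with \<open>v\<close> regular meets each mirror for
  only one value of \<open>t\<close>.\<close>

lemma regular_limpt: "x islimpt regular_points R"
  unfolding islimpt_approachable
proof (intro allI impI)
  fix e :: real assume e: "e > 0"
  obtain v where v: "\<And>\<alpha>. \<alpha> \<in> R \<Longrightarrow> bilin \<alpha> v \<noteq> 0" using regular_exists by blast
  have v0: "v \<noteq> 0" using v R_ne by (auto simp: bilin_zero_right)
  obtain B where B: "B > 0" "\<And>t::complex. norm (t *s v) \<le> norm t * B"
    using bounded_linear.pos_bounded[OF bounded_linear_scale_vec] by blast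
  have "infinite (ball (0::complex) (e / B))"
    using uncountable_ball[of "e / B" "0::complex"] e B(1) countable_finite by auto
  then obtain t where t: "t \<in> ball 0 (e / B)" "t \<notin> (\<lambda>\<alpha>. - bilin \<alpha> x / bilin \<alpha> v) ` R \<union> {0}"
    using finite_R by (meson finite.emptyI finite.insertI finite_UnI finite_imageI finite_subset subsetI)
  have "bilin \<alpha> (x + t *s v) \<noteq> 0" if "\<alpha> \<in> R" for \<alpha>
  proof
    assume "bilin \<alpha> (x + t *s v) = 0"
    then have "t = - bilin \<alpha> x / bilin \<alpha> v"
      using v[OF that] by (simp add: bilin_simps field_simps eq_neg_iff_add_eq_0)
    then show False using t(2) that by blast
  qed
  then have "x + t *s v \<in> regular_points R" unfolding regular_points_def by blast
  moreover have "x + t *s v \<noteq> x" using t(2) v0 by (simp add: vec_eq_iff)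
  moreover have "dist (x + t *s v) x < e"
  proof -
    have "norm t * B < e" using t(1) B(1) by (simp add: field_simps)
    then show ?thesis using B(2)[of t] by (simp add: dist_norm)
  qed
  ultimately show "\<exists>y\<in>regular_points R. y \<noteq> x \<and> dist y x < e" by blast
qed

lemma at_regular_nontrivial: "at x within regular_points R \<noteq> bot"
  using regular_limpt trivial_limit_within by blast

definition dunkl_expr :: "complex ^ 'n \<Rightarrow> 'n func \<Rightarrow> 'n func" where
  "dunkl_expr \<xi> f y = dir_deriv \<xi> f y -
     (\<Sum>\<alpha>\<in>Rp. m \<alpha> * bilin \<alpha> \<xi> / bilin \<alpha> y * (f y - f (reflection \<alpha> y)))"

lemma dunkl_limI:
  "(dunkl_expr \<xi> f \<longlongrightarrow> l) (at x within regular_points R) \<Longrightarrow> dunkl R Rp m \<xi> f x = l"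
  unfolding dunkl_def dunkl_expr_def[abs_def] using at_regular_nontrivial by (intro tendsto_Lim)

lemma eventually_in_open: "open V \<Longrightarrow> x \<in> V \<Longrightarrow> \<forall>\<^sub>F y in at x within S. y \<in> V"
  by (rule eventually_at_topological[THEN iffD2]) blast

lemma eventually_regular: "\<forall>\<^sub>F y in at x within regular_points R. y \<in> regular_points R"
  by (auto simp: eventually_at_filter)

end

locale invariant_function = dunkl_system R Rp m
  for R :: "(complex ^ 'n) set" and Rp m +
  fixes V :: "(complex ^ 'n) set" and F :: "'n func"
  assumes an: "analytic_open F V"
    and V_inv: "\<alpha> \<in> R \<Longrightarrow> y \<in> V \<Longrightarrow> reflection \<alpha> y \<in> V"
    and F_inv: "\<alpha> \<in> R \<Longrightarrow> y \<in> V \<Longrightarrow> F (reflection \<alpha> y) = F y"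
begin

lemma open_V: "open V"
  using an by (rule analytic_open_open)

text \<open>Near \<open>x\<close> every difference \<open>F y - F (reflection \<alpha> y)\<close> is
  zero. Reflection terms arise only with the second Dunkl operator, because a derivative of
  \<open>F\<close> need not be invariant.\<close>

lemma dunkl_invariant:
  assumes x: "x \<in> V"
  shows "dunkl R Rp m \<xi> F x = dir_deriv \<xi> F x"
proof (rule dunkl_limI)
  have "isCont (dir_deriv \<xi> F) x"
    using dir_deriv_continuous_on[OF an] open_V x continuous_on_eq_continuous_at by blast
  then have "(dir_deriv \<xi> F \<longlongrightarrow> dir_deriv \<xi> F x) (at x within regular_points R)"
    by (simp add: isCont_def Lim_at_imp_Lim_at_within)
  moreover have "\<forall>\<^sub>F y in at x within regular_points R. dir_deriv \<xi> F y = dunkl_expr \<xi> F y"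
    using eventually_in_open[OF open_V x]
  proof eventually_elim
    case (elim y)
    have "(\<Sum>\<alpha>\<in>Rp. m \<alpha> * bilin \<alpha> \<xi> / bilin \<alpha> y * (F y - F (reflection \<alpha> y))) = 0"
      using F_inv elim Rp_sub by (intro sum.neutral ballI) auto
    then show ?case unfolding dunkl_expr_def by simp
  qed
  ultimately show "(dunkl_expr \<xi> F \<longlongrightarrow> dir_deriv \<xi> F x) (at x within regular_points R)"
    by (rule Lim_transform_eventually)
qed

lemma dir_deriv_reflection:
  assumes "\<alpha> \<in> R" "x \<in> V"
  shows "dir_deriv \<eta> F (reflection \<alpha> x) = dir_deriv (reflection \<alpha> \<eta>) F x"
proof -
  have "dir_deriv (reflection \<alpha> \<eta>) F x = dir_deriv (reflection \<alpha> \<eta>) (\<lambda>y. F (reflection \<alpha> y)) x"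
    using F_inv[OF assms(1)] by (intro dir_deriv_cong_open[OF open_V assms(2)]) simp
  also have "\<dots> = dir_deriv (reflection \<alpha> (reflection \<alpha> \<eta>)) F (reflection \<alpha> x)"
    by (rule dir_deriv_linear[OF an reflection_linear V_inv[OF assms]])
  finally show ?thesis using reflection_reflection[OF nonisotropic[OF assms(1)]] by simp
qed

text \<open>The reflection fixes \<open>x\<close> and reverses \<alpha>, so the normal derivative
  equals its own negative.\<close>

lemma dir_deriv_mirror:
  assumes "\<alpha> \<in> R" "x \<in> V" "bilin \<alpha> x = 0"
  shows "dir_deriv \<alpha> F x = 0"
  using dir_deriv_reflection[OF assms(1,2), of \<alpha>] assms(3) nonisotropic[OF assms(1)]
    dir_deriv_minus_vec[OF an assms(2), of \<alpha>]
  by (simp add: reflection_fix reflection_self)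

lemma dir_deriv_antisymmetric_part:
  assumes "\<alpha> \<in> R" "x \<in> V"
  shows "dir_deriv \<eta> F x - dir_deriv \<eta> F (reflection \<alpha> x)
    = 2 * bilin \<alpha> \<eta> / bilin \<alpha> \<alpha> * dir_deriv \<alpha> F x"
proof -
  have "dir_deriv \<eta> F x - dir_deriv \<eta> F (reflection \<alpha> x) = dir_deriv (\<eta> - reflection \<alpha> \<eta>) F x"
    by (simp add: dir_deriv_reflection[OF assms] dir_deriv_diff_vec[OF an assms(2)])
  also have "\<eta> - reflection \<alpha> \<eta> = (2 * bilin \<alpha> \<eta> / bilin \<alpha> \<alpha>) *s \<alpha>" by (simp add: reflection_def)
  finally show ?thesis by (simp add: analytic_open_deriv(2)[OF an assms(2)])
qed

text \<open>On a mirror the difference quotient tends to a second derivative; the first-order summand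
  contributes nothing there because of \<open>x / 0 = 0\<close>.\<close>

lemma dunkl_dunkl:
  assumes x: "x \<in> V"
  shows "dunkl R Rp m \<xi> (dunkl R Rp m \<eta> F) x = dir_deriv \<xi> (dir_deriv \<eta> F) x -
     (\<Sum>\<alpha>\<in>Rp. m \<alpha> * bilin \<alpha> \<xi> * (if bilin \<alpha> x = 0 then 2 / bilin \<alpha> \<alpha> * dir_deriv \<alpha> (dir_deriv \<eta> F) x
        else 2 * bilin \<alpha> \<eta> / bilin \<alpha> \<alpha> * dir_deriv \<alpha> F x / bilin \<alpha> x))"
    (is "_ = _ - (\<Sum>\<alpha>\<in>Rp. _ * ?T \<alpha>)")
proof (rule dunkl_limI)
  let ?Reg = "at x within regular_points R"
  define G where "G = dir_deriv \<eta> F"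
  have anG: "analytic_open G V" unfolding G_def by (rule analytic_open_dir_deriv[OF an])
  have dG: "dunkl R Rp m \<eta> F y = G y" if "y \<in> V" for y unfolding G_def by (rule dunkl_invariant[OF that])
  have contG: "isCont G y" if "y \<in> V" for y
    using analytic_open_continuous_on[OF anG] open_V that continuous_on_eq_continuous_at by blast
  have "isCont (dir_deriv \<xi> G) x"
    using dir_deriv_continuous_on[OF anG] open_V x continuous_on_eq_continuous_at by blast
  then have 1: "(dir_deriv \<xi> G \<longlongrightarrow> dir_deriv \<xi> G x) ?Reg"
    by (simp add: isCont_def Lim_at_imp_Lim_at_within)
  have bl: "((\<lambda>y. bilin \<alpha> y) \<longlongrightarrow> bilin \<alpha> x) ?Reg" for \<alpha>
    by (rule bounded_linear.tendsto[OF bounded_linear_bilin tendsto_ident_at])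
  have 2: "((\<lambda>y. (G y - G (reflection \<alpha> y)) / bilin \<alpha> y) \<longlongrightarrow> ?T \<alpha>) ?Reg" if "\<alpha> \<in> Rp" for \<alpha>
  proof -
    have \<alpha>: "\<alpha> \<in> R" using that Rp_sub by blast
    have ev: "\<forall>\<^sub>F y in ?Reg. bilin \<alpha> y \<noteq> 0"
      using eventually_regular by eventually_elim (use \<alpha> in \<open>simp add: regular_points_def\<close>)
    show ?thesis
    proof (cases "bilin \<alpha> x = 0")
      case True
      \<comment> \<open>The increment is chosen so that \<open>y - ?h y *s \<alpha>\<close> is
        \<open>reflection \<alpha> y\<close>.\<close>
      let ?h = "\<lambda>y. 2 * bilin \<alpha> y / bilin \<alpha> \<alpha>"
      have "(?h \<longlongrightarrow> 2 * bilin \<alpha> x / bilin \<alpha> \<alpha>) ?Reg"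
        using nonisotropic[OF \<alpha>] by (intro tendsto_intros bl)
      then have "(?h \<longlongrightarrow> 0) ?Reg" using True by simp
      moreover have "\<forall>\<^sub>F y in ?Reg. ?h y \<noteq> 0"
        using ev by eventually_elim (use nonisotropic[OF \<alpha>] in simp)
      ultimately have "((\<lambda>y. (G y - G (y - ?h y *s \<alpha>)) / ?h y) \<longlongrightarrow> dir_deriv \<alpha> G x) ?Reg"
        by (rule tendsto_difference_quotient[OF anG x])
      then have "((\<lambda>y. 2 / bilin \<alpha> \<alpha> * ((G y - G (reflection \<alpha> y)) / ?h y)) \<longlongrightarrow> 2 / bilin \<alpha> \<alpha> * dir_deriv \<alpha> G x) ?Reg"
        unfolding reflection_def by (intro tendsto_intros)
      moreover have "2 / bilin \<alpha> \<alpha> * (a / (2 * b / bilin \<alpha> \<alpha>)) = a / b" for a b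
        using nonisotropic[OF \<alpha>] by simp
      ultimately have "((\<lambda>y. (G y - G (reflection \<alpha> y)) / bilin \<alpha> y) \<longlongrightarrow> 2 / bilin \<alpha> \<alpha> * dir_deriv \<alpha> G x) ?Reg"
        by (simp only:)
      then show ?thesis using True by (simp add: G_def)
    next
      case False
      have "isCont (\<lambda>y. G (reflection \<alpha> y)) x"
        by (rule isCont_o2[OF linear_continuous_at[OF clinear_bounded[OF reflection_linear]] contG[OF V_inv[OF \<alpha> x]]])
      then have "((\<lambda>y. G (reflection \<alpha> y)) \<longlongrightarrow> G (reflection \<alpha> x)) ?Reg"
        by (simp add: isCont_def Lim_at_imp_Lim_at_within)
      moreover have "(G \<longlongrightarrow> G x) ?Reg"
        using contG[OF x] by (simp add: isCont_def Lim_at_imp_Lim_at_within)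
      ultimately have "((\<lambda>y. (G y - G (reflection \<alpha> y)) / bilin \<alpha> y) \<longlongrightarrow> (G x - G (reflection \<alpha> x)) / bilin \<alpha> x) ?Reg"
        by (rule tendsto_divide[OF tendsto_diff[rotated] bl False])
      then show ?thesis
        using False dir_deriv_antisymmetric_part[OF \<alpha> x, of \<eta>] by (simp add: G_def)
    qed
  qed
  have "((\<lambda>y. dir_deriv \<xi> G y - (\<Sum>\<alpha>\<in>Rp. m \<alpha> * bilin \<alpha> \<xi> * ((G y - G (reflection \<alpha> y)) / bilin \<alpha> y)))
     \<longlongrightarrow> dir_deriv \<xi> G x - (\<Sum>\<alpha>\<in>Rp. m \<alpha> * bilin \<alpha> \<xi> * ?T \<alpha>)) ?Reg"
    by (intro tendsto_diff 1 tendsto_sum tendsto_mult tendsto_const 2)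
  moreover have "\<forall>\<^sub>F y in ?Reg. dir_deriv \<xi> G y - (\<Sum>\<alpha>\<in>Rp. m \<alpha> * bilin \<alpha> \<xi> * ((G y - G (reflection \<alpha> y)) / bilin \<alpha> y))
     = dunkl_expr \<xi> (dunkl R Rp m \<eta> F) y"
    using eventually_in_open[OF open_V x]
  proof eventually_elim
    case (elim y)
    have "dir_deriv \<xi> (dunkl R Rp m \<eta> F) y = dir_deriv \<xi> G y"
      by (rule dir_deriv_cong_open[OF open_V elim dG])
    then show ?case
      unfolding dunkl_expr_def using elim V_inv Rp_sub dG
      by (auto intro!: sum.cong)
  qed
  ultimately show "(dunkl_expr \<xi> (dunkl R Rp m \<eta> F) \<longlongrightarrow>
      dir_deriv \<xi> (dir_deriv \<eta> F) x - (\<Sum>\<alpha>\<in>Rp. m \<alpha> * bilin \<alpha> \<xi> * ?T \<alpha>)) ?Reg"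
    unfolding G_def[symmetric] by (rule Lim_transform_eventually)
qed

text \<open>Summation over the standard basis turns the coordinates of \<alpha> into a second
  derivative along \<alpha> if the mirror contains \<open>x\<close>, and into
  \<open>bilin \<alpha> \<alpha>\<close> otherwise. The last sum may run over all of
  \<open>Rp\<close>, since division by zero removes the terms of mirrors through \<open>x\<close>.
  With multiplicity \<open>1 / 2\<close>, a root whose mirror contains \<open>x\<close> subtracts
  exactly the second derivative in the unit normal direction.\<close>

lemma dunkl_laplacian_invariant:
  assumes x: "x \<in> V"
  shows "dunkl_laplacian R Rp m F x = (\<Sum>i\<in>UNIV. partial i (partial i F) x)
     - (\<Sum>\<alpha>\<in>{\<alpha>\<in>Rp. bilin \<alpha> x = 0}. m \<alpha> * (2 / bilin \<alpha> \<alpha> * dir_deriv \<alpha> (dir_deriv \<alpha> F) x))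
     - (\<Sum>\<alpha>\<in>Rp. m \<alpha> * (2 * dir_deriv \<alpha> F x / bilin \<alpha> x))"
proof -
  let ?T = "\<lambda>\<alpha> i. if bilin \<alpha> x = 0 then 2 / bilin \<alpha> \<alpha> * dir_deriv \<alpha> (partial i F) x
        else 2 * \<alpha> $ i / bilin \<alpha> \<alpha> * dir_deriv \<alpha> F x / bilin \<alpha> x"
  have "dunkl_laplacian R Rp m F x = (\<Sum>i\<in>UNIV. partial i (partial i F) x)
      - (\<Sum>i\<in>UNIV. \<Sum>\<alpha>\<in>Rp. m \<alpha> * \<alpha> $ i * ?T \<alpha> i)"
    unfolding dunkl_laplacian_def dunkl_dunkl[OF x] bilin_axis_right partial_def
    by (simp only: sum_subtractf)
  also have "(\<Sum>i\<in>UNIV. \<Sum>\<alpha>\<in>Rp. m \<alpha> * \<alpha> $ i * ?T \<alpha> i) = (\<Sum>\<alpha>\<in>Rp. m \<alpha> * (\<Sum>i\<in>UNIV. \<alpha> $ i * ?T \<alpha> i))"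
    unfolding sum_distrib_left by (subst sum.swap) (simp only: mult.assoc)
  also have "\<dots> = (\<Sum>\<alpha>\<in>Rp. (if bilin \<alpha> x = 0 then m \<alpha> * (2 / bilin \<alpha> \<alpha> * dir_deriv \<alpha> (dir_deriv \<alpha> F) x) else 0)
      + m \<alpha> * (2 * dir_deriv \<alpha> F x / bilin \<alpha> x))"
  proof (rule sum.cong[OF refl])
    fix \<alpha> assume "\<alpha> \<in> Rp"
    then have \<alpha>: "\<alpha> \<in> R" using Rp_sub by blast
    show "m \<alpha> * (\<Sum>i\<in>UNIV. \<alpha> $ i * ?T \<alpha> i) = (if bilin \<alpha> x = 0 then m \<alpha> * (2 / bilin \<alpha> \<alpha> * dir_deriv \<alpha> (dir_deriv \<alpha> F) x) else 0)
      + m \<alpha> * (2 * dir_deriv \<alpha> F x / bilin \<alpha> x)"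
    proof (cases "bilin \<alpha> x = 0")
      case True
      have "(\<Sum>i\<in>UNIV. \<alpha> $ i * ?T \<alpha> i) = 2 / bilin \<alpha> \<alpha> * (\<Sum>i\<in>UNIV. \<alpha> $ i * dir_deriv \<alpha> (partial i F) x)"
        using True by (simp add: sum_distrib_left mult_ac)
      also have "(\<Sum>i\<in>UNIV. \<alpha> $ i * dir_deriv \<alpha> (partial i F) x) = dir_deriv \<alpha> (dir_deriv \<alpha> F) x"
        unfolding dir_deriv_expand[OF analytic_open_dir_deriv[OF an] x, of \<alpha> \<alpha>] partial_def
        using dir_deriv_commute[OF an x] by (intro sum.cong refl) simp
      finally show ?thesis using True by simp
    next
      case False
      have "(\<Sum>i\<in>UNIV. \<alpha> $ i * ?T \<alpha> i) = (2 * dir_deriv \<alpha> F x / bilin \<alpha> x) / bilin \<alpha> \<alpha> * (\<Sum>i\<in>UNIV. \<alpha> $ i * \<alpha> $ i)"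
        using False by (simp add: sum_distrib_left sum_divide_distrib mult_ac)
      also have "(\<Sum>i\<in>UNIV. \<alpha> $ i * \<alpha> $ i) = bilin \<alpha> \<alpha>" by (simp add: bilin_def)
      finally show ?thesis using False nonisotropic[OF \<alpha>] by simp
    qed
  qed
  also have "\<dots> = (\<Sum>\<alpha>\<in>{\<alpha>\<in>Rp. bilin \<alpha> x = 0}. m \<alpha> * (2 / bilin \<alpha> \<alpha> * dir_deriv \<alpha> (dir_deriv \<alpha> F) x))
     + (\<Sum>\<alpha>\<in>Rp. m \<alpha> * (2 * dir_deriv \<alpha> F x / bilin \<alpha> x))"
    by (subst sum.inter_filter[OF finite_Rp]) (rule sum.distrib)
  finally show ?thesis by (simp add: algebra_simps)
qed

end

section \<open>Coordinates on the mirror and the explicit form of the operator\<close>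

definition incl :: "complex ^ 3 \<Rightarrow> complex ^ 4" where
  "incl u = (\<chi> i. if i = 1 then u $ 1 else if i = 2 then u $ 2 else if i = 3 then u $ 3 else 0)"

lemma incl_nth: "incl u $ 1 = u $ 1" "incl u $ 2 = u $ 2" "incl u $ 3 = u $ 3" "incl u $ 4 = 0"
  by (simp_all add: incl_def)

lemma incl_linear: "Vector_Spaces.linear (*s) (*s) incl"
  by (rule clinearI) (simp_all add: vec_eq_iff forall_4 incl_nth)

lemma bilin_incl: "bilin (incl u) (incl v) = bilin u v"
  by (simp add: bilin_4 incl_nth) (simp add: bilin_def sum_3)

lemma incl_axis: "incl (axis 1 1) = axis 1 1" "incl (axis 2 1) = axis 2 1" "incl (axis 3 1) = axis 3 1"
  by (simp_all add: vec_eq_iff forall_4 incl_nth axis_def)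

lemma sum_short_roots:
  fixes g :: "complex ^ 4 \<Rightarrow> complex"
  assumes "\<And>\<alpha>. g (- \<alpha>) = g \<alpha>"
  shows "(\<Sum>\<alpha>\<in>short_roots. g \<alpha>) = 2 * (\<Sum>t\<in>set short4. g (root_vec t))"
proof -
  have "\<forall>s\<in>set short4. \<forall>t\<in>set short4. s \<noteq> neg4 t" by code_simp
  then have "root_vec ` set short4 \<inter> uminus ` root_vec ` set short4 = {}"
    using inj_root_vec by (auto simp: root_vec_neg[symmetric] inj_eq)
  then have "(\<Sum>\<alpha>\<in>short_roots. g \<alpha>) = (\<Sum>\<alpha>\<in>root_vec ` set short4. g \<alpha>) + (\<Sum>\<alpha>\<in>uminus ` root_vec ` set short4. g \<alpha>)"
    unfolding short_roots_def by (intro sum.union_disjoint) auto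
  also have "(\<Sum>\<alpha>\<in>uminus ` root_vec ` set short4. g \<alpha>) = (\<Sum>\<alpha>\<in>root_vec ` set short4. g \<alpha>)"
    by (subst sum.reindex) (auto simp: assms inj_on_def)
  also have "(\<Sum>\<alpha>\<in>root_vec ` set short4. g \<alpha>) = (\<Sum>t\<in>set short4. g (root_vec t))"
    by (subst sum.reindex) (auto intro: inj_on_subset[OF inj_root_vec])
  finally show ?thesis by simp
qed

lemma sum_long_roots:
  fixes g :: "complex ^ 4 \<Rightarrow> complex"
  assumes "\<And>\<alpha>. g (- \<alpha>) = g \<alpha>"
  shows "(\<Sum>\<alpha>\<in>long_roots. g \<alpha>) = 2 * (\<Sum>t\<in>set long4. g (root_vec t))"
proof -
  have "\<forall>s\<in>set long4. \<forall>t\<in>set long4. s \<noteq> neg4 t" by code_simp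
  then have "root_vec ` set long4 \<inter> uminus ` root_vec ` set long4 = {}"
    using inj_root_vec by (auto simp: root_vec_neg[symmetric] inj_eq)
  then have "(\<Sum>\<alpha>\<in>long_roots. g \<alpha>) = (\<Sum>\<alpha>\<in>root_vec ` set long4. g \<alpha>) + (\<Sum>\<alpha>\<in>uminus ` root_vec ` set long4. g \<alpha>)"
    unfolding long_roots_def by (intro sum.union_disjoint) auto
  also have "(\<Sum>\<alpha>\<in>uminus ` root_vec ` set long4. g \<alpha>) = (\<Sum>\<alpha>\<in>root_vec ` set long4. g \<alpha>)"
    by (subst sum.reindex) (auto simp: assms inj_on_def)
  also have "(\<Sum>\<alpha>\<in>root_vec ` set long4. g \<alpha>) = (\<Sum>t\<in>set long4. g (root_vec t))"
    by (subst sum.reindex) (auto intro: inj_on_subset[OF inj_root_vec])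
  finally show ?thesis by simp
qed

lemma H_op_cong:
  assumes "open N" "u \<in> N" "\<And>v. v \<in> N \<Longrightarrow> f v = g v"
  shows "H_op k f u = H_op k g u"
proof -
  have 1: "partial i f v = partial i g v" if "v \<in> N" for i v
    using assms(1) that assms(3) by (rule partial_cong_open)
  have 2: "partial i (partial i f) u = partial i (partial i g) u" for i
    using assms(1,2) 1 by (rule partial_cong_open)
  show ?thesis unfolding H_op_def 2 1[OF assms(2)] ..
qed

lemma bilin_root_vec_incl:
  "bilin (root_vec (x, y, z, w)) (incl u) = (of_int x * u $ 1 + of_int y * u $ 2 + of_int z * u $ 3) / 2"
  unfolding bilin_4 incl_nth root_vec_nth by (simp add: add_divide_distrib)

text \<open>The linear forms in \<open>H_domain\<close> are, up to scalars, the roots restricted to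
  the hyperplane where the fourth coordinate is zero; among the listed roots only
  \<open>(0,0,0,2)\<close> restricts to zero.\<close>

lemma H_domain_roots:
  assumes u: "u \<in> H_domain"
  shows "t \<in> set short4 \<Longrightarrow> t \<noteq> (0,0,0,2) \<Longrightarrow> bilin (root_vec t) (incl u) \<noteq> 0"
    and "t \<in> set long4 \<Longrightarrow> bilin (root_vec t) (incl u) \<noteq> 0"
proof -
  have n: "u $ 1 \<noteq> 0" "u $ 2 \<noteq> 0" "u $ 3 \<noteq> 0" using u unfolding H_domain_def by blast+
  have p: "u $ i + s * u $ j \<noteq> 0" if "(i, j) \<in> {(1, 2), (1, 3), (2, 3)}" "s \<in> {1, -1}" for i j s
    using u that unfolding H_domain_def by blast
  have h: "u $ 1 + e2 * u $ 2 + e3 * u $ 3 \<noteq> 0" if "e2 \<in> {1, -1}" "e3 \<in> {1, -1}" for e2 e3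
    using u that unfolding H_domain_def by blast
  \<comment> \<open>The factor 2 anticipates the doubled coordinates in which \<open>long4\<close>
    is written.\<close>
  have p': "2 * (u $ 1 + 1 * u $ 2) \<noteq> 0" "2 * (u $ 1 + (-1) * u $ 2) \<noteq> 0" "2 * (u $ 1 + 1 * u $ 3) \<noteq> 0"
    "2 * (u $ 1 + (-1) * u $ 3) \<noteq> 0" "2 * (u $ 2 + 1 * u $ 3) \<noteq> 0" "2 * (u $ 2 + (-1) * u $ 3) \<noteq> 0"
    by (rule no_zero_divisors, simp, rule p; simp)+
  have h': "u $ 1 + 1 * u $ 2 + 1 * u $ 3 \<noteq> 0" "u $ 1 + 1 * u $ 2 + (-1) * u $ 3 \<noteq> 0"
    "u $ 1 + (-1) * u $ 2 + 1 * u $ 3 \<noteq> 0" "u $ 1 + (-1) * u $ 2 + (-1) * u $ 3 \<noteq> 0"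
    by (rule h; simp)+
  show "bilin (root_vec t) (incl u) \<noteq> 0" if "t \<in> set short4" "t \<noteq> (0,0,0,2)"
    using that n h' by (auto simp: short4_def bilin_root_vec_incl)
  show "bilin (root_vec t) (incl u) \<noteq> 0" if "t \<in> set long4"
    using that n p' unfolding distrib_left by (auto simp: long4_def bilin_root_vec_incl)
qed

context F4_frame
begin

definition \<phi> :: "complex ^ 3 \<Rightarrow> complex ^ 4" where "\<phi> u = A (incl u)"

lemma A_scale: "A (a *s x) = a *s A x"
  using lin by (rule clinear_scale)

lemma inj_A: "inj A"
proof (rule injI)
  fix x y assume e: "A x = A y"
  have "x $ i = y $ i" for i using bil[of x "axis i 1"] bil[of y "axis i 1"] e by (simp add: bilin_axis_right)
  then show "x = y" by (simp add: vec_eq_iff)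
qed

lemma phi_linear: "Vector_Spaces.linear (*s) (*s) \<phi>"
  using Vector_Spaces.linear_compose[OF incl_linear lin] by (simp add: \<phi>_def[abs_def] comp_def)

lemma bilin_phi: "bilin (\<phi> u) (\<phi> v) = bilin u v"
  by (simp add: \<phi>_def bil bilin_incl)

lemma inj_phi: "inj \<phi>"
proof (rule injI)
  fix x y assume e: "\<phi> x = \<phi> y"
  have "x $ i = y $ i" for i using bilin_phi[of x "axis i 1"] bilin_phi[of y "axis i 1"] e by (simp add: bilin_axis_right)
  then show "x = y" by (simp add: vec_eq_iff)
qed

lemma bilin_root: "bilin \<beta> (A y) = p * y $ 4"
  unfolding root by (simp add: bilin_simps bil bilin_axis_left)

lemma bilin_beta: "bilin \<beta> \<beta> = p * p"
  using bilin_root[of "p *s axis 4 1"] by (subst (2) root) (simp add: A_scale axis_def)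

lemma range_phi: "range \<phi> = mirror \<beta>"
proof (intro equalityI subsetI)
  fix x assume x: "x \<in> mirror \<beta>"
  obtain y where y: "x = A y" using surjA by blast
  then have "y $ 4 = 0" using x pq by (simp add: mirror_def bilin_root)
  then have "incl (\<chi> i. if i = 1 then y $ 1 else if i = 2 then y $ 2 else y $ 3) = y"
    by (simp add: vec_eq_iff forall_4 incl_nth)
  then have "\<phi> (\<chi> i. if i = 1 then y $ 1 else if i = 2 then y $ 2 else y $ 3) = x"
    unfolding y \<phi>_def by (rule arg_cong)
  then show "x \<in> range \<phi>" by (rule range_eqI[OF sym])
qed (auto simp: \<phi>_def mirror_def bilin_root incl_nth)

lemma orthonormal_coordinates_phi: "orthonormal_coordinates \<phi> (mirror \<beta>)"
  unfolding orthonormal_coordinates_def using phi_linear bilin_phi range_phi by blast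

lemma continuous_on_phi: "continuous_on S \<phi>"
  using linear_continuous_on[OF clinear_bounded[OF phi_linear]] .

lemma inv_phi: "inv \<phi> (\<phi> u) = u"
  using inj_phi by (rule inv_f_f)

text \<open>The Laplacian is the trace of the second derivative, which is the same in every
  orthonormal frame.\<close>

lemma trace_frame:
  assumes F: "analytic_open F V" and x: "x \<in> V"
  shows "(\<Sum>j\<in>UNIV. dir_deriv (A (axis j 1)) (dir_deriv (A (axis j 1)) F) x) = (\<Sum>k\<in>UNIV. partial k (partial k F) x)"
proof -
  \<comment> \<open>The columns of \<open>A\<close> are orthonormal because \<open>A\<close> is an
    isometry; for the rows, surjectivity provides preimages of the basis vectors.\<close>
  have orth: "(\<Sum>j\<in>UNIV. A (axis j 1) $ k * A (axis j 1) $ l) = (if k = l then 1 else 0)" for k l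
  proof -
    obtain f g where f: "axis k 1 = A f" "axis l 1 = A g" using surjA by (metis surjD)
    have "A (axis j 1) $ k = f $ j" "A (axis j 1) $ l = g $ j" for j
      using bil[of "axis j 1" f] bil[of "axis j 1" g] by (simp_all add: bilin_axis_left bilin_axis_right flip: f)
    then have "(\<Sum>j\<in>UNIV. A (axis j 1) $ k * A (axis j 1) $ l) = bilin f g" by (simp add: bilin_def)
    also have "\<dots> = bilin (axis k 1) (axis l 1)" using bil[of f g] f by simp
    finally show ?thesis unfolding bilin_axis_left by (simp add: axis_def)
  qed
  have "dir_deriv v (dir_deriv v F) x = (\<Sum>k\<in>UNIV. \<Sum>l\<in>UNIV. v $ k * v $ l * partial l (partial k F) x)" for v
  proof -
    have "dir_deriv v (dir_deriv v F) x = (\<Sum>k\<in>UNIV. v $ k * dir_deriv v (partial k F) x)"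
      unfolding dir_deriv_expand[OF analytic_open_dir_deriv[OF F] x, of v v] partial_def
      using dir_deriv_commute[OF F x] by (intro sum.cong refl) simp
    then show ?thesis
      by (simp add: dir_deriv_expand[OF analytic_open_partial[OF F] x] sum_distrib_left mult.assoc)
  qed
  then have "(\<Sum>j\<in>UNIV. dir_deriv (A (axis j 1)) (dir_deriv (A (axis j 1)) F) x)
      = (\<Sum>j\<in>UNIV. \<Sum>k\<in>UNIV. \<Sum>l\<in>UNIV. A (axis j 1) $ k * A (axis j 1) $ l * partial l (partial k F) x)"
    by simp
  also have "\<dots> = (\<Sum>k\<in>UNIV. \<Sum>j\<in>UNIV. \<Sum>l\<in>UNIV. A (axis j 1) $ k * A (axis j 1) $ l * partial l (partial k F) x)"
    by (rule sum.swap)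
  also have "\<dots> = (\<Sum>k\<in>UNIV. \<Sum>l\<in>UNIV. \<Sum>j\<in>UNIV. A (axis j 1) $ k * A (axis j 1) $ l * partial l (partial k F) x)"
    by (rule sum.cong[OF refl], rule sum.swap)
  also have "\<dots> = (\<Sum>k\<in>UNIV. \<Sum>l\<in>UNIV. (if k = l then 1 else 0) * partial l (partial k F) x)"
    by (simp only: orth flip: sum_distrib_right)
  also have "\<dots> = (\<Sum>k\<in>UNIV. partial k (partial k F) x)"
    by (simp add: if_distrib[of "\<lambda>a. a * _"] cong: if_cong)
  finally show ?thesis .
qed

lemma partial_phi:
  assumes "analytic_open F V" "\<phi> u \<in> V"
  shows "partial j (F \<circ> \<phi>) u = dir_deriv (\<phi> (axis j 1)) F (\<phi> u)"
  unfolding partial_def comp_def using dir_deriv_linear[OF assms(1) phi_linear assms(2)] .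

lemma partial_partial_phi:
  assumes F: "analytic_open F V" and u: "\<phi> u \<in> V"
  shows "partial j (partial j (F \<circ> \<phi>)) u = dir_deriv (\<phi> (axis j 1)) (dir_deriv (\<phi> (axis j 1)) F) (\<phi> u)"
proof -
  have "open (\<phi> -` V)" using continuous_on_phi analytic_open_open[OF F] by (rule open_vimage[rotated])
  then have "partial j (partial j (F \<circ> \<phi>)) u = partial j (dir_deriv (\<phi> (axis j 1)) F \<circ> \<phi>) u"
    using u partial_phi[OF F] by (intro partial_cong_open[where V = "\<phi> -` V"]) auto
  then show ?thesis using partial_phi[OF analytic_open_dir_deriv[OF F] u] by simp
qed

end

locale F4_setting = F4_frame \<beta> A p q + dunkl_system F4 Rp m
  for \<beta> A p q Rp m +
  fixes c :: complex
  assumes m_orbit: "\<alpha> \<in> root_orbit F4 \<beta> \<Longrightarrow> m \<alpha> = 1 / 2"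
    and m_other: "\<alpha> \<in> F4 - root_orbit F4 \<beta> \<Longrightarrow> m \<alpha> = c"
    and root_F4: "\<beta> \<in> F4"
begin

lemma orbit_sub: "root_orbit F4 \<beta> \<subseteq> F4"
  unfolding root_orbit_def using coxeter_group_root root_F4 by auto

lemma beta_in_orbit: "\<beta> \<in> root_orbit F4 \<beta>"
  unfolding root_orbit_def using coxeter_group.one by (intro CollectI exI[of _ id]) simp

text \<open>Homogeneity of degree zero removes \<open>p\<close> and \<open>q\<close>. The lists
  contain one root of each pair, just as \<open>Rp\<close> does, so the coefficients are twice the
  multiplicities: \<open>1\<close> and \<open>2 * c\<close>.\<close>

lemma sum_F4:
  fixes g :: "complex ^ 4 \<Rightarrow> complex"
  assumes scale: "\<And>a \<alpha>. a \<noteq> 0 \<Longrightarrow> g (a *s \<alpha>) = g \<alpha>"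
  shows "(\<Sum>\<alpha>\<in>Rp. m \<alpha> * (2 * g \<alpha>)) = (\<Sum>t\<in>set short4. g (A (root_vec t))) + 2 * c * (\<Sum>t\<in>set long4. g (A (root_vec t)))"
proof -
  have even: "g (- \<alpha>) = g \<alpha>" for \<alpha>
  proof -
    have "- \<alpha> = (-1) *s \<alpha>" by (simp add: vec_eq_iff)
    then show ?thesis using scale[of "-1" \<alpha>] by simp
  qed
  have evA: "g (A (- \<alpha>)) = g (A \<alpha>)" for \<alpha> using clinear_minus[OF lin] even by simp
  have inj: "inj_on (\<lambda>\<alpha>. a *s A \<alpha>) X" if "a \<noteq> 0" for a X
    by (rule inj_onI) (use that inj_A in \<open>simp add: inj_eq\<close>)
  have "2 * (\<Sum>\<alpha>\<in>Rp. m \<alpha> * g \<alpha>) = (\<Sum>\<alpha>\<in>F4. m \<alpha> * g \<alpha>)"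
    by (rule sum_positive[symmetric]) (simp add: m_minus even)
  also have "\<dots> = (\<Sum>\<alpha>\<in>root_orbit F4 \<beta>. m \<alpha> * g \<alpha>) + (\<Sum>\<alpha>\<in>F4 - root_orbit F4 \<beta>. m \<alpha> * g \<alpha>)"
    by (subst sum.subset_diff[OF orbit_sub finite_R]) simp
  also have "(\<Sum>\<alpha>\<in>root_orbit F4 \<beta>. m \<alpha> * g \<alpha>) = (\<Sum>\<alpha>\<in>root_orbit F4 \<beta>. 1 / 2 * g \<alpha>)"
    by (intro sum.cong refl) (simp add: m_orbit)
  also have "\<dots> = 1 / 2 * (\<Sum>\<alpha>\<in>root_orbit F4 \<beta>. g \<alpha>)" by (simp only: sum_distrib_left)
  also have "(\<Sum>\<alpha>\<in>root_orbit F4 \<beta>. g \<alpha>) = (\<Sum>\<alpha>\<in>short_roots. g (A \<alpha>))"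
    unfolding orbit by (subst sum.reindex[OF inj[OF pq(1)]]) (simp add: scale pq)
  also have "\<dots> = 2 * (\<Sum>t\<in>set short4. g (A (root_vec t)))"
    by (rule sum_short_roots) (rule evA)
  also have "(\<Sum>\<alpha>\<in>F4 - root_orbit F4 \<beta>. m \<alpha> * g \<alpha>) = (\<Sum>\<alpha>\<in>F4 - root_orbit F4 \<beta>. c * g \<alpha>)"
    by (intro sum.cong refl) (simp add: m_other)
  also have "\<dots> = c * (\<Sum>\<alpha>\<in>F4 - root_orbit F4 \<beta>. g \<alpha>)" by (simp only: sum_distrib_left)
  also have "(\<Sum>\<alpha>\<in>F4 - root_orbit F4 \<beta>. g \<alpha>) = (\<Sum>\<alpha>\<in>long_roots. g (A \<alpha>))"
    unfolding other by (subst sum.reindex[OF inj[OF pq(2)]]) (simp add: scale pq)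
  also have "\<dots> = 2 * (\<Sum>t\<in>set long4. g (A (root_vec t)))"
    by (rule sum_long_roots) (rule evA)
  finally show ?thesis by (simp add: sum_distrib_left mult_ac)
qed

text \<open>Roots that differ only in the sign of the fourth coordinate agree on the mirror. Each of
  the first three short axes counts once and the two long roots \<open>e_i + e_4\<close> and
  \<open>e_i - e_4\<close> add \<open>4 * c\<close>, giving \<open>4 * c + 1\<close>. The eight half
  roots in the list collapse in pairs, whence the coefficient 2, and the remaining long roots keep
  \<open>2 * c\<close>.\<close>

lemma first_order_part:
  fixes d u :: "complex ^ 3"
  defines "T \<equiv> \<lambda>t. bilin (root_vec t) (incl d) / bilin (root_vec t) (incl u)"
  shows "(\<Sum>t\<in>set short4. T t) + 2 * c * (\<Sum>t\<in>set long4. T t) =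
     (\<Sum>i\<in>UNIV. (4 * c + 1) * d $ i / u $ i)
   + (\<Sum>(i, j)\<in>{(1, 2), (1, 3), (2, 3)}. \<Sum>s\<in>{1, -1}. 2 * c * (d $ i + s * d $ j) / (u $ i + s * u $ j))
   + (\<Sum>e2\<in>{1, -1}. \<Sum>e3\<in>{1, -1}. 2 * (d $ 1 + e2 * d $ 2 + e3 * d $ 3) / (u $ 1 + e2 * u $ 2 + e3 * u $ 3))"
proof -
  have T: "T (x, y, z, w) = (of_int x * d $ 1 + of_int y * d $ 2 + of_int z * d $ 3) / (of_int x * u $ 1 + of_int y * u $ 2 + of_int z * u $ 3)" for x y z w
  proof -
    have "T (x, y, z, w) = ((of_int x * d $ 1 + of_int y * d $ 2 + of_int z * d $ 3) / 2) / ((of_int x * u $ 1 + of_int y * u $ 2 + of_int z * u $ 3) / 2)"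
      unfolding T_def bilin_4 incl_nth root_vec_nth by (simp add: add_divide_distrib)
    moreover have "(a / 2) / (b / 2) = a / b" for a b :: complex by simp
    ultimately show ?thesis by (simp only:)
  qed
  have two: "(2 * a) / (2 * b) = a / b" for a b :: complex by simp
  define E where "E = (\<lambda>i. d $ i / u $ i)"
  define P where "P = (\<lambda>i j s. (d $ i + s * d $ j) / (u $ i + s * u $ j))"
  define Q where "Q = (\<lambda>e2 e3. (d $ 1 + e2 * d $ 2 + e3 * d $ 3) / (u $ 1 + e2 * u $ 2 + e3 * u $ 3))"
  have PT: "P i j s = (2 * (d $ i + s * d $ j)) / (2 * (u $ i + s * u $ j))" for i j s
    unfolding P_def two ..
  \<comment> \<open>The term of \<open>(0,0,0,2)\<close> is \<open>0 / 0\<close>, which is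
    zero.\<close>
  have short: "T (2,0,0,0) = E 1" "T (0,2,0,0) = E 2" "T (0,0,2,0) = E 3" "T (0,0,0,2) = 0"
    "T (1,1,1,w) = Q 1 1" "T (1,1,-1,w) = Q 1 (-1)" "T (1,-1,1,w) = Q (-1) 1" "T (1,-1,-1,w) = Q (-1) (-1)" for w
    by (simp_all add: T E_def Q_def)
  have long: "T (2,0,0,w) = E 1" "T (0,2,0,w) = E 2" "T (0,0,2,w) = E 3"
    "T (2,2,0,0) = P 1 2 1" "T (2,-2,0,0) = P 1 2 (-1)" "T (2,0,2,0) = P 1 3 1" "T (2,0,-2,0) = P 1 3 (-1)"
    "T (0,2,2,0) = P 2 3 1" "T (0,2,-2,0) = P 2 3 (-1)" for w
    unfolding PT by (simp_all add: T E_def)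
  have "(\<Sum>t\<in>set short4. T t) = E 1 + E 2 + E 3 + 2 * (Q 1 1 + Q 1 (-1) + Q (-1) 1 + Q (-1) (-1))"
    by (simp add: short4_def short)
  moreover have "(\<Sum>t\<in>set long4. T t) = 2 * (E 1 + E 2 + E 3) + P 1 2 1 + P 1 2 (-1) + P 1 3 1 + P 1 3 (-1) + P 2 3 1 + P 2 3 (-1)"
    by (simp add: long4_def long)
  moreover have "(\<Sum>i\<in>UNIV. (4 * c + 1) * d $ i / u $ i) = (4 * c + 1) * (E 1 + E 2 + E 3)"
    by (simp add: sum_3 E_def distrib_left)
  moreover have "(\<Sum>(i, j)\<in>{(1::3, 2::3), (1, 3), (2, 3)}. \<Sum>s\<in>{1, -1}. 2 * c * (d $ i + s * d $ j) / (u $ i + s * u $ j))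
      = 2 * c * (P 1 2 1 + P 1 2 (-1) + P 1 3 1 + P 1 3 (-1) + P 2 3 1 + P 2 3 (-1))"
  proof -
    have "(\<Sum>(i, j)\<in>{(1::3, 2::3), (1, 3), (2, 3)}. \<Sum>s\<in>{1, -1}. 2 * c * (d $ i + s * d $ j) / (u $ i + s * u $ j))
      = (\<Sum>(i, j)\<in>{(1::3, 2::3), (1, 3), (2, 3)}. \<Sum>s\<in>{1, -1}. 2 * c * P i j s)"
      by (simp only: P_def times_divide_eq_right)
    also have "\<dots> = 2 * c * (P 1 2 1 + P 1 2 (-1) + P 1 3 1 + P 1 3 (-1) + P 2 3 1 + P 2 3 (-1))"
      by (simp add: distrib_left)
    finally show ?thesis .
  qed
  moreover have "(\<Sum>e2\<in>{1, -1}. \<Sum>e3\<in>{1, -1}. 2 * (d $ 1 + e2 * d $ 2 + e3 * d $ 3) / (u $ 1 + e2 * u $ 2 + e3 * u $ 3))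
      = 2 * (Q 1 1 + Q 1 (-1) + Q (-1) 1 + Q (-1) (-1))"
  proof -
    have "(\<Sum>e2\<in>{1, -1}. \<Sum>e3\<in>{1, -1}. 2 * (d $ 1 + e2 * d $ 2 + e3 * d $ 3) / (u $ 1 + e2 * u $ 2 + e3 * u $ 3))
      = (\<Sum>e2\<in>{1, -1}. \<Sum>e3\<in>{1, -1}. 2 * Q e2 e3)"
      by (simp only: Q_def times_divide_eq_right)
    also have "\<dots> = 2 * (Q 1 1 + Q 1 (-1) + Q (-1) 1 + Q (-1) (-1))" by simp
    finally show ?thesis .
  qed
  ultimately show ?thesis by (simp add: algebra_simps)
qed

theorem dunkl_laplacian_eq_H:
  assumes "invariant_function F4 Rp m V F" and x: "\<phi> u \<in> V"
    and gen: "\<And>\<alpha>. \<alpha> \<in> F4 \<Longrightarrow> bilin \<alpha> (\<phi> u) = 0 \<Longrightarrow> \<alpha> = \<beta> \<or> \<alpha> = - \<beta>"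
  shows "dunkl_laplacian F4 Rp m F (\<phi> u) = H_op c (F \<circ> \<phi>) u"
proof -
  interpret invariant_function F4 Rp m V F by fact
  let ?x = "\<phi> u"
  define d :: "complex ^ 3" where "d = (\<chi> j. partial j (F \<circ> \<phi>) u)"
  let ?D2 = "\<lambda>v. dir_deriv v (dir_deriv v F) ?x"
  have b0: "bilin \<beta> ?x = 0" using range_phi unfolding mirror_def by auto
  have phi_axis: "\<phi> (axis 1 1) = A (axis 1 1)" "\<phi> (axis 2 1) = A (axis 2 1)" "\<phi> (axis 3 1) = A (axis 3 1)"
    by (simp_all add: \<phi>_def incl_axis)
  have D2_scale: "?D2 (a *s v) = a * a * ?D2 v" for a v
  proof -
    have "dir_deriv (a *s v) (dir_deriv (a *s v) F) ?x = a * dir_deriv v (dir_deriv (a *s v) F) ?x"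
      by (rule analytic_open_deriv(2)[OF analytic_open_dir_deriv[OF an] x])
    also have "dir_deriv v (dir_deriv (a *s v) F) ?x = dir_deriv (a *s v) (dir_deriv v F) ?x"
      by (rule dir_deriv_commute[OF an x])
    also have "\<dots> = a * dir_deriv v (dir_deriv v F) ?x"
      by (rule analytic_open_deriv(2)[OF analytic_open_dir_deriv[OF an] x])
    finally show ?thesis by simp
  qed
  have second: "(\<Sum>i\<in>UNIV. partial i (partial i F) ?x) = (\<Sum>i\<in>UNIV. partial i (partial i (F \<circ> \<phi>)) u) + ?D2 (A (axis 4 1))"
    unfolding trace_frame[OF an x, symmetric] sum_4 sum_3 partial_partial_phi[OF an x] phi_axis ..
  \<comment> \<open>Exactly one of \<beta> and its negative is positive, and no other mirror
    contains the point, so this sum has a single term.\<close>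
  have normal: "(\<Sum>\<alpha>\<in>{\<alpha>\<in>Rp. bilin \<alpha> ?x = 0}. m \<alpha> * (2 / bilin \<alpha> \<alpha> * ?D2 \<alpha>)) = ?D2 (A (axis 4 1))"
  proof -
    have tm: "m \<alpha> * (2 / bilin \<alpha> \<alpha> * ?D2 \<alpha>) = ?D2 (A (axis 4 1))" if \<alpha>: "\<alpha> = \<beta> \<or> \<alpha> = - \<beta>" for \<alpha>
    proof -
      have m: "m \<alpha> = 1 / 2" using \<alpha> m_minus[OF root_F4] m_orbit[OF beta_in_orbit] by auto
      have b: "bilin \<alpha> \<alpha> = p * p" using \<alpha> bilin_beta by (auto simp: bilin_simps)
      have "- \<beta> = (- p) *s A (axis 4 1)" by (subst root) (simp add: vec_eq_iff)
      then have "?D2 \<alpha> = p * p * ?D2 (A (axis 4 1))"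
        using \<alpha> root D2_scale[of p] D2_scale[of "- p"] by (metis minus_mult_minus)
      then show ?thesis using m b pq by simp
    qed
    obtain \<alpha> where \<alpha>: "\<alpha> = \<beta> \<or> \<alpha> = - \<beta>" "\<alpha> \<in> Rp" "- \<alpha> \<notin> Rp"
      using Rp_half[OF root_F4] by (metis minus_minus)
    have "{\<alpha>\<in>Rp. bilin \<alpha> ?x = 0} = {\<alpha>}"
    proof (intro equalityI subsetI)
      fix \<gamma> assume "\<gamma> \<in> {\<alpha>\<in>Rp. bilin \<alpha> ?x = 0}"
      then have "\<gamma> \<in> Rp" "\<gamma> = \<beta> \<or> \<gamma> = - \<beta>" using gen[of \<gamma>] Rp_sub by auto
      then show "\<gamma> \<in> {\<alpha>}" using \<alpha> by (metis minus_minus singletonI)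
    qed (use \<alpha> b0 in \<open>auto simp: bilin_simps\<close>)
    then show ?thesis using tm[OF \<alpha>(1)] by simp
  qed
  define g where "g = (\<lambda>\<alpha>. dir_deriv \<alpha> F ?x / bilin \<alpha> ?x)"
  \<comment> \<open>The normal derivative of an invariant function is zero on the mirror, so in the
    frame \<open>A\<close> the gradient of \<open>F\<close> is \<open>incl d\<close> and only
    derivatives along the mirror remain.\<close>
  have gA: "g (A y) = bilin y (incl d) / bilin y (incl u)" for y
  proof -
    have "dir_deriv \<beta> F ?x = 0" by (rule dir_deriv_mirror[OF root_F4 x b0])
    then have "p * dir_deriv (A (axis 4 1)) F ?x = 0"
      by (subst (asm) root) (simp add: analytic_open_deriv(2)[OF an x])
    then have 4: "dir_deriv (A (axis 4 1)) F ?x = 0" using pq by simp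
    have "A y = (\<Sum>j\<in>UNIV. y $ j *s A (axis j 1))"
    proof -
      interpret l: Vector_Spaces.linear "(*s)" "(*s)" A by (rule lin)
      show ?thesis by (subst vec_expand[of y]) (simp add: l.sum l.scale)
    qed
    then have "dir_deriv (A y) F ?x = (\<Sum>j\<in>UNIV. y $ j * dir_deriv (A (axis j 1)) F ?x)"
      by (simp add: dir_deriv_sum_vec[OF an x] analytic_open_deriv(2)[OF an x])
    also have "\<dots> = bilin y (incl d)"
      unfolding sum_4 bilin_4 incl_nth 4 by (simp add: d_def partial_phi[OF an x] phi_axis)
    finally have "dir_deriv (A y) F ?x = bilin y (incl d)" .
    then show ?thesis by (simp add: g_def \<phi>_def bil)
  qed
  have "(\<Sum>\<alpha>\<in>Rp. m \<alpha> * (2 * dir_deriv \<alpha> F ?x / bilin \<alpha> ?x)) = (\<Sum>\<alpha>\<in>Rp. m \<alpha> * (2 * g \<alpha>))"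
    by (simp add: g_def)
  also have "\<dots> = (\<Sum>t\<in>set short4. g (A (root_vec t))) + 2 * c * (\<Sum>t\<in>set long4. g (A (root_vec t)))"
    by (rule sum_F4) (simp add: g_def analytic_open_deriv(2)[OF an x] bilin_simps)
  finally have first: "(\<Sum>\<alpha>\<in>Rp. m \<alpha> * (2 * dir_deriv \<alpha> F ?x / bilin \<alpha> ?x)) =
      (\<Sum>i\<in>UNIV. (4 * c + 1) * d $ i / u $ i)
   + (\<Sum>(i, j)\<in>{(1, 2), (1, 3), (2, 3)}. \<Sum>s\<in>{1, -1}. 2 * c * (d $ i + s * d $ j) / (u $ i + s * u $ j))
   + (\<Sum>e2\<in>{1, -1}. \<Sum>e3\<in>{1, -1}. 2 * (d $ 1 + e2 * d $ 2 + e3 * d $ 3) / (u $ 1 + e2 * u $ 2 + e3 * u $ 3))"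
    unfolding gA first_order_part .
  show ?thesis
    unfolding dunkl_laplacian_invariant[OF x] second normal first H_op_def
    by (simp add: d_def)
qed

lemma H_domain_generic:
  assumes u: "u \<in> H_domain" and \<alpha>: "\<alpha> \<in> F4" "bilin \<alpha> (\<phi> u) = 0"
  shows "\<alpha> = \<beta> \<or> \<alpha> = - \<beta>"
proof (cases "\<alpha> \<in> root_orbit F4 \<beta>")
  case True
  then obtain a where a: "a \<in> short_roots" "\<alpha> = p *s A a" unfolding orbit by blast
  obtain t where t: "t \<in> set short4" "a = root_vec t \<or> a = - root_vec t" using a(1) by (rule short_root_cases)
  have "bilin a (incl u) = 0" using \<alpha>(2) pq by (simp add: a(2) \<phi>_def bilin_simps bil)
  then have "bilin (root_vec t) (incl u) = 0" using t(2) by (auto simp: bilin_simps)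
  then have "t = (0,0,0,2)" using H_domain_roots(1)[OF u t(1)] by blast
  then have "a = axis 4 1 \<or> a = - axis 4 1" using t(2) axis_root_vec(4) by simp
  then show ?thesis using a(2) root clinear_minus[OF lin] by (auto simp: vector_smult_rneg)
next
  case False
  then have "\<alpha> \<in> (\<lambda>\<alpha>. q *s A \<alpha>) ` long_roots" using \<alpha>(1) other by blast
  then obtain a where a: "a \<in> long_roots" "\<alpha> = q *s A a" by blast
  obtain t where t: "t \<in> set long4" "a = root_vec t \<or> a = - root_vec t" using a(1) by (rule long_root_cases)
  have "bilin a (incl u) = 0" using \<alpha>(2) pq by (simp add: a(2) \<phi>_def bilin_simps bil)
  then have "bilin (root_vec t) (incl u) = 0" using t(2) by (auto simp: bilin_simps)
  then show ?thesis using H_domain_roots(2)[OF u t(1)] by blast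
qed

lemma invariant_extension_function:
  assumes "invariant_extension F4 U f U' F"
  shows "invariant_function F4 Rp m (\<Union>w\<in>coxeter_group F4. w ` U') F"
proof (unfold_locales)
  let ?V = "\<Union>w\<in>coxeter_group F4. w ` U'"
  show "analytic_open F ?V" using assms unfolding invariant_extension_def by blast
  show "reflection \<alpha> y \<in> ?V" if \<alpha>: "\<alpha> \<in> F4" and y: "y \<in> ?V" for \<alpha> y
  proof -
    obtain w z where w: "w \<in> coxeter_group F4" "z \<in> U'" "y = w z" using y by blast
    have "reflection \<alpha> y = (reflection \<alpha> \<circ> w) z" using w by simp
    then show ?thesis using coxeter_group.step[OF \<alpha> w(1)] w(2) by blast
  qed
  show "F (reflection \<alpha> y) = F y" if "\<alpha> \<in> F4" "y \<in> ?V" for \<alpha> y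
    using assms coxeter_group_reflection[OF that(1)] that(2) unfolding invariant_extension_def by blast
qed

text \<open>Independence of the extension: the value is \<open>H_op\<close> of
  \<open>F \<circ> \<phi>\<close>, a local operator, and \<open>F\<close> agrees with
  \<open>f\<close> on the relatively open set \<open>U\<close>.\<close>

lemma extension_value:
  assumes ext: "invariant_extension F4 U f U' F" and U: "openin (top_of_set (mirror \<beta>)) U"
    and x: "x \<in> U" and gen: "\<And>\<alpha>. \<alpha> \<in> F4 \<Longrightarrow> bilin \<alpha> x = 0 \<Longrightarrow> \<alpha> = \<beta> \<or> \<alpha> = - \<beta>"
  shows "dunkl_laplacian F4 Rp m F x = H_op c (f \<circ> \<phi>) (inv \<phi> x)"
proof -
  obtain T where T: "open T" "U = mirror \<beta> \<inter> T" using U unfolding openin_open by blast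
  obtain u where u: "x = \<phi> u" using x T(2) range_phi by blast
  have xV: "x \<in> (\<Union>w\<in>coxeter_group F4. w ` U')"
    using ext x coxeter_group.one unfolding invariant_extension_def by (metis UN_I id_apply image_eqI subsetD)
  have "dunkl_laplacian F4 Rp m F (\<phi> u) = H_op c (F \<circ> \<phi>) u"
    by (rule dunkl_laplacian_eq_H[OF invariant_extension_function[OF ext]]) (use xV gen u in auto)
  also have "\<dots> = H_op c (f \<circ> \<phi>) u"
  proof (rule H_op_cong)
    show "open (\<phi> -` T)" using T(1) continuous_on_phi by (rule open_vimage)
    show "u \<in> \<phi> -` T" using x u T(2) by simp
    show "(F \<circ> \<phi>) v = (f \<circ> \<phi>) v" if "v \<in> \<phi> -` T" for v
    proof -
      have "\<phi> v \<in> U" using that T(2) range_phi by blast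
      then show ?thesis using ext unfolding invariant_extension_def by simp
    qed
  qed
  finally show ?thesis unfolding u inv_phi .
qed

section \<open>Existence of invariant extensions\<close>

definition proj :: "complex ^ 4 \<Rightarrow> complex ^ 4" where
  "proj y = y - (bilin \<beta> y / bilin \<beta> \<beta>) *s \<beta>"

lemma proj_linear: "Vector_Spaces.linear (*s) (*s) proj"
  by (rule clinearI) (simp_all add: proj_def bilin_simps vec_eq_iff algebra_simps add_divide_distrib)

lemma proj_mirror: "proj y \<in> mirror \<beta>"
  using nonisotropic[OF root_F4] by (simp add: mirror_def proj_def bilin_simps)

lemma proj_fix: "x \<in> mirror \<beta> \<Longrightarrow> proj x = x"
  by (simp add: mirror_def proj_def)

lemma proj_reflection: "proj (reflection \<beta> y) = proj y"
  using nonisotropic[OF root_F4] by (simp add: proj_def reflection_def bilin_simps vec_eq_iff field_simps)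

text \<open>In a small ball around a generic point of the mirror the group acts through its stabilizer
  \<open>{id, reflection \<beta>}\<close>, so the extension constant in the normal direction can be moved around
  consistently by the group.\<close>

lemma invariant_extension_exists:
  assumes sep: "\<And>w y. w \<in> coxeter_group F4 \<Longrightarrow> y \<in> ball x0 e \<Longrightarrow> w y \<in> ball x0 e \<Longrightarrow> proj (w y) = proj y"
    and U: "openin (top_of_set (mirror \<beta>)) U" "U \<subseteq> ball x0 e" and f: "analytic_sub f U"
  shows "\<exists>U' F. invariant_extension F4 U f U' F"
proof -
  let ?W = "coxeter_group F4"
  obtain T where T: "open T" "U = mirror \<beta> \<inter> T" using U(1) unfolding openin_open by blast
  define U' where "U' = ball x0 e \<inter> proj -` T"
  have cp: "continuous_on S proj" for S
    using linear_continuous_on[OF clinear_bounded[OF proj_linear]] .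
  have oU': "open U'" unfolding U'_def by (intro open_Int open_ball open_vimage T(1) cp)
  have sub: "U \<subseteq> U'" using U(2) T(2) by (auto simp: U'_def proj_fix)
  have projU: "proj y \<in> U" if "y \<in> U'" for y using that T(2) proj_mirror by (simp add: U'_def)
  let ?V = "\<Union>w\<in>?W. w ` U'"
  \<comment> \<open>The value at \<open>y\<close> is read off at some representative of its orbit in
    \<open>U'\<close>; \<open>sep\<close> makes the choice immaterial.\<close>
  define F where "F = (\<lambda>y. f (proj (SOME z. z \<in> U' \<and> (\<exists>w\<in>?W. y = w z))))"
  have F: "F (w z) = f (proj z)" if w: "w \<in> ?W" and z: "z \<in> U'" for w z
  proof -
    define z' where "z' = (SOME z'. z' \<in> U' \<and> (\<exists>w'\<in>?W. w z = w' z'))"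
    have "z' \<in> U' \<and> (\<exists>w'\<in>?W. w z = w' z')"
      unfolding z'_def by (rule someI[of _ z]) (use w z in blast)
    then obtain w' where z': "z' \<in> U'" "w' \<in> ?W" "w z = w' z'" by blast
    obtain v where v: "v \<in> ?W" "\<And>x. v (w' x) = x" using z'(2) by (rule coxeter_group_inverse) blast
    have "(v \<circ> w) z = z'" using z'(3) v(2) by simp
    then have "proj z' = proj z"
      using sep[OF coxeter_group_comp[OF v(1) w], of z] z z'(1) by (simp add: U'_def)
    then show ?thesis unfolding F_def z'_def by simp
  qed
  have "analytic_open F ?V"
  proof (rule analytic_open_Union)
    fix y assume "y \<in> ?V"
    then obtain w z where w: "w \<in> ?W" "z \<in> U'" "y = w z" by blast
    obtain w' where w': "w' \<in> ?W" "\<And>x. w' (w x) = x" "\<And>x. w (w' x) = x"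
      using w(1) by (rule coxeter_group_inverse) blast
    obtain O' g where g: "proj z \<in> O'" "analytic_open g O'" and gf: "\<forall>y\<in>U \<inter> O'. g y = f y"
      using bspec[OF f[unfolded analytic_sub_def] projU[OF w(2)]] by (elim exE conjE)
    have lin': "Vector_Spaces.linear (*s) (*s) (proj \<circ> w')"
      using Vector_Spaces.linear_compose[OF coxeter_group_linear[OF w'(1)] proj_linear] .
    have cw': "continuous_on UNIV w'" "continuous_on UNIV (proj \<circ> w')"
      using linear_continuous_on[OF clinear_bounded] coxeter_group_linear[OF w'(1)] lin' by blast+
    \<comment> \<open>Around \<open>y\<close> the function is
      \<open>g \<circ> proj \<circ> w'\<close>, with \<open>g\<close> a local holomorphic extension
      of \<open>f\<close>; \<open>M\<close> is where this formula is valid.\<close>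
    define M where "M = w' -` U' \<inter> (proj \<circ> w') -` O'"
    have oM: "open M" unfolding M_def
      by (intro open_Int open_vimage oU' analytic_open_open[OF g(2)] cw')
    have "analytic_open (\<lambda>y. g ((proj \<circ> w') y)) M"
      by (rule analytic_open_linear[OF g(2) lin' oM]) (simp add: M_def)
    moreover have "g ((proj \<circ> w') y) = F y" if "y \<in> M" for y
    proof -
      have "w' y \<in> U'" "proj (w' y) \<in> U \<inter> O'" using that projU by (simp_all add: M_def)
      then show ?thesis using F[OF w(1), of "w' y"] gf w'(3) by simp
    qed
    ultimately have "analytic_open F M" by (rule analytic_open_cong[rotated])
    moreover have "y \<in> M" using w g(1) w'(2) by (simp add: M_def)
    moreover have "M \<subseteq> ?V"
    proof
      fix v assume "v \<in> M"
      then have "w' v \<in> U'" by (simp add: M_def)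
      then show "v \<in> ?V" using w(1) w'(3)[of v] by (intro UN_I[OF w(1)] image_eqI[of _ _ "w' v"]) simp_all
    qed
    ultimately show "\<exists>M. y \<in> M \<and> M \<subseteq> ?V \<and> analytic_open F M" by blast
  qed
  moreover have "F (w x) = F x" if w: "w \<in> ?W" and x: "x \<in> ?V" for w x
  proof -
    obtain w' z where w': "w' \<in> ?W" "z \<in> U'" "x = w' z" using x by blast
    then show ?thesis using F[OF coxeter_group_comp[OF w w'(1)] w'(2)] F[OF w'(1,2)] by simp
  qed
  moreover have "F x = f x" if "x \<in> U" for x
    using F[OF coxeter_group.one, of x] that sub T(2) proj_fix by auto
  ultimately have "invariant_extension F4 U f U' F"
    unfolding invariant_extension_def by (intro conjI ballI oU' sub)
  then show ?thesis by blast
qed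

lemma separating_radius:
  assumes x0: "x0 \<in> mirror \<beta>" and gen: "\<And>\<alpha>. \<alpha> \<in> F4 \<Longrightarrow> bilin \<alpha> x0 = 0 \<Longrightarrow> \<alpha> = \<beta> \<or> \<alpha> = - \<beta>"
  obtains e where "e > 0"
    "\<And>w y. w \<in> coxeter_group F4 \<Longrightarrow> y \<in> ball x0 e \<Longrightarrow> w y \<in> ball x0 e \<Longrightarrow> proj (w y) = proj y"
    "\<And>\<alpha> y. \<alpha> \<in> F4 \<Longrightarrow> y \<in> ball x0 e \<Longrightarrow> bilin \<alpha> y = 0 \<Longrightarrow> \<alpha> = \<beta> \<or> \<alpha> = - \<beta>"
proof -
  let ?W = "coxeter_group F4"
  have bl: "bounded_linear w" if "w \<in> ?W" for w using clinear_bounded[OF coxeter_group_linear[OF that]] .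
  \<comment> \<open>A common bound for the operator norms: so far the group is only known to
    preserve the bilinear form, not the norm.\<close>
  define C where "C = 1 + (\<Sum>w\<in>?W. onorm w)"
  have on: "onorm w \<le> C" if "w \<in> ?W" for w
    using member_le_sum[OF that, of onorm] onorm_pos_le[OF bl] finite_W by (fastforce simp: C_def)
  have C: "C > 0" using sum_nonneg[of ?W onorm] onorm_pos_le[OF bl] by (simp add: C_def)
  have nw: "norm (w z) \<le> C * norm z" if "w \<in> ?W" for w z
    using onorm[OF bl[OF that], of z] mult_right_mono[OF on[OF that] norm_ge_zero[of z]] by linarith
  obtain d where d: "d > 0" "\<And>w. w \<in> ?W \<Longrightarrow> w x0 \<noteq> x0 \<Longrightarrow> d \<le> dist x0 (w x0)"
    using finite_set_avoid[of "(\<lambda>w. w x0) ` ?W" x0] finite_W by auto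
  have o: "open (\<Inter>\<alpha>\<in>{\<alpha>\<in>F4. bilin \<alpha> x0 \<noteq> 0}. bilin \<alpha> -` (- {0}))"
    using finite_R by (intro open_INT ballI open_vimage linear_continuous_on bounded_linear_bilin) auto
  have i: "x0 \<in> (\<Inter>\<alpha>\<in>{\<alpha>\<in>F4. bilin \<alpha> x0 \<noteq> 0}. bilin \<alpha> -` (- {0}))" by simp
  obtain r where r: "r > 0" "ball x0 r \<subseteq> (\<Inter>\<alpha>\<in>{\<alpha>\<in>F4. bilin \<alpha> x0 \<noteq> 0}. bilin \<alpha> -` (- {0}))"
    by (rule openE[OF o i])
  define e where "e = min r (d / (C + 1))"
  have e: "e > 0" "e \<le> r" "C * e + e \<le> d"
  proof -
    show "e > 0" using r d C by (simp add: e_def)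
    show "e \<le> r" by (simp add: e_def)
    have "e \<le> d / (C + 1)" by (simp add: e_def)
    then have "e * (C + 1) \<le> d" using C by (simp add: pos_le_divide_eq)
    then show "C * e + e \<le> d" by (simp add: algebra_simps)
  qed
  show thesis
  proof (rule that[OF e(1)])
    fix w y assume w: "w \<in> ?W" and y: "y \<in> ball x0 e" "w y \<in> ball x0 e"
    have "w x0 = x0"
    proof (rule ccontr)
      assume "w x0 \<noteq> x0"
      then have "d \<le> dist x0 (w x0)" using d(2) w by blast
      also have "\<dots> \<le> dist x0 (w y) + dist (w y) (w x0)" by (rule dist_triangle)
      also have "dist (w y) (w x0) = norm (w (y - x0))"
        using bounded_linear.linear[OF bl[OF w]] by (simp add: dist_norm linear_diff)
      also have "\<dots> \<le> C * norm (y - x0)" by (rule nw[OF w])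
      also have "\<dots> \<le> C * e" using y(1) C by (simp add: dist_norm norm_minus_commute)
      also have "dist x0 (w y) < e" using y(2) by simp
      finally show False using e(3) by linarith
    qed
    then have "w = id \<or> w = reflection \<beta>"
      using stabilizer[OF root_F4 _ gen w] x0 by (simp add: mirror_def)
    then show "proj (w y) = proj y" using proj_reflection by auto
  next
    fix \<alpha> y assume "\<alpha> \<in> F4" "y \<in> ball x0 e" "bilin \<alpha> y = 0"
    have "bilin \<alpha> x0 = 0"
    proof (rule ccontr)
      assume "bilin \<alpha> x0 \<noteq> 0"
      moreover have "y \<in> ball x0 r" using \<open>y \<in> ball x0 e\<close> e(2) by simp
      ultimately have "y \<in> bilin \<alpha> -` (- {0})" using r(2) \<open>\<alpha> \<in> F4\<close> by blast
      then show False using \<open>bilin \<alpha> y = 0\<close> by simp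
    qed
    then show "\<alpha> = \<beta> \<or> \<alpha> = - \<beta>" using gen \<open>\<alpha> \<in> F4\<close> by blast
  qed
qed

theorem restricted_form: "restricted_operator_has_form F4 Rp m \<beta> \<phi> (H_op c)"
  unfolding restricted_operator_has_form_def
proof (intro ballI)
  fix x0 assume x0: "x0 \<in> generic_points F4 \<beta>"
  then have "x0 \<in> mirror \<beta>" unfolding generic_points_def by blast
  then obtain e where e: "e > 0"
    "\<And>w y. w \<in> coxeter_group F4 \<Longrightarrow> y \<in> ball x0 e \<Longrightarrow> w y \<in> ball x0 e \<Longrightarrow> proj (w y) = proj y"
    "\<And>\<alpha> y. \<alpha> \<in> F4 \<Longrightarrow> y \<in> ball x0 e \<Longrightarrow> bilin \<alpha> y = 0 \<Longrightarrow> \<alpha> = \<beta> \<or> \<alpha> = - \<beta>"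
    by (rule separating_radius) (use generic_pointsD[OF x0 _ _ root_F4] in blast)+
  show "\<exists>e>0. \<forall>U f. x0 \<in> U \<and> openin (top_of_set (mirror \<beta>)) U \<and> U \<subseteq> ball x0 e \<and> analytic_sub f U \<longrightarrow>
        restricted_maps F4 Rp m U f (\<lambda>x. H_op c (f \<circ> \<phi>) (inv \<phi> x))"
  proof (intro exI conjI allI impI)
    show "e > 0" by fact
    fix U f assume "x0 \<in> U \<and> openin (top_of_set (mirror \<beta>)) U \<and> U \<subseteq> ball x0 e \<and> analytic_sub f U"
    then have U: "openin (top_of_set (mirror \<beta>)) U" "U \<subseteq> ball x0 e" "analytic_sub f U" by blast+
    show "restricted_maps F4 Rp m U f (\<lambda>x. H_op c (f \<circ> \<phi>) (inv \<phi> x))"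
      unfolding restricted_maps_def
    proof (intro conjI allI impI ballI)
      show "\<exists>U' F. invariant_extension F4 U f U' F"
      proof (rule invariant_extension_exists[OF _ U])
        show "proj (w y) = proj y" if "w \<in> coxeter_group F4" "y \<in> ball x0 e" "w y \<in> ball x0 e" for w y
          using that by (rule e(2))
      qed
      fix U' F x assume "invariant_extension F4 U f U' F" "x \<in> U"
      then show "dunkl_laplacian F4 Rp m F x = H_op c (f \<circ> \<phi>) (inv \<phi> x)"
        using extension_value[OF _ U(1)] e(3) U(2) by blast
    qed
  qed
qed

end

section \<open>Dunkl operators on polynomials\<close>

text \<open>Products are generated through multiplication by a coordinate only. Inductions over
  polynomials then need no general product rule, just the commutation of an operator with a
  coordinate.\<close>

inductive cpoly :: "'n::finite func \<Rightarrow> bool" where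
  const: "cpoly (\<lambda>x. k)"
| add: "cpoly f \<Longrightarrow> cpoly g \<Longrightarrow> cpoly (\<lambda>x. f x + g x)"
| nth: "cpoly f \<Longrightarrow> cpoly (\<lambda>x. x $ i * f x)"

lemma cpoly_mult: "cpoly f \<Longrightarrow> cpoly g \<Longrightarrow> cpoly (\<lambda>x. f x * g x)"
proof (induction f rule: cpoly.induct)
  case (const k)
  from const show ?case
  proof (induction g rule: cpoly.induct)
    case (const l)
    show ?case using cpoly.const[of "k * l"] by simp
  next
    case (add f g)
    then show ?case using cpoly.add by (simp add: distrib_left)
  next
    case (nth f i)
    then show ?case using cpoly.nth[of "\<lambda>x. k * f x" i] by (simp add: mult.left_commute)
  qed
next
  case (add f f')
  then show ?case using cpoly.add[of "\<lambda>x. f x * g x" "\<lambda>x. f' x * g x"] by (simp add: distrib_right)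
next
  case (nth f i)
  then show ?case using cpoly.nth[of "\<lambda>x. f x * g x" i] by (simp add: mult.assoc)
qed

lemma cpoly_coord: "cpoly (\<lambda>x. x $ i)"
  using cpoly.nth[OF cpoly.const[of 1], of i] by simp

lemma cpoly_uminus: "cpoly f \<Longrightarrow> cpoly (\<lambda>x. - f x)"
  using cpoly_mult[OF cpoly.const[of "-1"]] by simp

lemma cpoly_diff: "cpoly f \<Longrightarrow> cpoly g \<Longrightarrow> cpoly (\<lambda>x. f x - g x)"
  using cpoly.add[OF _ cpoly_uminus] by simp

lemma cpoly_sum: "(\<And>i. i \<in> I \<Longrightarrow> cpoly (f i)) \<Longrightarrow> cpoly (\<lambda>x. \<Sum>i\<in>I. f i x)"
  by (induction I rule: infinite_finite_induct) (auto intro: cpoly.intros)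

lemma cpoly_prod: "(\<And>i. i \<in> I \<Longrightarrow> cpoly (f i)) \<Longrightarrow> cpoly (\<lambda>x. \<Prod>i\<in>I. f i x)"
  by (induction I rule: infinite_finite_induct) (auto intro: cpoly.intros cpoly_mult)

lemma cpoly_power: "cpoly f \<Longrightarrow> cpoly (\<lambda>x. f x ^ n)"
  by (induction n) (auto intro: cpoly.const cpoly_mult)

lemma cpoly_bilin: "cpoly (bilin a)"
  unfolding bilin_def[abs_def] by (intro cpoly_sum cpoly_mult cpoly.const cpoly_coord)

lemma cpoly_linear:
  assumes "Vector_Spaces.linear (*s) (*s) (h :: complex ^ 'k \<Rightarrow> complex ^ 'n)" "cpoly f"
  shows "cpoly (\<lambda>x. f (h x))"
  using assms(2)
proof (induction f rule: cpoly.induct)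
  case (nth f i)
  interpret h: Vector_Spaces.linear "(*s)" "(*s)" h by fact
  define a where "a = (\<chi> j. h (axis j 1) $ i)"
  have "h x $ i = bilin a x" for x
    unfolding a_def by (subst vec_expand[of x]) (simp add: h.sum h.scale bilin_def mult.commute)
  then show ?case using cpoly_mult[OF cpoly_bilin nth.IH] by simp
qed (auto intro: cpoly.intros)

lemma analytic_cpoly: "cpoly f \<Longrightarrow> open V \<Longrightarrow> analytic_open f V"
  by (induction f rule: cpoly.induct)
    (auto intro: analytic_open_const analytic_open_add analytic_open_mult analytic_open_nth)

lemma cpoly_partial: "cpoly f \<Longrightarrow> cpoly (partial i f)"
proof (induction f rule: cpoly.induct)
  case (const k)
  have "partial i (\<lambda>x. k) = (\<lambda>x. 0)" by (simp add: fun_eq_iff partial_def dir_deriv_const)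
  then show ?case by (simp add: cpoly.const)
next
  case (add f g)
  have "partial i (\<lambda>x. f x + g x) = (\<lambda>x. partial i f x + partial i g x)"
    unfolding partial_def fun_eq_iff
    using dir_deriv_add[OF analytic_cpoly[OF add.hyps(1) open_UNIV] analytic_cpoly[OF add.hyps(2) open_UNIV]] by simp
  then show ?case using cpoly.add[OF add.IH] by simp
next
  case (nth f j)
  have "partial i (\<lambda>x. x $ j * f x) = (\<lambda>x. x $ j * partial i f x + axis i 1 $ j * f x)"
    unfolding partial_def fun_eq_iff
    using dir_deriv_mult[OF analytic_open_nth[OF open_UNIV] analytic_cpoly[OF nth.hyps(1) open_UNIV]]
    by (simp add: dir_deriv_nth)
  then show ?case using cpoly.add[OF cpoly.nth[OF nth.IH] cpoly_mult[OF cpoly.const nth.hyps(1)]] by simp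
qed

lemma isCont_cpoly: "cpoly f \<Longrightarrow> isCont f x"
  using analytic_open_continuous_on[OF analytic_cpoly[OF _ open_UNIV]]
    continuous_on_eq_continuous_at[OF open_UNIV] by blast

section \<open>Polynomials as a type and the ring of additive operators on them\<close>

typedef (overloaded) 'n pol = "{f :: 'n::finite func. cpoly f}"
  using cpoly.const by blast

setup_lifting type_definition_pol

instantiation pol :: (finite) ab_group_add
begin
lift_definition zero_pol :: "'a pol" is "\<lambda>x. 0" by (rule cpoly.const)
lift_definition plus_pol :: "'a pol \<Rightarrow> 'a pol \<Rightarrow> 'a pol" is "\<lambda>f g x. f x + g x" by (rule cpoly.add)
lift_definition minus_pol :: "'a pol \<Rightarrow> 'a pol \<Rightarrow> 'a pol" is "\<lambda>f g x. f x - g x" by (rule cpoly_diff)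
lift_definition uminus_pol :: "'a pol \<Rightarrow> 'a pol" is "\<lambda>f x. - f x" by (rule cpoly_uminus)
instance by standard (transfer, simp add: algebra_simps fun_eq_iff)+
end

lift_definition mul_pol :: "'n::finite pol \<Rightarrow> 'n pol \<Rightarrow> 'n pol" is "\<lambda>f g x. f x * g x" by (rule cpoly_mult)
lift_definition const_pol :: "complex \<Rightarrow> 'n::finite pol" is "\<lambda>k x. k" by (rule cpoly.const)
lift_definition bilin_pol :: "complex ^ 'n \<Rightarrow> 'n::finite pol" is "bilin" by (rule cpoly_bilin)

text \<open>Additivity makes the operators a ring, and the class \<open>ring_1\<close> supplies
  noncommutative algebra and powers. Complex scalars are represented by the operators
  \<open>sc\<close>, so linearity becomes commutation with \<open>sc\<close>.\<close>

typedef (overloaded) 'n pend = "{T :: 'n::finite pol \<Rightarrow> 'n pol. \<forall>x y. T (x + y) = T x + T y}"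
  by (rule exI[of _ id]) simp

setup_lifting type_definition_pend

instantiation pend :: (finite) ring_1
begin
lift_definition zero_pend :: "'a pend" is "\<lambda>x. 0" by simp
lift_definition one_pend :: "'a pend" is "\<lambda>x. x" by simp
lift_definition plus_pend :: "'a pend \<Rightarrow> 'a pend \<Rightarrow> 'a pend" is "\<lambda>S T x. S x + T x" by (simp add: algebra_simps)
lift_definition minus_pend :: "'a pend \<Rightarrow> 'a pend \<Rightarrow> 'a pend" is "\<lambda>S T x. S x - T x" by (simp add: algebra_simps)
lift_definition uminus_pend :: "'a pend \<Rightarrow> 'a pend" is "\<lambda>T x. - T x" by simp
lift_definition times_pend :: "'a pend \<Rightarrow> 'a pend \<Rightarrow> 'a pend" is "\<lambda>S T x. S (T x)" by simp
instance
proof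
  have "const_pol 1 \<noteq> (0 :: 'a pol)" by transfer (simp add: fun_eq_iff)
  then show "(0::'a pend) \<noteq> 1" by transfer (auto simp: fun_eq_iff)
qed (transfer; simp add: algebra_simps fun_eq_iff)+
end

definition app :: "'n::finite pend \<Rightarrow> 'n pol \<Rightarrow> 'n pol" where "app = Rep_pend"

lemma app_Abs_pend: "(\<And>x y. T (x + y) = T x + T y) \<Longrightarrow> app (Abs_pend T) = T"
  unfolding app_def by (rule Abs_pend_inverse) simp

lemma app_simps: "app 0 P = 0" "app 1 P = P" "app (S + T) P = app S P + app T P"
  "app (S - T) P = app S P - app T P" "app (- T) P = - app T P" "app (S * T) P = app S (app T P)"
  "app T (P + Q) = app T P + app T Q"
  using Rep_pend[of T]
  by (simp_all add: app_def zero_pend.rep_eq one_pend.rep_eq plus_pend.rep_eq minus_pend.rep_eq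
      uminus_pend.rep_eq times_pend.rep_eq)

lemma app_sum: "app (\<Sum>i\<in>I. T i) P = (\<Sum>i\<in>I. app (T i) P)"
  by (induction I rule: infinite_finite_induct) (simp_all add: app_simps)

lemma pend_eqI: "(\<And>P. app S P = app T P) \<Longrightarrow> S = T"
  by (simp add: app_def fun_eq_iff flip: Rep_pend_inject)

lift_definition val :: "'n::finite pol \<Rightarrow> complex ^ 'n \<Rightarrow> complex" is "\<lambda>f. f" .

lemma cpoly_val: "cpoly (val P)"
  by transfer

lemma val_simps: "val 0 x = 0" "val (P + Q) x = val P x + val Q x" "val (P - Q) x = val P x - val Q x"
  "val (- P) x = - val P x" "val (const_pol k) x = k" "val (mul_pol P Q) x = val P x * val Q x"
  "val (bilin_pol a) x = bilin a x"
  by (transfer; simp)+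

lemma val_sum: "val (\<Sum>i\<in>I. P i) x = (\<Sum>i\<in>I. val (P i) x)"
  by (induction I rule: infinite_finite_induct) (simp_all add: val_simps)

lemma pol_eqI: "(\<And>x. val P x = val Q x) \<Longrightarrow> P = Q"
  by transfer (simp add: fun_eq_iff)

definition mul_op :: "'n::finite pol \<Rightarrow> 'n pend" where "mul_op P = Abs_pend (mul_pol P)"

definition X :: "complex ^ 'n \<Rightarrow> 'n::finite pend" where "X \<eta> = mul_op (bilin_pol \<eta>)"
definition sc :: "complex \<Rightarrow> 'n::finite pend" where "sc k = mul_op (const_pol k)"

lemma app_mul_op: "app (mul_op P) Q = mul_pol P Q"
  unfolding mul_op_def by (subst app_Abs_pend) (auto intro: pol_eqI simp: val_simps algebra_simps)

lemma val_X: "val (app (X \<eta>) P) x = bilin \<eta> x * val P x"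
  by (simp add: X_def app_mul_op val_simps)

lemma val_sc: "val (app (sc k) P) x = k * val P x"
  by (simp add: sc_def app_mul_op val_simps)

lemma pend_val_eqI: "(\<And>P x. val (app S P) x = val (app T P) x) \<Longrightarrow> S = T"
  by (intro pend_eqI pol_eqI)

lemmas val_app = app_simps val_simps val_X val_sc app_sum val_sum

lemma sc_simps: "sc (a + b) = sc a + sc b" "sc (a - b) = sc a - sc b" "sc (- a) = - sc a" "sc (a * b) = sc a * sc b"
  "sc 0 = 0" "sc 1 = 1"
  by (rule pend_val_eqI, simp add: val_app algebra_simps)+

lemma sc_sum: "sc (\<Sum>i\<in>I. f i) = (\<Sum>i\<in>I. sc (f i))"
  by (induction I rule: infinite_finite_induct) (simp_all add: sc_simps)

lemma sc_of_nat: "sc (of_nat n) = of_nat n"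
  by (induction n) (simp_all add: sc_simps)

lemma sc_sc: "sc a * sc b = sc b * sc a"
  by (simp add: mult.commute flip: sc_simps(4))

lift_definition refl_pol :: "complex ^ 'n \<Rightarrow> 'n::finite pol \<Rightarrow> 'n pol" is "\<lambda>\<alpha> f x. f (reflection \<alpha> x)"
  by (rule cpoly_linear[OF reflection_linear])

lemma val_refl_pol: "val (refl_pol \<alpha> P) x = val P (reflection \<alpha> x)"
  by transfer simp

definition S :: "complex ^ 'n \<Rightarrow> 'n::finite pend" where "S \<alpha> = Abs_pend (refl_pol \<alpha>)"

lemma val_S: "val (app (S \<alpha>) P) x = val P (reflection \<alpha> x)"
  unfolding S_def by (subst app_Abs_pend) (auto intro: pol_eqI simp: val_simps val_refl_pol)

lemma sc_S: "sc a * S \<alpha> = S \<alpha> * sc a"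
  by (rule pend_val_eqI) (simp add: val_app val_S)

lemma S_X: "S \<alpha> * X \<eta> = X (reflection \<alpha> \<eta>) * S \<alpha>"
  by (rule pend_val_eqI) (simp add: val_app val_S bilin_reflection_left)

lemma pol_induct [case_names const add mult]:
  assumes "\<And>k. Q (const_pol k)" "\<And>P P'. Q P \<Longrightarrow> Q P' \<Longrightarrow> Q (P + P')" "\<And>P i. Q P \<Longrightarrow> Q (app (X (axis i 1)) P)"
  shows "Q P"
proof -
  have "\<forall>P. val P = f \<longrightarrow> Q P" if "cpoly f" for f
    using that
  proof (induction f rule: cpoly.induct)
    case (const k)
    have "P = const_pol k" if "val P = (\<lambda>x. k)" for P :: "'a pol" by (rule pol_eqI) (simp add: that val_simps)
    then show ?case using assms(1) by blast
  next
    case (add f g)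
    obtain P P' where P: "val P = f" "val P' = g" using add.hyps by (metis mem_Collect_eq Abs_pol_inverse val.rep_eq)
    have "R = P + P'" if "val R = (\<lambda>x. f x + g x)" for R by (rule pol_eqI) (simp add: that P val_simps)
    then show ?case using add.IH P assms(2) by metis
  next
    case (nth f i)
    obtain P where P: "val P = f" using nth.hyps by (metis mem_Collect_eq Abs_pol_inverse val.rep_eq)
    have "R = app (X (axis i 1)) P" if "val R = (\<lambda>x. x $ i * f x)" for R
      by (rule pol_eqI) (simp add: that P val_X bilin_axis_left)
    then show ?case using nth.IH P assms(3) by metis
  qed
  then show ?thesis using cpoly_val by blast
qed

section \<open>Iterated commutators\<close>

definition ad :: "'r::ring_1 \<Rightarrow> 'r \<Rightarrow> 'r" where "ad A T = A * T - T * A"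

text \<open>\<open>nilp A n T Z\<close> expresses that \<open>ad A\<close> applied \<open>n\<close> times to \<open>T\<close> gives \<open>n! Z\<close> and that \<open>Z\<close>
  commutes with \<open>A\<close>; by the Leibniz rule it is multiplicative.\<close>

fun nilp :: "'r::ring_1 \<Rightarrow> nat \<Rightarrow> 'r \<Rightarrow> 'r \<Rightarrow> bool" where
  "nilp A 0 T Z \<longleftrightarrow> T = Z \<and> A * Z = Z * A"
| "nilp A (Suc n) T Z \<longleftrightarrow> nilp A n (ad A T) (of_nat (Suc n) * Z)"

lemma nilp_add: "nilp A n T Z \<Longrightarrow> nilp A n T' Z' \<Longrightarrow> nilp A n (T + T') (Z + Z')"
proof (induction n arbitrary: T Z T' Z')
  case (Suc n)
  have "ad A (T + T') = ad A T + ad A T'" by (simp add: ad_def algebra_simps)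
  then show ?case using Suc by (simp only: nilp.simps distrib_left)
qed (simp add: algebra_simps)

lemma nilp_zero: "nilp A n 0 0"
  by (induction n) (simp_all add: ad_def)

lemma nilp_sum: "(\<And>i. i \<in> I \<Longrightarrow> nilp A n (T i) (Z i)) \<Longrightarrow> nilp A n (\<Sum>i\<in>I. T i) (\<Sum>i\<in>I. Z i)"
  by (induction I rule: infinite_finite_induct) (simp_all add: nilp_zero nilp_add)

lemma nilp_scale: "A * k = k * A \<Longrightarrow> nilp A n T Z \<Longrightarrow> nilp A n (k * T) (k * Z)"
proof (induction n arbitrary: T Z)
  case 0
  then show ?case by (simp add: mult.assoc) (metis mult.assoc)
next
  case (Suc n)
  have "ad A (k * T) = A * k * T - k * T * A" by (simp add: ad_def mult.assoc)
  then have "ad A (k * T) = k * ad A T" using Suc.prems(1) by (simp add: ad_def algebra_simps)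
  then show ?case
    using Suc.IH[OF Suc.prems(1), of "ad A T" "of_nat (Suc n) * Z"] Suc.prems(2)
    by (simp only: nilp.simps mult.assoc[symmetric] mult_of_nat_commute[of "Suc n" k])
qed

lemma nilp_mult: "nilp A n T Z \<Longrightarrow> nilp A n' T' Z' \<Longrightarrow> nilp A (n + n') (T * T') (Z * Z')"
proof (induction "n + n'" arbitrary: n n' T T' Z Z')
  case 0
  then show ?case by (simp add: mult.assoc) (metis mult.assoc)
next
  case (Suc k)
  have leib: "ad A (T * T') = ad A T * T' + T * ad A T'" by (simp add: ad_def algebra_simps)
  have 1: "nilp A k (ad A T * T') (of_nat n * (Z * Z'))"
  proof (cases n)
    case 0
    then have "ad A T = 0" using Suc.prems by (simp add: ad_def)
    then show ?thesis using 0 by (simp add: nilp_zero)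
  next
    case (Suc i)
    then have "nilp A (i + n') (ad A T * T') (of_nat n * Z * Z')"
      using Suc.hyps(2) Suc.prems by (intro Suc.hyps(1)) (simp_all del: of_nat_Suc)
    moreover have "k = i + n'" using Suc Suc.hyps(2) by simp
    ultimately show ?thesis by (simp add: mult.assoc)
  qed
  have 2: "nilp A k (T * ad A T') (of_nat n' * (Z * Z'))"
  proof (cases n')
    case 0
    then have "ad A T' = 0" using Suc.prems by (simp add: ad_def)
    then show ?thesis using 0 by (simp add: nilp_zero)
  next
    case (Suc i)
    then have "nilp A (n + i) (T * ad A T') (Z * (of_nat n' * Z'))"
      using Suc.hyps(2) Suc.prems by (intro Suc.hyps(1)) (simp_all del: of_nat_Suc)
    moreover have "k = n + i" using Suc Suc.hyps(2) by simp
    moreover have "Z * (of_nat n' * Z') = of_nat n' * (Z * Z')"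
      by (metis mult.assoc mult_of_nat_commute)
    ultimately show ?thesis by simp
  qed
  have "nilp A k (ad A (T * T')) (of_nat n * (Z * Z') + of_nat n' * (Z * Z'))"
    unfolding leib by (rule nilp_add[OF 1 2])
  \<comment> \<open>Because \<open>nilp\<close> divides out the factorials, the two Leibniz terms
    add up with the factor \<open>n + n' = Suc k\<close> and no binomial coefficients
    appear.\<close>
  moreover have "of_nat n * (Z * Z') + of_nat n' * (Z * Z') = of_nat (Suc k) * (Z * Z')"
    unfolding Suc.hyps(2) by (simp only: of_nat_add distrib_right)
  ultimately show ?case unfolding Suc.hyps(2)[symmetric] nilp.simps by simp
qed

lemma nilp_power: "nilp A n T Z \<Longrightarrow> nilp A (n * k) (T ^ k) (Z ^ k)"
proof (induction k)
  case (Suc k)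
  then show ?case using nilp_mult[of A n T Z "n * k"] by simp
qed simp

lemma nilp_ad: "nilp A n T Z \<Longrightarrow> (ad A ^^ n) T = of_nat (fact n) * Z"
proof (induction n arbitrary: T Z)
  case (Suc n)
  then have "(ad A ^^ n) (ad A T) = of_nat (fact n) * (of_nat (Suc n) * Z)" by (simp only: nilp.simps)
  also have "\<dots> = of_nat (fact (Suc n)) * Z"
    by (simp only: mult.assoc[symmetric] of_nat_mult[symmetric] fact_Suc mult.commute[of "fact n"] of_nat_id)
  finally show ?case by (simp only: funpow_Suc_right comp_apply)
qed simp

lemma nilp_Suc: "nilp A n T Z \<Longrightarrow> nilp A (Suc n) T 0"
proof (induction n arbitrary: T Z)
  case 0
  then show ?case by (simp add: ad_def)
next
  case (Suc n)
  then show ?case using nilp.simps(2)[of A n T Z] nilp.simps(2)[of A "Suc n" T 0] by (metis mult_zero_right)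
qed

text \<open>Serves to discard the terms of lower order when more commutators are taken than their
  order.\<close>

lemma nilp_lower: "nilp A n T Z \<Longrightarrow> n < k \<Longrightarrow> nilp A k T 0"
proof (induction k)
  case (Suc k)
  then show ?case using nilp_Suc by (cases "n = k") auto
qed simp

lemma reflection_conj:
  assumes "bilin \<alpha> \<alpha> \<noteq> 0"
  shows "reflection \<alpha> (reflection \<gamma> y) = reflection (reflection \<alpha> \<gamma>) (reflection \<alpha> y)"
proof -
  have "reflection \<alpha> (y - t *s \<gamma>) = reflection \<alpha> y - t *s reflection \<alpha> \<gamma>" for t
    by (simp add: reflection_def bilin_simps vec_eq_iff algebra_simps diff_divide_distrib)
  then show ?thesis
    unfolding reflection_def[of \<gamma>] reflection_def[of "reflection \<alpha> \<gamma>"] bilin_reflection[OF assms] by simp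
qed

section \<open>The Dunkl operators and their commutation relations\<close>

context dunkl_system
begin

text \<open>Regular points are dense and polynomials continuous. A Dunkl operator has an explicit
  formula only off the mirrors, so identities between such operators are verified there.\<close>

lemma cpoly_eq_on_regular:
  assumes "cpoly f" "cpoly g" "\<And>y. y \<in> regular_points R \<Longrightarrow> f y = g y"
  shows "f = g"
proof
  fix x
  have f: "(f \<longlongrightarrow> f x) (at x within regular_points R)" and g: "(g \<longlongrightarrow> g x) (at x within regular_points R)"
    using isCont_cpoly[OF assms(1)] isCont_cpoly[OF assms(2)]
    by (simp_all add: isCont_def Lim_at_imp_Lim_at_within)
  have "\<forall>\<^sub>F y in at x within regular_points R. f y = g y"
    using eventually_regular by eventually_elim (rule assms(3))
  from Lim_transform_eventually[OF f this] show "f x = g x"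
    using tendsto_unique[OF at_regular_nontrivial _ g] by blast
qed

lemma dunkl_eq_cpoly:
  assumes "cpoly g" "\<And>y. y \<in> regular_points R \<Longrightarrow> dunkl_expr \<xi> f y = g y"
  shows "dunkl R Rp m \<xi> f = g"
proof
  fix x
  have g: "(g \<longlongrightarrow> g x) (at x within regular_points R)"
    using isCont_cpoly[OF assms(1)] by (simp add: isCont_def Lim_at_imp_Lim_at_within)
  have "\<forall>\<^sub>F y in at x within regular_points R. g y = dunkl_expr \<xi> f y"
    using eventually_regular by eventually_elim (rule assms(2)[symmetric])
  from Lim_transform_eventually[OF g this] show "dunkl R Rp m \<xi> f x = g x" by (rule dunkl_limI)
qed

lemma dunkl_expr_add:
  assumes "cpoly f" "cpoly g"
  shows "dunkl_expr \<xi> (\<lambda>x. f x + g x) y = dunkl_expr \<xi> f y + dunkl_expr \<xi> g y"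
proof -
  have "k * ((a + b) - (a' + b')) = k * (a - a') + k * (b - b')" for k a b a' b' :: complex
    by (simp add: algebra_simps)
  then show ?thesis
    unfolding dunkl_expr_def
      dir_deriv_add[OF analytic_cpoly[OF assms(1) open_UNIV] analytic_cpoly[OF assms(2) open_UNIV] UNIV_I]
    by (simp only: sum.distrib) simp
qed

text \<open>Minus the coefficient of \<open>S \<alpha>\<close> in the commutator of
  \<open>D \<xi>\<close> with \<open>X \<eta>\<close>.\<close>

definition coef :: "complex ^ 'n \<Rightarrow> complex ^ 'n \<Rightarrow> complex ^ 'n \<Rightarrow> complex" where
  "coef \<alpha> \<xi> \<eta> = 2 * m \<alpha> * bilin \<alpha> \<xi> * bilin \<alpha> \<eta> / bilin \<alpha> \<alpha>"

lemma dunkl_expr_bilin_mult: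
  assumes f: "cpoly f" and y: "y \<in> regular_points R"
  shows "dunkl_expr \<xi> (\<lambda>x. bilin \<eta> x * f x) y = bilin \<eta> y * dunkl_expr \<xi> f y + bilin \<eta> \<xi> * f y
     - (\<Sum>\<alpha>\<in>Rp. coef \<alpha> \<xi> \<eta> * f (reflection \<alpha> y))"
proof -
  have "m \<alpha> * bilin \<alpha> \<xi> / bilin \<alpha> y * (bilin \<eta> y * f y - bilin \<eta> (reflection \<alpha> y) * f (reflection \<alpha> y))
      = bilin \<eta> y * (m \<alpha> * bilin \<alpha> \<xi> / bilin \<alpha> y * (f y - f (reflection \<alpha> y))) + coef \<alpha> \<xi> \<eta> * f (reflection \<alpha> y)"
    if "\<alpha> \<in> Rp" for \<alpha>
  proof -
    have a: "bilin \<alpha> y \<noteq> 0" using that y Rp_sub by (auto simp: regular_points_def)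
    have "bilin \<alpha> \<alpha> \<noteq> 0" using that Rp_sub nonisotropic by blast
    moreover have e: "bilin \<eta> (reflection \<alpha> y) = bilin \<eta> y - 2 * bilin \<alpha> y / bilin \<alpha> \<alpha> * bilin \<alpha> \<eta>"
      by (simp add: reflection_def bilin_simps bilin_commute[of \<eta> \<alpha>])
    ultimately show ?thesis using a unfolding e coef_def by (simp add: field_simps)
  qed
  then have "(\<Sum>\<alpha>\<in>Rp. m \<alpha> * bilin \<alpha> \<xi> / bilin \<alpha> y * (bilin \<eta> y * f y - bilin \<eta> (reflection \<alpha> y) * f (reflection \<alpha> y)))
    = bilin \<eta> y * (\<Sum>\<alpha>\<in>Rp. m \<alpha> * bilin \<alpha> \<xi> / bilin \<alpha> y * (f y - f (reflection \<alpha> y)))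
      + (\<Sum>\<alpha>\<in>Rp. coef \<alpha> \<xi> \<eta> * f (reflection \<alpha> y))"
    by (simp add: sum_distrib_left flip: sum.distrib)
  moreover have "dir_deriv \<xi> (\<lambda>x. bilin \<eta> x * f x) y = bilin \<eta> y * dir_deriv \<xi> f y + bilin \<eta> \<xi> * f y"
    by (subst dir_deriv_mult[OF analytic_open_bilin[OF open_UNIV] analytic_cpoly[OF f open_UNIV] UNIV_I])
      (simp add: dir_deriv_bilin)
  ultimately show ?thesis unfolding dunkl_expr_def by (simp add: algebra_simps)
qed

text \<open>Induction over multiplications by coordinates: constants give zero, and the twisted
  Leibniz rule introduces no denominators.\<close>

lemma dunkl_cpoly:
  assumes "cpoly f"
  shows "cpoly (dunkl R Rp m \<xi> f) \<and> (\<forall>y\<in>regular_points R. dunkl R Rp m \<xi> f y = dunkl_expr \<xi> f y)"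
proof -
  have "\<exists>g. cpoly g \<and> (\<forall>y\<in>regular_points R. dunkl_expr \<xi> f y = g y)"
    using assms
  proof (induction f rule: cpoly.induct)
    case (const k)
    show ?case
      by (intro exI[of _ "\<lambda>x. 0"]) (auto simp: dunkl_expr_def dir_deriv_const intro: cpoly.const)
  next
    case (add f f')
    then obtain g g' where g: "cpoly g" "\<forall>y\<in>regular_points R. dunkl_expr \<xi> f y = g y"
      "cpoly g'" "\<forall>y\<in>regular_points R. dunkl_expr \<xi> f' y = g' y" by blast
    show ?case
      by (intro exI[of _ "\<lambda>x. g x + g' x"] conjI ballI cpoly.add g(1,3))
        (use g add.hyps in \<open>simp add: dunkl_expr_add\<close>)
  next
    case (nth f i)
    then obtain g where g: "cpoly g" "\<forall>y\<in>regular_points R. dunkl_expr \<xi> f y = g y" by blast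
    let ?e = "axis i 1 :: complex ^ 'n"
    let ?g = "\<lambda>y. bilin ?e y * g y + bilin ?e \<xi> * f y - (\<Sum>\<alpha>\<in>Rp. coef \<alpha> \<xi> ?e * f (reflection \<alpha> y))"
    have "cpoly ?g"
      by (intro cpoly_diff cpoly.add cpoly_sum cpoly_mult cpoly_bilin cpoly.const g(1) nth.hyps cpoly_linear[OF reflection_linear])
    moreover have "dunkl_expr \<xi> (\<lambda>x. x $ i * f x) y = ?g y" if "y \<in> regular_points R" for y
      using dunkl_expr_bilin_mult[OF nth.hyps that, of \<xi> ?e] g(2) that by (simp add: bilin_axis_left)
    ultimately show ?case by blast
  qed
  then show ?thesis using dunkl_eq_cpoly by metis
qed

definition D :: "complex ^ 'n \<Rightarrow> 'n pend" where
  "D \<xi> = Abs_pend (\<lambda>P. Abs_pol (dunkl R Rp m \<xi> (val P)))"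

lemma val_Abs_pol: "cpoly f \<Longrightarrow> val (Abs_pol f) = f"
  by (simp add: val.rep_eq Abs_pol_inverse)

lemma pol_regular_eqI: "(\<And>y. y \<in> regular_points R \<Longrightarrow> val P y = val Q y) \<Longrightarrow> P = Q"
  using cpoly_eq_on_regular[OF cpoly_val cpoly_val] by (metis pol_eqI)

lemma val_D: "val (app (D \<xi>) P) = dunkl R Rp m \<xi> (val P)"
proof -
  have "Abs_pol (dunkl R Rp m \<xi> (val (P + Q))) = Abs_pol (dunkl R Rp m \<xi> (val P)) + Abs_pol (dunkl R Rp m \<xi> (val Q))"
    (is "?a = _") for P Q
  proof (rule pol_regular_eqI)
    fix y assume y: "y \<in> regular_points R"
    have v: "val (P + Q) = (\<lambda>x. val P x + val Q x)" by (simp add: fun_eq_iff val_simps)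
    have d: "val (Abs_pol (dunkl R Rp m \<xi> (val P))) y = dunkl_expr \<xi> (val P) y" for P
      using y dunkl_cpoly[OF cpoly_val, of \<xi> P] by (simp add: val_Abs_pol)
    show "val ?a y = val (Abs_pol (dunkl R Rp m \<xi> (val P)) + Abs_pol (dunkl R Rp m \<xi> (val Q))) y"
      unfolding val_simps(2) d unfolding v by (rule dunkl_expr_add[OF cpoly_val cpoly_val])
  qed
  then show ?thesis
    unfolding D_def by (subst app_Abs_pend) (simp_all add: val_Abs_pol dunkl_cpoly cpoly_val)
qed

lemma val_D_regular: "y \<in> regular_points R \<Longrightarrow> val (app (D \<xi>) P) y = dunkl_expr \<xi> (val P) y"
  using dunkl_cpoly[OF cpoly_val] by (simp add: val_D)

lemma pend_regular_eqI:
  "(\<And>P y. y \<in> regular_points R \<Longrightarrow> val (app T P) y = val (app T' P) y) \<Longrightarrow> T = T'"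
  by (intro pend_eqI pol_regular_eqI)

lemma dir_deriv_val: "dir_deriv (a *s v) (val P) y = a * dir_deriv v (val P) y"
  "dir_deriv (v + w) (val P) y = dir_deriv v (val P) y + dir_deriv w (val P) y"
  using analytic_open_deriv(2)[OF analytic_cpoly[OF cpoly_val open_UNIV] UNIV_I]
    dir_deriv_add_vec[OF analytic_cpoly[OF cpoly_val open_UNIV] UNIV_I] by blast+

lemma D_add: "D (\<xi> + \<eta>) = D \<xi> + D \<eta>"
  by (rule pend_regular_eqI)
    (simp add: val_app val_D_regular dunkl_expr_def dir_deriv_val bilin_simps sum.distrib algebra_simps add_divide_distrib)

lemma sc_D: "sc a * D \<xi> = D \<xi> * sc a"
proof (rule pend_regular_eqI)
  fix P :: "'n pol" and y assume y: "y \<in> regular_points R"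
  have v: "val (app (sc a) P) = (\<lambda>x. a * val P x)" by (simp add: fun_eq_iff val_sc)
  have "dir_deriv \<xi> (\<lambda>x. a * val P x) y = a * dir_deriv \<xi> (val P) y"
    using dir_deriv_mult[OF analytic_open_const[OF open_UNIV] analytic_cpoly[OF cpoly_val open_UNIV] UNIV_I]
    by (simp add: dir_deriv_const)
  then show "val (app (sc a * D \<xi>) P) y = val (app (D \<xi> * sc a) P) y"
    using y by (simp add: app_simps val_sc val_D_regular v dunkl_expr_def)
      (simp add: algebra_simps sum_distrib_left)
qed

lemma D_sc_left: "D \<xi> * (sc a * T) = sc a * (D \<xi> * T)"
  by (simp only: mult.assoc[symmetric] sc_D)

lemma sc_left: "sc a * (sc b * T) = sc b * (sc a * T)"
  by (simp only: mult.assoc[symmetric] sc_sc[of a b])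

lemma D_scale: "D (a *s \<xi>) = sc a * D \<xi>"
proof (rule pend_regular_eqI)
  fix P :: "'n pol" and y assume y: "y \<in> regular_points R"
  show "val (app (D (a *s \<xi>)) P) y = val (app (sc a * D \<xi>) P) y"
    using y by (simp add: app_simps val_sc val_D_regular dunkl_expr_def dir_deriv_val bilin_simps)
      (simp add: algebra_simps sum_distrib_left)
qed

lemma D_minus: "D (- \<xi>) = - D \<xi>"
proof -
  have "(- 1) *s \<xi> = - \<xi>" by (simp add: vec_eq_iff)
  then show ?thesis using D_scale[of "-1" \<xi>] by (simp add: sc_simps)
qed

lemma D_sum: "D (\<Sum>i\<in>I. f i) = (\<Sum>i\<in>I. D (f i))"
proof (induction I rule: infinite_finite_induct)
  case empty
  show ?case using D_add[of 0 0] by simp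
next
  case (infinite I)
  show ?case using D_add[of 0 0] infinite by simp
qed (simp add: D_add)

text \<open>The commutator of \<open>D \<xi>\<close> with \<open>X \<eta>\<close>; the resulting
  \<open>D_X\<close> is one of the defining relations of the rational Cherednik algebra.\<close>

definition B :: "complex ^ 'n \<Rightarrow> complex ^ 'n \<Rightarrow> 'n pend" where
  "B \<xi> \<eta> = sc (bilin \<eta> \<xi>) - (\<Sum>\<alpha>\<in>Rp. sc (coef \<alpha> \<xi> \<eta>) * S \<alpha>)"

lemma D_X: "D \<xi> * X \<eta> = X \<eta> * D \<xi> + B \<xi> \<eta>"
proof (rule pend_regular_eqI)
  fix P :: "'n pol" and y assume y: "y \<in> regular_points R"
  have v: "val (app (X \<eta>) P) = (\<lambda>x. bilin \<eta> x * val P x)" by (simp add: fun_eq_iff val_X)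
  show "val (app (D \<xi> * X \<eta>) P) y = val (app (X \<eta> * D \<xi> + B \<xi> \<eta>) P) y"
    using y by (simp add: app_simps val_D_regular v dunkl_expr_bilin_mult[OF cpoly_val y] B_def val_app val_S)
qed

lemma bij_reflection: "\<alpha> \<in> R \<Longrightarrow> bij_betw (reflection \<alpha>) R R"
  using coxeter_group_bij_root[OF coxeter_group_reflection] .

text \<open>Conjugation by a reflection permutes the roots and keeps \<open>m\<close>, but it does
  not preserve \<open>Rp\<close>. The summands are even in the root, so the sum over
  \<open>Rp\<close> is half of a sum over \<open>R\<close>, on which the permutation can
  act.\<close>

lemma S_D:
  assumes \<alpha>: "\<alpha> \<in> R"
  shows "S \<alpha> * D \<xi> = D (reflection \<alpha> \<xi>) * S \<alpha>"
proof (rule pend_regular_eqI)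
  fix P :: "'n pol" and y assume y: "y \<in> regular_points R"
  let ?s = "reflection \<alpha>"
  have iso: "bilin (?s a) (?s b) = bilin a b" for a b by (rule bilin_reflection[OF nonisotropic[OF \<alpha>]])
  have inv: "?s (?s a) = a" for a by (rule reflection_reflection[OF nonisotropic[OF \<alpha>]])
  have sy: "?s y \<in> regular_points R"
    using y stable[OF \<alpha>] by (auto simp: regular_points_def simp flip: bilin_reflection_left)
  have v: "val (app (S \<alpha>) P) = (\<lambda>x. val P (?s x))" by (simp add: fun_eq_iff val_S)
  let ?g = "\<lambda>\<gamma>. m \<gamma> * bilin \<gamma> \<xi> / bilin \<gamma> (?s y) * (val P (?s y) - val P (reflection \<gamma> (?s y)))"
  let ?h = "\<lambda>\<gamma>. m \<gamma> * bilin \<gamma> (?s \<xi>) / bilin \<gamma> y * (val P (?s y) - val P (?s (reflection \<gamma> y)))"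
  have even: "?g (- \<gamma>) = ?g \<gamma>" "?h (- \<gamma>) = ?h \<gamma>" if "\<gamma> \<in> R" for \<gamma>
    using m_minus[OF that] by (simp_all add: bilin_simps reflection_minus_root)
  have "2 * (\<Sum>\<gamma>\<in>Rp. ?g \<gamma>) = (\<Sum>\<gamma>\<in>R. ?g \<gamma>)" by (rule sum_positive[symmetric]) (rule even(1))
  also have "\<dots> = (\<Sum>\<gamma>\<in>R. ?g (?s \<gamma>))" by (rule sum.reindex_bij_betw[OF bij_reflection[OF \<alpha>], symmetric])
  also have "\<dots> = (\<Sum>\<gamma>\<in>R. ?h \<gamma>)"
  proof (rule sum.cong[OF refl])
    fix \<gamma> assume "\<gamma> \<in> R"
    then show "?g (?s \<gamma>) = ?h \<gamma>"
      using m_inv[OF \<alpha>] reflection_conj[OF nonisotropic[OF \<alpha>], of \<gamma> y]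
      by (simp add: iso bilin_reflection_left inv)
  qed
  also have "\<dots> = 2 * (\<Sum>\<gamma>\<in>Rp. ?h \<gamma>)" by (rule sum_positive) (rule even(2))
  finally have gh: "(\<Sum>\<gamma>\<in>Rp. ?g \<gamma>) = (\<Sum>\<gamma>\<in>Rp. ?h \<gamma>)" by simp
  have "dir_deriv (?s \<xi>) (\<lambda>x. val P (?s x)) y = dir_deriv \<xi> (val P) (?s y)"
    using dir_deriv_linear[OF analytic_cpoly[OF cpoly_val open_UNIV] reflection_linear UNIV_I, of "?s \<xi>"] inv by simp
  then show "val (app (S \<alpha> * D \<xi>) P) y = val (app (D (?s \<xi>) * S \<alpha>) P) y"
    using y sy gh by (simp add: app_simps val_S val_D_regular v dunkl_expr_def)
qed

lemma S_D_commutator: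
  assumes \<alpha>: "\<alpha> \<in> R"
  shows "S \<alpha> * D \<eta> - D \<eta> * S \<alpha> = - (sc (2 * bilin \<alpha> \<eta> / bilin \<alpha> \<alpha>) * (D \<alpha> * S \<alpha>))"
proof -
  have "reflection \<alpha> \<eta> = \<eta> + (- (2 * bilin \<alpha> \<eta> / bilin \<alpha> \<alpha>)) *s \<alpha>"
    by (simp add: reflection_def vec_eq_iff)
  then have r: "D (reflection \<alpha> \<eta>) = D \<eta> - sc (2 * bilin \<alpha> \<eta> / bilin \<alpha> \<alpha>) * D \<alpha>"
    by (simp only: D_add D_scale sc_simps)  (simp add: algebra_simps)
  show ?thesis unfolding S_D[OF \<alpha>] r by (simp add: left_diff_distrib mult.assoc)
qed

lemma B_D_commutator:
  "B \<xi> \<zeta> * D \<eta> - D \<eta> * B \<xi> \<zeta> = (\<Sum>\<alpha>\<in>Rp. sc (coef \<alpha> \<xi> \<zeta> * (2 * bilin \<alpha> \<eta> / bilin \<alpha> \<alpha>)) * (D \<alpha> * S \<alpha>))"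
proof -
  have "B \<xi> \<zeta> * D \<eta> - D \<eta> * B \<xi> \<zeta> = - (\<Sum>\<alpha>\<in>Rp. sc (coef \<alpha> \<xi> \<zeta>) * (S \<alpha> * D \<eta> - D \<eta> * S \<alpha>))"
  proof -
    have "sc a * (S \<alpha> * D \<eta> - D \<eta> * S \<alpha>) = sc a * S \<alpha> * D \<eta> - D \<eta> * (sc a * S \<alpha>)" for a \<alpha>
      by (simp add: right_diff_distrib mult.assoc[symmetric] sc_D)
    then show ?thesis
      by (simp add: B_def left_diff_distrib right_diff_distrib sum_distrib_left sum_distrib_right sc_D sum_subtractf)
  qed
  also have "\<dots> = (\<Sum>\<alpha>\<in>Rp. sc (coef \<alpha> \<xi> \<zeta> * (2 * bilin \<alpha> \<eta> / bilin \<alpha> \<alpha>)) * (D \<alpha> * S \<alpha>))"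
    unfolding sum_negf[symmetric]
  proof (rule sum.cong[OF refl])
    fix \<alpha> assume "\<alpha> \<in> Rp"
    then have "\<alpha> \<in> R" using Rp_sub by blast
    then show "- (sc (coef \<alpha> \<xi> \<zeta>) * (S \<alpha> * D \<eta> - D \<eta> * S \<alpha>)) = sc (coef \<alpha> \<xi> \<zeta> * (2 * bilin \<alpha> \<eta> / bilin \<alpha> \<alpha>)) * (D \<alpha> * S \<alpha>)"
      unfolding S_D_commutator[OF \<open>\<alpha> \<in> R\<close>] sc_simps(4)[of "coef \<alpha> \<xi> \<zeta>"] by (simp only: mult.assoc mult_minus_right minus_minus)
  qed
  finally show ?thesis .
qed

text \<open>The commutator of two Dunkl operators commutes with multiplication by coordinates (Jacobi
  identity) and annihilates constants, so it annihilates all polynomials.\<close>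

theorem D_commute: "D \<xi> * D \<eta> = D \<eta> * D \<xi>"
proof -
  define C where "C = D \<xi> * D \<eta> - D \<eta> * D \<xi>"
  have CX: "C * X \<zeta> = X \<zeta> * C" for \<zeta>
  proof -
    have dd: "D a * D b * X \<zeta> = X \<zeta> * D a * D b + B a \<zeta> * D b + D a * B b \<zeta>" for a b
    proof -
      have "D a * D b * X \<zeta> = D a * (X \<zeta> * D b + B b \<zeta>)" by (simp only: mult.assoc D_X)
      also have "\<dots> = (D a * X \<zeta>) * D b + D a * B b \<zeta>" by (simp only: distrib_left mult.assoc)
      also have "\<dots> = (X \<zeta> * D a + B a \<zeta>) * D b + D a * B b \<zeta>" by (simp only: D_X)
      finally show ?thesis by (simp only: distrib_right)
    qed
    have "C * X \<zeta> - X \<zeta> * C = (B \<xi> \<zeta> * D \<eta> - D \<eta> * B \<xi> \<zeta>) - (B \<eta> \<zeta> * D \<xi> - D \<xi> * B \<eta> \<zeta>)"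
      unfolding C_def by (simp add: left_diff_distrib right_diff_distrib dd) (simp add: algebra_simps)
    \<comment> \<open>Each coefficient is \<open>4 * m \<alpha>\<close> times the pairings of
      \<alpha> with \<xi>, \<eta> and \<zeta>, divided by the square of
      \<open>bilin \<alpha> \<alpha>\<close>; this is symmetric in \<xi> and \<eta>.\<close>
    also have "\<dots> = 0" unfolding B_D_commutator by (simp add: coef_def mult_ac)
    finally show ?thesis by simp
  qed
  have D_const: "app (D a) (const_pol k) = 0" for a k
  proof (rule pol_regular_eqI)
    fix y assume "y \<in> regular_points R"
    moreover have "val (const_pol k :: 'n pol) = (\<lambda>x. k)" by (simp add: fun_eq_iff val_simps)
    ultimately show "val (app (D a) (const_pol k)) y = val 0 y"
      by (simp add: val_D_regular dunkl_expr_def dir_deriv_const val_simps)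
  qed
  have app0: "app T 0 = 0" for T :: "'n pend" using app_simps(7)[of T 0 0] by simp
  have "app C P = 0" for P
  proof (induction P rule: pol_induct)
    case (const k)
    show ?case by (simp add: C_def app_simps D_const app0)
  next
    case (mult P i)
    then show ?case using arg_cong[OF CX, of "\<lambda>T. app T P"] by (simp add: app_simps app0)
  qed (simp add: app_simps)
  then have "C = 0" by (intro pend_eqI) (simp add: app_simps)
  then show ?thesis by (simp add: C_def)
qed

abbreviation e :: "'n \<Rightarrow> complex ^ 'n" where "e i \<equiv> axis i 1"

definition Lap :: "'n pend" where "Lap = (\<Sum>i\<in>UNIV. D (e i) * D (e i))"

text \<open>Multiplication by \<open>(x, x) / 2\<close>, normalized so that its commutator with
  \<open>D \<xi>\<close> is exactly \<open>- X \<xi>\<close>.\<close>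

definition E :: "'n pend" where "E = sc (1 / 2) * (\<Sum>i\<in>UNIV. X (e i) * X (e i))"

lemma D_expand: "(\<Sum>i\<in>UNIV. sc (\<eta> $ i) * D (e i)) = D \<eta>"
  by (subst (2) vec_expand[of \<eta>]) (simp only: D_sum D_scale)

lemma S_D_self: "\<alpha> \<in> R \<Longrightarrow> S \<alpha> * D \<alpha> = - (D \<alpha> * S \<alpha>)"
  using S_D[of \<alpha> \<alpha>] by (simp add: reflection_self nonisotropic D_minus)

lemma Lap_D: "Lap * D \<xi> = D \<xi> * Lap"
  unfolding Lap_def sum_distrib_left sum_distrib_right
proof (rule sum.cong[OF refl])
  fix i
  have "D (e i) * D (e i) * D \<xi> = D (e i) * (D \<xi> * D (e i))"
    by (simp only: mult.assoc D_commute[of "e i" \<xi>])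
  also have "\<dots> = D \<xi> * (D (e i) * D (e i))"
    by (simp only: mult.assoc[symmetric] D_commute[of "e i" \<xi>])
  finally show "D (e i) * D (e i) * D \<xi> = D \<xi> * (D (e i) * D (e i))" .
qed

text \<open>The commutators \<open>B (e i) \<eta>\<close> contribute \<open>D \<eta>\<close> twice,
  together with multiples of \<open>S \<alpha> * D \<alpha> + D \<alpha> * S \<alpha>\<close>; the
  latter is zero by \<open>S_D_self\<close>.\<close>

lemma Lap_X: "Lap * X \<eta> - X \<eta> * Lap = 2 * D \<eta>"
proof -
  have Bi: "B (e i) \<eta> = sc (\<eta> $ i) - (\<Sum>\<alpha>\<in>Rp. sc (2 * m \<alpha> * bilin \<alpha> \<eta> / bilin \<alpha> \<alpha>) * sc (\<alpha> $ i) * S \<alpha>)" for i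
    unfolding B_def coef_def bilin_axis_right by (simp add: mult_ac flip: sc_simps(4))
  have "D (e i) * D (e i) * X \<eta> - X \<eta> * (D (e i) * D (e i)) = B (e i) \<eta> * D (e i) + D (e i) * B (e i) \<eta>" for i
  proof -
    have "D (e i) * D (e i) * X \<eta> = D (e i) * (X \<eta> * D (e i) + B (e i) \<eta>)" by (simp only: mult.assoc D_X)
    also have "\<dots> = (D (e i) * X \<eta>) * D (e i) + D (e i) * B (e i) \<eta>" by (simp only: distrib_left mult.assoc)
    also have "\<dots> = (X \<eta> * D (e i) + B (e i) \<eta>) * D (e i) + D (e i) * B (e i) \<eta>" by (simp only: D_X)
    finally show ?thesis by (simp add: distrib_right mult.assoc)
  qed
  then have "Lap * X \<eta> - X \<eta> * Lap = (\<Sum>i\<in>UNIV. B (e i) \<eta> * D (e i) + D (e i) * B (e i) \<eta>)"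
    by (simp add: Lap_def sum_distrib_left sum_distrib_right flip: sum_subtractf)
  also have "\<dots> = (\<Sum>i\<in>UNIV. B (e i) \<eta> * D (e i)) + (\<Sum>i\<in>UNIV. D (e i) * B (e i) \<eta>)"
    by (rule sum.distrib)
  also have "(\<Sum>i\<in>UNIV. B (e i) \<eta> * D (e i)) = D \<eta> - (\<Sum>\<alpha>\<in>Rp. sc (2 * m \<alpha> * bilin \<alpha> \<eta> / bilin \<alpha> \<alpha>) * (S \<alpha> * D \<alpha>))"
  proof -
    have "(\<Sum>i\<in>UNIV. B (e i) \<eta> * D (e i)) = D \<eta> - (\<Sum>i\<in>UNIV. \<Sum>\<alpha>\<in>Rp. sc (2 * m \<alpha> * bilin \<alpha> \<eta> / bilin \<alpha> \<alpha>) * (S \<alpha> * (sc (\<alpha> $ i) * D (e i))))"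
      unfolding Bi left_diff_distrib sum_subtractf D_expand sum_distrib_right by (simp add: mult.assoc sc_S)
    also have "(\<Sum>i\<in>UNIV. \<Sum>\<alpha>\<in>Rp. sc (2 * m \<alpha> * bilin \<alpha> \<eta> / bilin \<alpha> \<alpha>) * (S \<alpha> * (sc (\<alpha> $ i) * D (e i))))
      = (\<Sum>\<alpha>\<in>Rp. \<Sum>i\<in>UNIV. sc (2 * m \<alpha> * bilin \<alpha> \<eta> / bilin \<alpha> \<alpha>) * (S \<alpha> * (sc (\<alpha> $ i) * D (e i))))"
      by (rule sum.swap)
    finally show ?thesis by (simp add: D_expand flip: sum_distrib_left)
  qed
  also have "(\<Sum>i\<in>UNIV. D (e i) * B (e i) \<eta>) = D \<eta> - (\<Sum>\<alpha>\<in>Rp. sc (2 * m \<alpha> * bilin \<alpha> \<eta> / bilin \<alpha> \<alpha>) * (D \<alpha> * S \<alpha>))"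
  proof -
    have t: "D (e i) * (sc a * sc b * S \<alpha>) = sc a * ((sc b * D (e i)) * S \<alpha>)" for i a b \<alpha>
      by (simp only: mult.assoc D_sc_left)
    have "(\<Sum>i\<in>UNIV. D (e i) * B (e i) \<eta>) = D \<eta> - (\<Sum>i\<in>UNIV. \<Sum>\<alpha>\<in>Rp. sc (2 * m \<alpha> * bilin \<alpha> \<eta> / bilin \<alpha> \<alpha>) * ((sc (\<alpha> $ i) * D (e i)) * S \<alpha>))"
      unfolding Bi right_diff_distrib sum_subtractf sum_distrib_left t sc_D[symmetric] D_expand ..
    also have "(\<Sum>i\<in>UNIV. \<Sum>\<alpha>\<in>Rp. sc (2 * m \<alpha> * bilin \<alpha> \<eta> / bilin \<alpha> \<alpha>) * ((sc (\<alpha> $ i) * D (e i)) * S \<alpha>))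
      = (\<Sum>\<alpha>\<in>Rp. \<Sum>i\<in>UNIV. sc (2 * m \<alpha> * bilin \<alpha> \<eta> / bilin \<alpha> \<alpha>) * ((sc (\<alpha> $ i) * D (e i)) * S \<alpha>))"
      by (rule sum.swap)
    finally show ?thesis by (simp add: D_expand flip: sum_distrib_left sum_distrib_right)
  qed
  finally have "Lap * X \<eta> - X \<eta> * Lap = (D \<eta> + D \<eta>) - ((\<Sum>\<alpha>\<in>Rp. sc (2 * m \<alpha> * bilin \<alpha> \<eta> / bilin \<alpha> \<alpha>) * (S \<alpha> * D \<alpha>))
      + (\<Sum>\<alpha>\<in>Rp. sc (2 * m \<alpha> * bilin \<alpha> \<eta> / bilin \<alpha> \<alpha>) * (D \<alpha> * S \<alpha>)))"
    by (simp add: algebra_simps)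
  also have "(\<Sum>\<alpha>\<in>Rp. sc (2 * m \<alpha> * bilin \<alpha> \<eta> / bilin \<alpha> \<alpha>) * (S \<alpha> * D \<alpha>)) = - (\<Sum>\<alpha>\<in>Rp. sc (2 * m \<alpha> * bilin \<alpha> \<eta> / bilin \<alpha> \<alpha>) * (D \<alpha> * S \<alpha>))"
    unfolding sum_negf[symmetric]
  proof (rule sum.cong[OF refl])
    fix \<alpha> assume "\<alpha> \<in> Rp"
    then have "\<alpha> \<in> R" using Rp_sub by blast
    then show "sc (2 * m \<alpha> * bilin \<alpha> \<eta> / bilin \<alpha> \<alpha>) * (S \<alpha> * D \<alpha>) = - (sc (2 * m \<alpha> * bilin \<alpha> \<eta> / bilin \<alpha> \<alpha>) * (D \<alpha> * S \<alpha>))"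
      by (simp only: S_D_self mult_minus_right)
  qed
  also have "(D \<eta> + D \<eta>) - (- (\<Sum>\<alpha>\<in>Rp. sc (2 * m \<alpha> * bilin \<alpha> \<eta> / bilin \<alpha> \<alpha>) * (D \<alpha> * S \<alpha>))
      + (\<Sum>\<alpha>\<in>Rp. sc (2 * m \<alpha> * bilin \<alpha> \<eta> / bilin \<alpha> \<alpha>) * (D \<alpha> * S \<alpha>))) = 2 * D \<eta>"
    by (simp only: mult_2 left_minus diff_0_right)
  finally show ?thesis .
qed

lemma val_E: "val (app E P) x = bilin x x / 2 * val P x"
  unfolding E_def by (simp add: val_app bilin_axis_left bilin_def[of x x] sum_distrib_right mult.assoc)

text \<open>The function \<open>(x, x) / 2\<close> is invariant, so it passes through every
  difference term and only its derivative in direction \<xi> survives.\<close>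

lemma E_D: "E * D \<xi> - D \<xi> * E = - X \<xi>"
proof (rule pend_regular_eqI)
  fix P :: "'n pol" and y assume y: "y \<in> regular_points R"
  have v: "val (app E P) = (\<lambda>x. bilin x x / 2 * val P x)" by (simp add: fun_eq_iff val_E)
  have an: "analytic_open (\<lambda>x. bilin x x / 2) UNIV"
    unfolding bilin_def by (intro analytic_open_divide analytic_open_sum analytic_open_mult analytic_open_nth analytic_open_const) auto
  have "((\<lambda>x. bilin x x / 2) has_derivative (\<lambda>v. bilin y v)) (at y)"
    unfolding bilin_def by (auto intro!: derivative_eq_intros bounded_linear_imp_has_derivative bounded_linear_vec_nth
      simp: sum_divide_distrib[symmetric] sum.distrib[symmetric] mult.commute sum_distrib_left[symmetric])
  then have d: "dir_deriv \<xi> (\<lambda>x. bilin x x / 2) y = bilin y \<xi>"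
    by (rule has_derivative_imp_dir_deriv) (simp add: bilin_simps)
  have "dir_deriv \<xi> (\<lambda>x. bilin x x / 2 * val P x) y = bilin y y / 2 * dir_deriv \<xi> (val P) y + bilin y \<xi> * val P y"
    by (subst dir_deriv_mult[OF an analytic_cpoly[OF cpoly_val open_UNIV] UNIV_I]) (simp add: d)
  moreover have "bilin (reflection \<alpha> y) (reflection \<alpha> y) = bilin y y" if "\<alpha> \<in> Rp" for \<alpha>
    using that Rp_sub nonisotropic bilin_reflection by blast
  then have "(\<Sum>\<alpha>\<in>Rp. m \<alpha> * bilin \<alpha> \<xi> / bilin \<alpha> y * (bilin y y / 2 * val P y - bilin (reflection \<alpha> y) (reflection \<alpha> y) / 2 * val P (reflection \<alpha> y)))
    = bilin y y / 2 * (\<Sum>\<alpha>\<in>Rp. m \<alpha> * bilin \<alpha> \<xi> / bilin \<alpha> y * (val P y - val P (reflection \<alpha> y)))"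
  proof -
    assume q: "\<And>\<alpha>. \<alpha> \<in> Rp \<Longrightarrow> bilin (reflection \<alpha> y) (reflection \<alpha> y) = bilin y y"
    have kk: "k * (b * a - b * a') = b * (k * (a - a'))" for k a a' b :: complex by (simp add: algebra_simps)
    show ?thesis unfolding sum_distrib_left by (intro sum.cong refl) (simp only: q kk)
  qed
  ultimately have "dunkl_expr \<xi> (\<lambda>x. bilin x x / 2 * val P x) y = bilin y y / 2 * dunkl_expr \<xi> (val P) y + bilin y \<xi> * val P y"
    unfolding dunkl_expr_def by (simp add: algebra_simps)
  then show "val (app (E * D \<xi> - D \<xi> * E) P) y = val (app (- X \<xi>) P) y"
    using y by (simp add: val_app val_D_regular v val_E bilin_commute[of y \<xi>])
qed

lemma E_X: "E * X \<xi> = X \<xi> * E"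
  by (rule pend_val_eqI) (simp add: app_simps val_X val_E)

text \<open>A sum of squares over an orthonormal basis is unchanged by an isometry. Here the
  correction is \<open>k * k * bilin \<alpha> \<alpha> - 2 * k\<close> times
  \<open>D \<alpha> * D \<alpha>\<close>, and \<open>k\<close> makes this zero.\<close>

lemma S_Lap:
  assumes \<alpha>: "\<alpha> \<in> R"
  shows "S \<alpha> * Lap = Lap * S \<alpha>"
proof -
  define k where "k = 2 / bilin \<alpha> \<alpha>"
  have sD: "D (reflection \<alpha> (e i)) = D (e i) - sc k * (sc (\<alpha> $ i) * D \<alpha>)" for i
  proof -
    have "reflection \<alpha> (e i) = e i + (- (k * \<alpha> $ i)) *s \<alpha>"
      by (simp add: reflection_def bilin_axis_right k_def vec_eq_iff)
    then show ?thesis by (simp only: D_add D_scale sc_simps) (simp add: mult.assoc)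
  qed
  have "S \<alpha> * Lap = (\<Sum>i\<in>UNIV. D (reflection \<alpha> (e i)) * D (reflection \<alpha> (e i))) * S \<alpha>"
    unfolding Lap_def sum_distrib_left sum_distrib_right
  proof (rule sum.cong[OF refl])
    fix i
    have "S \<alpha> * (D (e i) * D (e i)) = (S \<alpha> * D (e i)) * D (e i)" by (simp only: mult.assoc)
    also have "\<dots> = (D (reflection \<alpha> (e i)) * S \<alpha>) * D (e i)" by (simp only: S_D[OF \<alpha>])
    also have "\<dots> = D (reflection \<alpha> (e i)) * (S \<alpha> * D (e i))" by (simp only: mult.assoc)
    also have "\<dots> = D (reflection \<alpha> (e i)) * (D (reflection \<alpha> (e i)) * S \<alpha>)"
      by (simp only: S_D[OF \<alpha>])
    finally show "S \<alpha> * (D (e i) * D (e i)) = D (reflection \<alpha> (e i)) * D (reflection \<alpha> (e i)) * S \<alpha>"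
      by (simp only: mult.assoc)
  qed
  also have "(\<Sum>i\<in>UNIV. D (reflection \<alpha> (e i)) * D (reflection \<alpha> (e i))) = Lap"
  proof -
    have sq: "D (reflection \<alpha> (e i)) * D (reflection \<alpha> (e i)) = D (e i) * D (e i)
       - sc (2 * k) * ((sc (\<alpha> $ i) * D (e i)) * D \<alpha>) + sc (k * k * (\<alpha> $ i * \<alpha> $ i)) * (D \<alpha> * D \<alpha>)" for i
    proof -
      have "D (e i) * (sc k * (sc (\<alpha> $ i) * D \<alpha>)) = sc k * ((sc (\<alpha> $ i) * D (e i)) * D \<alpha>)"
        by (simp only: mult.assoc D_sc_left)
      moreover have "sc k * (sc (\<alpha> $ i) * D \<alpha>) * D (e i) = sc k * ((sc (\<alpha> $ i) * D (e i)) * D \<alpha>)"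
        by (simp only: mult.assoc D_commute[of \<alpha> "e i"])
      moreover have "sc k * (sc (\<alpha> $ i) * D \<alpha>) * (sc k * (sc (\<alpha> $ i) * D \<alpha>)) = sc (k * k * (\<alpha> $ i * \<alpha> $ i)) * (D \<alpha> * D \<alpha>)"
        by (simp only: mult.assoc D_sc_left sc_simps(4) sc_left[of "\<alpha> $ i" k])
      ultimately have "(D (e i) - sc k * (sc (\<alpha> $ i) * D \<alpha>)) * (D (e i) - sc k * (sc (\<alpha> $ i) * D \<alpha>))
        = D (e i) * D (e i) - (sc k * ((sc (\<alpha> $ i) * D (e i)) * D \<alpha>) + sc k * ((sc (\<alpha> $ i) * D (e i)) * D \<alpha>))
          + sc (k * k * (\<alpha> $ i * \<alpha> $ i)) * (D \<alpha> * D \<alpha>)"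
        by (simp only: left_diff_distrib right_diff_distrib) (simp add: algebra_simps)
      note sq = this
      have two: "sc (2 * k) = sc k + sc k" unfolding mult_2 by (rule sc_simps)
      show ?thesis unfolding sD two sq by (simp only: distrib_right)
    qed
    have "(\<Sum>i\<in>UNIV. D (reflection \<alpha> (e i)) * D (reflection \<alpha> (e i)))
      = Lap - sc (2 * k) * (D \<alpha> * D \<alpha>) + sc (k * k * bilin \<alpha> \<alpha>) * (D \<alpha> * D \<alpha>)"
    proof -
      have "(\<Sum>i\<in>UNIV. sc (k * k * (\<alpha> $ i * \<alpha> $ i)) :: 'n pend) = sc (k * k * bilin \<alpha> \<alpha>)"
        by (simp only: sc_sum[symmetric] bilin_def sum_distrib_left[symmetric])
      then show ?thesis
        unfolding sq sum.distrib sum_subtractf Lap_def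
        by (simp only: sum_distrib_left[symmetric] sum_distrib_right[symmetric] D_expand)
    qed
    moreover have "k * k * bilin \<alpha> \<alpha> = 2 * k" using nonisotropic[OF \<alpha>] by (simp add: k_def)
    ultimately show ?thesis by simp
  qed
  finally show ?thesis .
qed

lemma nilp_Lap: "nilp Lap 1 (X \<xi>) (2 * D \<xi>)"
  using Lap_X[of \<xi>] Lap_D[of \<xi>] by (simp add: ad_def mult_2 distrib_left distrib_right)

lemma nilp_E: "nilp E 1 (D \<xi>) (- X \<xi>)"
  using E_D[of \<xi>] E_X[of \<xi>] by (simp add: ad_def)

lemma val_Lap: "val (app Lap P) x = dunkl_laplacian R Rp m (val P) x"
  unfolding Lap_def dunkl_laplacian_def by (simp add: val_app val_D)

end

section \<open>Differential operators and jets\<close>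

lemma analytic_foldr_partial: "analytic_open f V \<Longrightarrow> analytic_open (foldr partial k f) V"
  by (induction k) (auto intro: analytic_open_partial)

lemma partial_diff:
  "analytic_open f V \<Longrightarrow> analytic_open g V \<Longrightarrow> x \<in> V \<Longrightarrow> partial i (\<lambda>x. f x - g x) x = partial i f x - partial i g x"
  unfolding partial_def by (rule dir_deriv_diff)

lemma partial_mult:
  "analytic_open f V \<Longrightarrow> analytic_open g V \<Longrightarrow> x \<in> V \<Longrightarrow>
    partial i (\<lambda>x. f x * g x) x = f x * partial i g x + partial i f x * g x"
  unfolding partial_def by (rule dir_deriv_mult)

lemma partial_const: "partial i (\<lambda>x. k) x = 0"
  unfolding partial_def by (rule dir_deriv_const)

lemma foldr_partial_cong:
  assumes "open V" "\<And>y. y \<in> V \<Longrightarrow> f y = g y" "x \<in> V"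
  shows "foldr partial k f x = foldr partial k g x"
  using assms(3)
proof (induction k arbitrary: x)
  case (Cons i k)
  show ?case unfolding foldr.simps comp_apply by (rule partial_cong_open[OF assms(1) Cons.prems Cons.IH])
qed (simp add: assms(2))

lemma foldr_partial_diff:
  assumes f: "analytic_open f V" and g: "analytic_open g V" and x: "x \<in> V"
  shows "foldr partial k (\<lambda>y. f y - g y) x = foldr partial k f x - foldr partial k g x"
  using x
proof (induction k arbitrary: x)
  case (Cons i k)
  have "partial i (foldr partial k (\<lambda>y. f y - g y)) x = partial i (\<lambda>y. foldr partial k f y - foldr partial k g y) x"
    by (rule partial_cong_open[OF analytic_open_open[OF f] Cons.prems Cons.IH])
  also have "\<dots> = partial i (foldr partial k f) x - partial i (foldr partial k g) x"
    by (rule partial_diff[OF analytic_foldr_partial[OF f] analytic_foldr_partial[OF g] Cons.prems])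
  finally show ?case by simp
qed simp

lemma op_eq_onD: "op_eq_on A L M \<Longrightarrow> V \<subseteq> A \<Longrightarrow> analytic_open f V \<Longrightarrow> x \<in> V \<Longrightarrow> L f x = M f x"
  unfolding op_eq_on_def by blast

lemma op_eq_onI: "(\<And>V f x. V \<subseteq> A \<Longrightarrow> analytic_open f V \<Longrightarrow> x \<in> V \<Longrightarrow> L f x = M f x) \<Longrightarrow> op_eq_on A L M"
  unfolding op_eq_on_def by blast

lemma diff_op_onI:
  assumes "finite K" "\<And>k. k \<in> K \<Longrightarrow> analytic_open (a k) A"
    "\<And>V f x. V \<subseteq> A \<Longrightarrow> analytic_open f V \<Longrightarrow> x \<in> V \<Longrightarrow> L f x = (\<Sum>k\<in>K. a k x * foldr partial k f x)"
  shows "diff_op_on A L"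
  unfolding diff_op_on_def
proof (intro exI conjI ballI)
  show "op_eq_on A L (\<lambda>f x. \<Sum>k\<in>K. a k x * foldr partial k f x)"
    by (rule op_eq_onI) (rule assms(3))
qed (rule assms(1,2))+

lemma diff_op_onE:
  assumes "diff_op_on A L"
  obtains K a where "finite K" "\<And>k. k \<in> K \<Longrightarrow> analytic_open (a k) A"
    "\<And>V f x. V \<subseteq> A \<Longrightarrow> analytic_open f V \<Longrightarrow> x \<in> V \<Longrightarrow> L f x = (\<Sum>k\<in>K. a k x * foldr partial k f x)"
proof -
  obtain K a where K: "finite K" "\<forall>k\<in>K. analytic_open (a k) A"
    "op_eq_on A L (\<lambda>f x. \<Sum>k\<in>K. a k x * foldr partial k f x)"
    using assms unfolding diff_op_on_def by (elim exE conjE)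
  show thesis
    by (rule that[of K a]) (rule K(1), erule bspec[OF K(2)], erule (2) op_eq_onD[OF K(3)])
qed

lemma diff_op_cong:
  assumes "diff_op_on A L" "\<And>V f x. V \<subseteq> A \<Longrightarrow> analytic_open f V \<Longrightarrow> x \<in> V \<Longrightarrow> M f x = L f x"
  shows "diff_op_on A M"
proof (rule diff_op_onE[OF assms(1)])
  fix K a assume K: "finite K" "\<And>k. k \<in> K \<Longrightarrow> analytic_open (a k) A"
    "\<And>V f x. V \<subseteq> A \<Longrightarrow> analytic_open f V \<Longrightarrow> x \<in> V \<Longrightarrow> L f x = (\<Sum>k\<in>K. a k x * foldr partial k f x)"
  show ?thesis
    by (rule diff_op_onI[OF K(1,2)]) (simp_all only: assms(2) K(3))
qed

lemma diff_op_analytic: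
  assumes "diff_op_on A L" "V \<subseteq> A" "analytic_open f V"
  shows "analytic_open (L f) V"
proof (rule diff_op_onE[OF assms(1)])
  fix K a assume K: "finite K" "\<And>k. k \<in> K \<Longrightarrow> analytic_open (a k) A"
    "\<And>V f x. V \<subseteq> A \<Longrightarrow> analytic_open f V \<Longrightarrow> x \<in> V \<Longrightarrow> L f x = (\<Sum>k\<in>K. a k x * foldr partial k f x)"
  have oV: "open V" using assms(3) by (rule analytic_open_open)
  have "analytic_open (\<lambda>x. \<Sum>k\<in>K. a k x * foldr partial k f x) V"
    by (intro analytic_open_sum oV analytic_open_mult analytic_foldr_partial[OF assms(3)] analytic_open_subset[OF K(2) oV assms(2)])
  then show ?thesis by (rule analytic_open_cong[rotated]) (rule K(3)[OF assms(2,3), symmetric])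
qed

lemma diff_op_id: "open A \<Longrightarrow> diff_op_on A (\<lambda>f. f)"
  by (rule diff_op_onI[of "{[]}" "\<lambda>_ _. 1"]) (auto intro: analytic_open_const)

lemma diff_op_zero: "open A \<Longrightarrow> diff_op_on A (\<lambda>f x. 0)"
  by (rule diff_op_onI[of "{}" "\<lambda>_ _. 1"]) auto

lemma diff_op_add:
  assumes "diff_op_on A L" "diff_op_on A M"
  shows "diff_op_on A (\<lambda>f x. L f x + M f x)"
proof (rule diff_op_onE[OF assms(1)], rule diff_op_onE[OF assms(2)])
  fix K a K' a'
  assume K: "finite K" "\<And>k. k \<in> K \<Longrightarrow> analytic_open (a k) A"
    "\<And>V f x. V \<subseteq> A \<Longrightarrow> analytic_open f V \<Longrightarrow> x \<in> V \<Longrightarrow> L f x = (\<Sum>k\<in>K. a k x * foldr partial k f x)"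
    and K': "finite K'" "\<And>k. k \<in> K' \<Longrightarrow> analytic_open (a' k) A"
    "\<And>V f x. V \<subseteq> A \<Longrightarrow> analytic_open f V \<Longrightarrow> x \<in> V \<Longrightarrow> M f x = (\<Sum>k\<in>K'. a' k x * foldr partial k f x)"
  show ?thesis
  \<comment> \<open>Openness of \<open>A\<close> is read off from an analytic coefficient; if there
    are no coefficients, both operators are zero whatever \<open>A\<close> is.\<close>
  proof (cases "K \<union> K' = {}")
    case True
    then have "diff_op_on A (\<lambda>f x. L f x + M f x)" if "open A"
      using K(3) K'(3) by (intro diff_op_cong[OF diff_op_zero[OF that]]) simp
    moreover have ?thesis if "\<not> open A"
      by (rule diff_op_onI[of "{}" "\<lambda>_ _. 1"]) (use True K(3) K'(3) in auto)
    ultimately show ?thesis by blast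
  next
    case False
    then have oA: "open A" using K(2) K'(2) analytic_open_open by blast
    let ?a = "\<lambda>k x. (if k \<in> K then a k x else 0) + (if k \<in> K' then a' k x else 0)"
    show ?thesis
    proof (rule diff_op_onI[of "K \<union> K'" ?a])
      show "finite (K \<union> K')" using K(1) K'(1) by simp
      show "analytic_open (?a k) A" if "k \<in> K \<union> K'" for k
        using K(2)[of k] K'(2)[of k] analytic_open_const[OF oA, of 0]
        by (intro analytic_open_add; cases "k \<in> K"; cases "k \<in> K'"; simp)
      fix V :: "(complex ^ 'a) set" and f x assume V: "V \<subseteq> A" "analytic_open f V" "x \<in> V"
      have "L f x = (\<Sum>k\<in>K \<union> K'. (if k \<in> K then a k x else 0) * foldr partial k f x)"
        unfolding K(3)[OF V] using K(1) K'(1) by (intro sum.mono_neutral_cong_left) auto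
      moreover have "M f x = (\<Sum>k\<in>K \<union> K'. (if k \<in> K' then a' k x else 0) * foldr partial k f x)"
        unfolding K'(3)[OF V] using K(1) K'(1) by (intro sum.mono_neutral_cong_left) auto
      ultimately show "L f x + M f x = (\<Sum>k\<in>K \<union> K'. ?a k x * foldr partial k f x)"
        by (simp only: distrib_right sum.distrib)
    qed
  qed
qed

lemma diff_op_mult:
  assumes "diff_op_on A L" "analytic_open b A"
  shows "diff_op_on A (\<lambda>f x. b x * L f x)"
proof (rule diff_op_onE[OF assms(1)])
  fix K a assume K: "finite K" "\<And>k. k \<in> K \<Longrightarrow> analytic_open (a k) A"
    "\<And>V f x. V \<subseteq> A \<Longrightarrow> analytic_open f V \<Longrightarrow> x \<in> V \<Longrightarrow> L f x = (\<Sum>k\<in>K. a k x * foldr partial k f x)"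
  show ?thesis
    by (rule diff_op_onI[of K "\<lambda>k x. b x * a k x"])
      (auto intro: K(1) analytic_open_mult assms(2) K(2) simp: K(3) sum_distrib_left mult.assoc)
qed

lemma diff_op_sum:
  assumes "open A" "\<And>i. i \<in> I \<Longrightarrow> diff_op_on A (L i)"
  shows "diff_op_on A (\<lambda>f x. \<Sum>i\<in>I. L i f x)"
  using assms(2)
  by (induction I rule: infinite_finite_induct) (auto intro: diff_op_zero assms(1) diff_op_add)

lemma diff_op_diff:
  assumes "open A" "diff_op_on A L" "diff_op_on A M"
  shows "diff_op_on A (\<lambda>f x. L f x - M f x)"
  using diff_op_add[OF assms(2) diff_op_mult[OF assms(3) analytic_open_const[OF assms(1), of "-1"]]] by simp

lemma diff_op_partial:
  assumes A: "open A" and L: "diff_op_on A L"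
  shows "diff_op_on A (\<lambda>f. partial i (L f))"
proof (rule diff_op_onE[OF L])
  fix K a assume K: "finite K" "\<And>k. k \<in> K \<Longrightarrow> analytic_open (a k) A"
    "\<And>V f x. V \<subseteq> A \<Longrightarrow> analytic_open f V \<Longrightarrow> x \<in> V \<Longrightarrow> L f x = (\<Sum>k\<in>K. a k x * foldr partial k f x)"
  have 1: "diff_op_on A (\<lambda>f x. \<Sum>k\<in>K. partial i (a k) x * foldr partial k f x)"
    by (rule diff_op_onI[of K "\<lambda>k. partial i (a k)"]) (auto intro: K(1) analytic_open_partial K(2))
  have 2: "diff_op_on A (\<lambda>f x. \<Sum>k\<in>K. a k x * foldr partial (i # k) f x)"
  proof (rule diff_op_onI[of "(#) i ` K" "\<lambda>k. a (tl k)"])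
    show "(\<Sum>k\<in>K. a k x * foldr partial (i # k) f x) = (\<Sum>k\<in>(#) i ` K. a (tl k) x * foldr partial k f x)" for f x
      by (subst sum.reindex) auto
  qed (use K in auto)
  show ?thesis
  proof (rule diff_op_cong[OF diff_op_add[OF 1 2]])
    fix V :: "(complex ^ 'a) set" and f x assume V: "V \<subseteq> A" "analytic_open f V" "x \<in> V"
    have oV: "open V" using V(2) by (rule analytic_open_open)
    have an: "analytic_open (a k) V" if "k \<in> K" for k using analytic_open_subset[OF K(2)[OF that] oV V(1)] .
    have "partial i (L f) x = partial i (\<lambda>x. \<Sum>k\<in>K. a k x * foldr partial k f x) x"
      using K(3)[OF V(1,2)] by (rule partial_cong_open[OF oV V(3)])
    also have "\<dots> = (\<Sum>k\<in>K. partial i (\<lambda>x. a k x * foldr partial k f x) x)"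
      unfolding partial_def
      by (rule dir_deriv_sum[OF oV V(3)]) (intro analytic_open_mult an analytic_foldr_partial[OF V(2), unfolded partial_def])
    also have "\<dots> = (\<Sum>k\<in>K. partial i (a k) x * foldr partial k f x + a k x * foldr partial (i # k) f x)"
    proof (rule sum.cong[OF refl])
      fix k assume "k \<in> K"
      show "partial i (\<lambda>x. a k x * foldr partial k f x) x = partial i (a k) x * foldr partial k f x + a k x * foldr partial (i # k) f x"
        using dir_deriv_mult[OF an[OF \<open>k \<in> K\<close>] analytic_foldr_partial[OF V(2)] V(3), of "axis i 1" k]
        by (simp add: partial_def)
    qed
    finally show "partial i (L f) x = (\<Sum>k\<in>K. partial i (a k) x * foldr partial k f x) + (\<Sum>k\<in>K. a k x * foldr partial (i # k) f x)"
      by (simp only: sum.distrib)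
  qed
qed

lemma diff_op_comp:
  assumes A: "open A" and L: "diff_op_on A L" and M: "diff_op_on A M"
  shows "diff_op_on A (\<lambda>f. L (M f))"
proof (rule diff_op_onE[OF L])
  fix K a assume K: "finite K" "\<And>k. k \<in> K \<Longrightarrow> analytic_open (a k) A"
    "\<And>V f x. V \<subseteq> A \<Longrightarrow> analytic_open f V \<Longrightarrow> x \<in> V \<Longrightarrow> L f x = (\<Sum>k\<in>K. a k x * foldr partial k f x)"
  have "diff_op_on A (\<lambda>f. foldr partial k (M f))" for k
    by (induction k) (auto intro: M diff_op_partial[OF A])
  then have "diff_op_on A (\<lambda>f x. \<Sum>k\<in>K. a k x * foldr partial k (M f) x)"
    by (intro diff_op_sum A diff_op_mult K(2))
  then show ?thesis
    by (rule diff_op_cong) (use K(3) diff_op_analytic[OF M] in blast)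
qed

text \<open>The jet of order \<open>n - 1\<close> is zero; \<open>n = 0\<close> imposes no
  condition. Derivatives are indexed by lists as in \<open>diff_op_on\<close>, so that list lengths
  can be compared with \<open>n\<close> directly.\<close>

definition vanishes :: "nat \<Rightarrow> 'n::finite func \<Rightarrow> complex ^ 'n \<Rightarrow> bool" where
  "vanishes n g x \<longleftrightarrow> (\<forall>k. length k < n \<longrightarrow> foldr partial k g x = 0)"

lemma vanishes_0: "vanishes 0 g x"
  by (simp add: vanishes_def)

lemma vanishes_Suc: "vanishes (Suc n) g x \<longleftrightarrow> g x = 0 \<and> (\<forall>i. vanishes n (partial i g) x)"
proof
  assume v: "vanishes (Suc n) g x"
  \<comment> \<open>\<open>foldr\<close> applies the last entry of the list first, so an inner
    derivative is appended at the end.\<close>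
  have "foldr partial k (partial i g) x = 0" if "length k < n" for k i
    using v[unfolded vanishes_def, rule_format, of "k @ [i]"] that by simp
  moreover have "g x = 0" using v[unfolded vanishes_def, rule_format, of "[]"] by simp
  ultimately show "g x = 0 \<and> (\<forall>i. vanishes n (partial i g) x)" by (simp add: vanishes_def)
next
  assume v: "g x = 0 \<and> (\<forall>i. vanishes n (partial i g) x)"
  show "vanishes (Suc n) g x"
    unfolding vanishes_def
  proof (intro allI impI)
    fix k :: "'a list" assume "length k < Suc n"
    then show "foldr partial k g x = 0" using v by (cases k rule: rev_cases) (auto simp: vanishes_def)
  qed
qed

lemma vanishes_mono: "vanishes n g x \<Longrightarrow> k \<le> n \<Longrightarrow> vanishes k g x"
  unfolding vanishes_def by (meson le_trans not_le less_le_trans)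

lemma vanishes_cong: "open V \<Longrightarrow> x \<in> V \<Longrightarrow> (\<And>y. y \<in> V \<Longrightarrow> f y = g y) \<Longrightarrow> vanishes n f x \<longleftrightarrow> vanishes n g x"
  unfolding vanishes_def using foldr_partial_cong[of V f g x] by simp

lemma vanishes_add:
  assumes "analytic_open f V" "analytic_open g V" "x \<in> V" "vanishes n f x" "vanishes n g x"
  shows "vanishes n (\<lambda>y. f y + g y) x"
  using assms
proof (induction n arbitrary: f g)
  case (Suc n)
  have "vanishes n (partial i (\<lambda>y. f y + g y)) x" for i
  proof -
    have "vanishes n (\<lambda>y. partial i f y + partial i g y) x"
      using Suc.prems by (intro Suc.IH analytic_open_partial) (auto simp: vanishes_Suc)
    then show ?thesis
      using vanishes_cong[OF analytic_open_open[OF Suc.prems(1)] Suc.prems(3), of "partial i (\<lambda>y. f y + g y)" "\<lambda>y. partial i f y + partial i g y"]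
        dir_deriv_add[OF Suc.prems(1,2)] by (simp add: partial_def)
  qed
  then show ?case using Suc.prems by (simp add: vanishes_Suc)
qed (simp add: vanishes_0)

lemma vanishes_mult:
  assumes "analytic_open f V" "analytic_open g V" "x \<in> V" "vanishes n f x" "vanishes k g x"
  shows "vanishes (n + k) (\<lambda>y. f y * g y) x"
  using assms
proof (induction "n + k" arbitrary: n k f g)
  case (Suc l)
  have "f x = 0 \<or> g x = 0"
  proof (cases n)
    case 0
    then have "k = Suc l" using Suc.hyps(2) by simp
    then show ?thesis using Suc.prems(5) vanishes_Suc[of l g x] by blast
  next
    case (Suc n')
    then show ?thesis using Suc.prems(4) vanishes_Suc[of n' f x] by blast
  qed
  then have 0: "f x * g x = 0" by simp
  have "vanishes l (partial i (\<lambda>y. f y * g y)) x" for i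
  proof -
    have 1: "vanishes l (\<lambda>y. f y * partial i g y) x"
    proof (cases k)
      case 0
      have "vanishes (n - 1 + 0) (\<lambda>y. f y * partial i g y) x"
        using Suc.prems Suc.hyps(2) 0
        by (intro Suc.hyps(1) analytic_open_partial vanishes_0) (auto intro: vanishes_mono)
      moreover have "n - 1 + 0 = l" using 0 Suc.hyps(2) by simp
      ultimately show ?thesis by (simp only:)
    next
      case (Suc k')
      have "vanishes (n + k') (\<lambda>y. f y * partial i g y) x"
        using Suc.prems Suc.hyps(2) Suc
        by (intro Suc.hyps(1) analytic_open_partial) (auto simp: vanishes_Suc)
      then show ?thesis using Suc Suc.hyps(2) by simp
    qed
    have 2: "vanishes l (\<lambda>y. partial i f y * g y) x"
    proof (cases n)
      case 0
      have "vanishes (0 + (k - 1)) (\<lambda>y. partial i f y * g y) x"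
        using Suc.prems Suc.hyps(2) 0
        by (intro Suc.hyps(1) analytic_open_partial vanishes_0) (auto intro: vanishes_mono)
      moreover have "0 + (k - 1) = l" using 0 Suc.hyps(2) by simp
      ultimately show ?thesis by (simp only:)
    next
      case (Suc n')
      have "vanishes (n' + k) (\<lambda>y. partial i f y * g y) x"
        using Suc.prems Suc.hyps(2) Suc
        by (intro Suc.hyps(1) analytic_open_partial) (auto simp: vanishes_Suc)
      then show ?thesis using Suc Suc.hyps(2) by simp
    qed
    have "vanishes l (\<lambda>y. f y * partial i g y + partial i f y * g y) x"
      by (rule vanishes_add[OF _ _ Suc.prems(3) 1 2]; intro analytic_open_mult analytic_open_partial Suc.prems)
    then show ?thesis
      using vanishes_cong[OF analytic_open_open[OF Suc.prems(1)] Suc.prems(3), of "partial i (\<lambda>y. f y * g y)" "\<lambda>y. f y * partial i g y + partial i f y * g y"]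
        dir_deriv_mult[OF Suc.prems(1,2)] by (simp add: partial_def)
  qed
  then show ?case using 0 unfolding Suc.hyps(2)[symmetric] vanishes_Suc by blast
qed (simp add: vanishes_0)

lemma vanishes_zero: "vanishes n (\<lambda>y. 0) (x :: complex ^ 'n)"
proof (induction n)
  case (Suc n)
  have "partial i (\<lambda>y. 0) = (\<lambda>y. 0)" for i :: 'n by (simp add: fun_eq_iff partial_def dir_deriv_const)
  then show ?case using Suc by (simp add: vanishes_Suc)
qed (simp add: vanishes_0)

lemma vanishes_mult_right:
  assumes "analytic_open f V" "analytic_open g V" "x \<in> V" "vanishes n f x"
  shows "vanishes n (\<lambda>y. f y * g y) x"
  using vanishes_mult[OF assms vanishes_0] by simp

lemma vanishes_power:
  assumes "analytic_open f V" "x \<in> V" "f x = 0"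
  shows "vanishes n (\<lambda>y. f y ^ n) x \<and> analytic_open (\<lambda>y. f y ^ n) V"
proof (induction n)
  case 0
  then show ?case using analytic_open_const[OF analytic_open_open[OF assms(1)]] by (simp add: vanishes_0)
next
  case (Suc n)
  have "vanishes (Suc 0) f x" using assms(3) by (simp add: vanishes_Suc vanishes_0)
  then have "vanishes (Suc 0 + n) (\<lambda>y. f y * f y ^ n) x"
    using Suc by (intro vanishes_mult[OF assms(1) _ assms(2)]) auto
  then show ?case using Suc analytic_open_mult[OF assms(1)] by simp
qed

lemma vanishes_sum:
  assumes "open V" "x \<in> V" "\<And>i. i \<in> I \<Longrightarrow> analytic_open (f i) V" "\<And>i. i \<in> I \<Longrightarrow> vanishes n (f i) x"
  shows "vanishes n (\<lambda>y. \<Sum>i\<in>I. f i y) x"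
  using assms(3,4)
proof (induction I rule: infinite_finite_induct)
  case (insert i I)
  then show ?case
    using vanishes_add[OF _ analytic_open_sum[OF assms(1)] assms(2), of "f i" I f n] by simp
qed (auto simp: vanishes_zero)

text \<open>A tensor \<open>c\<close> contracted \<open>n\<close> times with \<open>y - x\<close>.
  Every ordering of a monomial has its own coefficient, so for symmetric \<open>c\<close> a
  derivative contracts one index and brings out the degree as a factor.\<close>

fun hom_pol :: "complex ^ 'n \<Rightarrow> nat \<Rightarrow> ('n list \<Rightarrow> complex) \<Rightarrow> 'n::finite func" where
  "hom_pol x 0 c = (\<lambda>y. c [])"
| "hom_pol x (Suc n) c = (\<lambda>y. \<Sum>j\<in>UNIV. (y $ j - x $ j) * hom_pol x n (\<lambda>k. c (j # k)) y)"

lemma cpoly_hom_pol: "cpoly (hom_pol x n c)"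
  by (induction n arbitrary: c) (auto intro!: cpoly.const cpoly_sum cpoly_mult cpoly_diff cpoly_coord)

lemma partial_hom_pol:
  assumes "\<And>l a b k. c (l @ a # b # k) = c (l @ b # a # k)"
  shows "partial i (hom_pol x (Suc n) c) = (\<lambda>y. of_nat (Suc n) * hom_pol x n (\<lambda>k. c (i # k)) y)"
  using assms
proof (induction n arbitrary: c)
  have an: "analytic_open (\<lambda>y. y $ j - x $ j) UNIV" for j
    by (intro analytic_open_diff analytic_open_nth analytic_open_const open_UNIV)
  have d: "partial i (\<lambda>y. y $ j - x $ j) y = (if j = i then 1 else 0)" for j y
    unfolding partial_def
    by (subst dir_deriv_diff[OF analytic_open_nth[OF open_UNIV] analytic_open_const[OF open_UNIV] UNIV_I])
      (simp add: dir_deriv_nth dir_deriv_const axis_def)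
  have step: "partial i (hom_pol x (Suc n) c) y = hom_pol x n (\<lambda>k. c (i # k)) y
      + (\<Sum>j\<in>UNIV. (y $ j - x $ j) * partial i (hom_pol x n (\<lambda>k. c (j # k))) y)" for n c y
  proof -
    have "partial i (hom_pol x (Suc n) c) y = (\<Sum>j\<in>UNIV. partial i (\<lambda>y. (y $ j - x $ j) * hom_pol x n (\<lambda>k. c (j # k)) y) y)"
      unfolding hom_pol.simps partial_def
      by (rule dir_deriv_sum[OF open_UNIV UNIV_I]) (intro analytic_open_mult an analytic_cpoly cpoly_hom_pol open_UNIV)
    also have "\<dots> = (\<Sum>j\<in>UNIV. (y $ j - x $ j) * partial i (hom_pol x n (\<lambda>k. c (j # k))) y
        + (if j = i then 1 else 0) * hom_pol x n (\<lambda>k. c (j # k)) y)"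
      using dir_deriv_mult[OF an analytic_cpoly[OF cpoly_hom_pol open_UNIV] UNIV_I] d
      by (simp add: partial_def)
    also have "\<dots> = (\<Sum>j\<in>UNIV. (y $ j - x $ j) * partial i (hom_pol x n (\<lambda>k. c (j # k))) y) + hom_pol x n (\<lambda>k. c (i # k)) y"
      by (simp add: sum.distrib if_distrib[of "\<lambda>a. a * _"] cong: if_cong)
    finally show ?thesis by simp
  qed
  {
    case 0
    show ?case by (rule ext) (simp add: step del: hom_pol.simps(2), simp add: partial_def dir_deriv_const)
  next
    case (Suc n)
    have IH: "partial i (hom_pol x (Suc n) (\<lambda>k. c (j # k))) = (\<lambda>y. of_nat (Suc n) * hom_pol x n (\<lambda>k. c (j # i # k)) y)" for j
      using Suc.prems[of "j # l" for l] by (intro Suc.IH) simp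
    have sw: "c (j # i # k) = c (i # j # k)" for j k using Suc.prems[of "[]"] by simp
    show ?case
    proof
      fix y
      have "(\<Sum>j\<in>UNIV. (y $ j - x $ j) * partial i (hom_pol x (Suc n) (\<lambda>k. c (j # k))) y)
        = (\<Sum>j\<in>UNIV. (y $ j - x $ j) * (of_nat (Suc n) * hom_pol x n (\<lambda>k. c (i # j # k)) y))"
        by (simp only: IH sw)
      also have "\<dots> = of_nat (Suc n) * hom_pol x (Suc n) (\<lambda>k. c (i # k)) y"
        unfolding hom_pol.simps(2)[of x n] sum_distrib_left by (intro sum.cong refl) (simp only: mult.left_commute)
      finally have "(\<Sum>j\<in>UNIV. (y $ j - x $ j) * partial i (hom_pol x (Suc n) (\<lambda>k. c (j # k))) y)
        = of_nat (Suc n) * hom_pol x (Suc n) (\<lambda>k. c (i # k)) y" .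
      then show "partial i (hom_pol x (Suc (Suc n)) c) y = of_nat (Suc (Suc n)) * hom_pol x (Suc n) (\<lambda>k. c (i # k)) y"
        unfolding step[of "Suc n"] by (simp only: of_nat_Suc[of "Suc n"] distrib_right mult_1 add.commute)
    qed
  }
qed

lemma foldr_partial_scale:
  assumes "cpoly f"
  shows "foldr partial k (\<lambda>y. a * f y) = (\<lambda>y. a * foldr partial k f y)"
proof (induction k)
  case (Cons i k)
  have "cpoly (foldr partial k f)" by (induction k) (auto intro: assms cpoly_partial)
  then have "partial i (\<lambda>y. a * foldr partial k f y) y = a * partial i (foldr partial k f) y" for y
    by (subst partial_mult[OF analytic_open_const[OF open_UNIV] analytic_cpoly[OF _ open_UNIV] UNIV_I])
      (simp_all add: partial_const)
  then show ?case by (simp add: Cons)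
qed simp

lemma foldr_partial_hom_pol:
  assumes "\<And>l a b k. c (l @ a # b # k) = c (l @ b # a # k)" "length k \<le> n"
  shows "foldr partial k (hom_pol x n c) x = (if length k = n then of_nat (fact n) * c (rev k) else 0)"
  using assms
proof (induction n arbitrary: c k)
  case (Suc n)
  show ?case
  proof (cases k rule: rev_cases)
    case Nil
    then show ?thesis by simp
  next
    case (snoc k' i)
    have "foldr partial k (hom_pol x (Suc n) c) x = of_nat (Suc n) * foldr partial k' (hom_pol x n (\<lambda>k. c (i # k))) x"
      unfolding snoc foldr_append foldr.simps comp_apply id_apply partial_hom_pol[where c = c and i = i and x = x and n = n, OF Suc.prems(1)]
        foldr_partial_scale[OF cpoly_hom_pol] ..
    also have "foldr partial k' (hom_pol x n (\<lambda>k. c (i # k))) x = (if length k' = n then of_nat (fact n) * c (i # rev k') else 0)"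
      using Suc.prems(1)[of "i # l" for l] Suc.prems(2) snoc by (intro Suc.IH) auto
    finally show ?thesis using snoc by (simp add: algebra_simps del: hom_pol.simps)
  qed
qed simp

lemma taylor_polynomial:
  assumes f: "analytic_open f V" and x: "x \<in> V"
  obtains T where "cpoly T" "vanishes n (\<lambda>y. f y - T y) x"
proof -
  have "\<exists>T. cpoly T \<and> vanishes n (\<lambda>y. f y - T y) x"
  proof (induction n)
    case 0
    then show ?case using cpoly.const vanishes_0 by blast
  next
    case (Suc n)
    then obtain T where T: "cpoly T" "vanishes n (\<lambda>y. f y - T y) x" by blast
    have oV: "open V" using f by (rule analytic_open_open)
    let ?g = "\<lambda>y. f y - T y"
    have g: "analytic_open ?g V" by (intro analytic_open_diff f analytic_cpoly T(1) oV)
    \<comment> \<open>The derivatives of order \<open>n\<close> of the current remainder, divided by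
      \<open>n!\<close>. The list is reversed because \<open>hom_pol\<close> consumes indices from
      the front, while \<open>foldr\<close> differentiates by the last index first.\<close>
    define c where "c = (\<lambda>k. foldr partial (rev k) ?g x / of_nat (fact n))"
    have sym: "c (l @ a # b # k) = c (l @ b # a # k)" for l a b k
    proof -
      have "foldr partial (rev k @ b # a # rev l) ?g x = foldr partial (rev k) (partial b (partial a (foldr partial (rev l) ?g))) x" by simp
      also have "\<dots> = foldr partial (rev k) (partial a (partial b (foldr partial (rev l) ?g))) x"
        by (rule foldr_partial_cong[OF oV _ x]) (rule partial_commute[OF analytic_foldr_partial[OF g]])
      finally show ?thesis by (simp add: c_def)
    qed
    let ?h = "hom_pol x n c"
    have h: "analytic_open ?h V" by (intro analytic_cpoly cpoly_hom_pol oV)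
    have "foldr partial k (\<lambda>y. ?g y - ?h y) x = 0" if k: "length k < Suc n" for k
    proof -
      have "foldr partial k (\<lambda>y. ?g y - ?h y) x = foldr partial k ?g x - foldr partial k ?h x"
        by (rule foldr_partial_diff[OF g h x])
      then have "foldr partial k (\<lambda>y. ?g y - ?h y) x = foldr partial k ?g x - (if length k = n then of_nat (fact n) * c (rev k) else 0)"
        using k foldr_partial_hom_pol[where c = c and k = k and n = n and x = x, OF sym] by simp
      also have "\<dots> = 0"
      proof (cases "length k = n")
        case False
        then show ?thesis using T(2) k by (simp add: vanishes_def)
      qed (simp add: c_def)
      finally show ?thesis .
    qed
    then have "vanishes (Suc n) (\<lambda>y. f y - (T y + ?h y)) x" by (simp add: vanishes_def diff_diff_eq)
    then show ?case using cpoly.add[OF T(1) cpoly_hom_pol] by blast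
  qed
  then show thesis using that by blast
qed

lemma diff_op_jet:
  assumes "diff_op_on A M"
  obtains n where "\<And>V f g x. V \<subseteq> A \<Longrightarrow> analytic_open f V \<Longrightarrow> analytic_open g V \<Longrightarrow> x \<in> V \<Longrightarrow>
    vanishes n (\<lambda>y. f y - g y) x \<Longrightarrow> M f x = M g x"
proof (rule diff_op_onE[OF assms])
  fix K a assume K: "finite K" "\<And>k. k \<in> K \<Longrightarrow> analytic_open (a k) A"
    "\<And>V f x. V \<subseteq> A \<Longrightarrow> analytic_open f V \<Longrightarrow> x \<in> V \<Longrightarrow> M f x = (\<Sum>k\<in>K. a k x * foldr partial k f x)"
  define n where "n = Suc (Max (insert 0 (length ` K)))"
  have n: "length k < n" if "k \<in> K" for k
    using that K(1) by (auto simp: n_def intro: le_imp_less_Suc Max_ge)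
  show thesis
  proof (rule that[of n])
    fix V f g x assume V: "V \<subseteq> A" "analytic_open f V" "analytic_open g V" "x \<in> V" "vanishes n (\<lambda>y. f y - g y) x"
    have oV: "open V" using V(2) by (rule analytic_open_open)
    have "foldr partial k f x = foldr partial k g x" if "k \<in> K" for k
      using V(5) n[OF that] foldr_partial_diff[OF V(2-4), of k] by (simp add: vanishes_def)
    then show "M f x = M g x" unfolding K(3)[OF V(1,2,4)] K(3)[OF V(1,3,4)] by simp
  qed
qed

section \<open>Restrictions of the basic invariants\<close>

lemma quadratic_roots:
  obtains x y :: complex where "x + y = s" "x * y = q"
proof
  let ?r = "csqrt (s\<^sup>2 - 4 * q)"
  show "(s + ?r) / 2 + (s - ?r) / 2 = s" by (simp add: field_simps)
  have "?r\<^sup>2 = s\<^sup>2 - 4 * q" by simp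
  then show "(s + ?r) / 2 * ((s - ?r) / 2) = q" by (simp add: field_simps power2_eq_square)
qed

lemma cubic_roots:
  obtains x y z :: complex where "x + y + z = a" "x * y + x * z + y * z = b" "x * y * z = c"
proof -
  let ?a = "\<lambda>i::nat. if i = 0 then - c else if i = 1 then b else if i = 2 then - a else 1"
  obtain x where "(\<Sum>i\<le>3. ?a i * x ^ i) = 0"
    by (rule fundamental_theorem_of_algebra[of ?a 3]) (auto intro!: bexI[of _ 3])
  then have x: "x ^ 3 - a * x\<^sup>2 + b * x - c = 0"
    by (simp add: eval_nat_numeral algebra_simps)
  obtain y z where yz: "y + z = a - x" "y * z = b - x * (a - x)" by (rule quadratic_roots)
  show thesis
  proof (rule that)
    show "x + y + z = a" using yz(1) by (simp add: algebra_simps)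
    have "x * y + x * z + y * z = x * (y + z) + y * z" by (simp add: algebra_simps)
    then show "x * y + x * z + y * z = b" unfolding yz by simp
    have "x * y * z = x * (b - x * (a - x))" using yz(2) by simp
    then show "x * y * z = c" using x by (simp add: algebra_simps power2_eq_square power3_eq_cube)
  qed
qed

lemma quadratic_root:
  fixes a b c :: complex
  assumes "a \<noteq> 0"
  obtains x where "a * x\<^sup>2 + b * x + c = 0"
proof -
  obtain x y where xy: "x + y = - b / a" "x * y = c / a" by (rule quadratic_roots)
  have "a * x\<^sup>2 + b * x + c = a * (x * x - (x + y) * x + x * y)"
    unfolding xy using assms by (simp add: field_simps power2_eq_square)
  then show thesis by (intro that[of x]) (simp add: algebra_simps)
qed

definition power_inv :: "nat \<Rightarrow> complex ^ 3 \<Rightarrow> complex" where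
  "power_inv d u = (\<Sum>\<alpha>\<in>short_roots. bilin \<alpha> (incl u) ^ d)"

lemma bilin_incl_short:
  "bilin (root_vec (2,0,0,0)) (incl u) = u $ 1" "bilin (root_vec (0,2,0,0)) (incl u) = u $ 2"
  "bilin (root_vec (0,0,2,0)) (incl u) = u $ 3" "bilin (root_vec (0,0,0,2)) (incl u) = 0"
  "bilin (root_vec (1,1,1,w)) (incl u) = (u $ 1 + u $ 2 + u $ 3) / 2"
  "bilin (root_vec (1,1,-1,w)) (incl u) = (u $ 1 + u $ 2 - u $ 3) / 2"
  "bilin (root_vec (1,-1,1,w)) (incl u) = (u $ 1 - u $ 2 + u $ 3) / 2"
  "bilin (root_vec (1,-1,-1,w)) (incl u) = (u $ 1 - u $ 2 - u $ 3) / 2"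
  by (simp_all add: bilin_root_vec_incl)

lemma sum_short4: "(\<Sum>t\<in>set short4. f t) = f (2,0,0,0) + f (0,2,0,0) + f (0,0,2,0) + f (0,0,0,2)
      + (f (1,1,1,1) + f (1,1,1,-1) + f (1,1,-1,1) + f (1,1,-1,-1)
       + f (1,-1,1,1) + f (1,-1,1,-1) + f (1,-1,-1,1) + f (1,-1,-1,-1) :: complex)"
  by (simp add: short4_def)

lemma power_inv_short4:
  assumes "even d"
  shows "power_inv d u = 2 * (\<Sum>t\<in>set short4. bilin (root_vec t) (incl u) ^ d)"
  unfolding power_inv_def
proof (rule sum_short_roots)
  show "bilin (- \<alpha>) (incl u) ^ d = bilin \<alpha> (incl u) ^ d" for \<alpha>
    unfolding bilin_minus_left using assms by (rule power_minus_even)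
qed

lemma power_inv_eq:
  assumes "even d" "d > 0"
  shows "power_inv d u = 2 * (u $ 1 ^ d + u $ 2 ^ d + u $ 3 ^ d) + 4 / 2 ^ d * ((u $ 1 + u $ 2 + u $ 3) ^ d
    + (u $ 1 + u $ 2 - u $ 3) ^ d + (u $ 1 - u $ 2 + u $ 3) ^ d + (u $ 1 - u $ 2 - u $ 3) ^ d)"
proof -
  have "a + b + k + o' + (p + p + q + q + r + r + s + s) = a + b + k + o' + 2 * (p + q + r + s)"
      for a b k o' p q r s :: complex by algebra
  moreover have "2 * (a + b + k + 0 + 2 * (p / h + q / h + r / h + s / h)) = 2 * (a + b + k) + 4 / h * (p + q + r + s)"
    for a b k p q r s h :: complex unfolding divide_inverse by algebra
  moreover have "0 ^ d = (0::complex)" using assms(2) by simp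
  ultimately show ?thesis
    unfolding power_inv_short4[OF assms(1)] sum_short4 bilin_incl_short power_divide by (simp only:)
qed

text \<open>In the elementary symmetric functions of the squares the equations become solvable step
  by step: \<open>z1\<close> is \<open>bilin u u\<close>, degree 6 is linear in \<open>z3\<close>,
  and eliminating \<open>z3\<close> from degree 8 leaves a quadratic equation in
  \<open>z2\<close>.\<close>

lemma power_inv_elementary:
  fixes u :: "complex ^ 3"
  defines "t \<equiv> \<lambda>i. (u $ i)\<^sup>2"
  defines "z1 \<equiv> t 1 + t 2 + t 3" and "z2 \<equiv> t 1 * t 2 + t 1 * t 3 + t 2 * t 3" and "z3 \<equiv> t 1 * t 2 * t 3"
  shows "4 * power_inv 6 u = 9 * z1 ^ 3 - 12 * z1 * z2 + 72 * z3"
    and "16 * power_inv 8 u = 33 * z1 ^ 4 - 104 * z1\<^sup>2 * z2 + 80 * z2\<^sup>2 + 384 * z1 * z3"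
proof -
  have "(16::complex) * power_inv 6 u = 32 * (u $ 1 ^ 6 + u $ 2 ^ 6 + u $ 3 ^ 6) + ((u $ 1 + u $ 2 + u $ 3) ^ 6
    + (u $ 1 + u $ 2 - u $ 3) ^ 6 + (u $ 1 - u $ 2 + u $ 3) ^ 6 + (u $ 1 - u $ 2 - u $ 3) ^ 6)"
    by (simp add: power_inv_eq)
  also have "\<dots> = 4 * (9 * z1 ^ 3 - 12 * z1 * z2 + 72 * z3)"
    unfolding z1_def z2_def z3_def t_def by algebra
  finally show "4 * power_inv 6 u = 9 * z1 ^ 3 - 12 * z1 * z2 + 72 * z3" by algebra
  have "(64::complex) * power_inv 8 u = 128 * (u $ 1 ^ 8 + u $ 2 ^ 8 + u $ 3 ^ 8) + ((u $ 1 + u $ 2 + u $ 3) ^ 8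
    + (u $ 1 + u $ 2 - u $ 3) ^ 8 + (u $ 1 - u $ 2 + u $ 3) ^ 8 + (u $ 1 - u $ 2 - u $ 3) ^ 8)"
    by (simp add: power_inv_eq)
  also have "\<dots> = 4 * (33 * z1 ^ 4 - 104 * z1\<^sup>2 * z2 + 80 * z2\<^sup>2 + 384 * z1 * z3)"
    unfolding z1_def z2_def z3_def t_def by algebra
  finally show "16 * power_inv 8 u = 33 * z1 ^ 4 - 104 * z1\<^sup>2 * z2 + 80 * z2\<^sup>2 + 384 * z1 * z3" by algebra
qed

lemma invariants_surjective:
  obtains u where "bilin u u = a" "power_inv 6 u = b" "power_inv 8 u = c"
proof -
  let ?z3 = "\<lambda>z2. (4 * b - 9 * a ^ 3 + 12 * a * z2) / 72"
  \<comment> \<open>Three times the degree 8 relation for the value \<open>c\<close>, with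
    \<open>z1 = a\<close> and \<open>z3\<close> replaced by \<open>?z3 z2\<close>.\<close>
  obtain z2 where q: "240 * z2\<^sup>2 + (- 120 * a\<^sup>2) * z2 + (99 * a ^ 4 + 16 * a * (4 * b - 9 * a ^ 3) - 48 * c) = 0"
    using quadratic_root[of 240] by (metis zero_neq_numeral)
  define w where "w = ?z3 z2"
  have w: "72 * w = 4 * b - 9 * a ^ 3 + 12 * a * z2" by (simp add: w_def)
  have z2: "33 * a ^ 4 - 104 * a\<^sup>2 * z2 + 80 * z2\<^sup>2 + 384 * a * w = 16 * c"
    using q w by algebra
  obtain x y z where xyz: "x + y + z = a" "x * y + x * z + y * z = z2" "x * y * z = w" by (rule cubic_roots)
  define u :: "complex ^ 3" where "u = (\<chi> i. if i = 1 then csqrt x else if i = 2 then csqrt y else csqrt z)"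
  have u: "(u $ 1)\<^sup>2 = x" "(u $ 2)\<^sup>2 = y" "(u $ 3)\<^sup>2 = z" by (simp_all add: u_def)
  show thesis
  proof (rule that[of u])
    show "bilin u u = a" using u xyz(1) by (simp add: bilin_def sum_3 power2_eq_square)
    have "4 * power_inv 6 u = 4 * b"
      unfolding power_inv_elementary u xyz using w by algebra
    then show "power_inv 6 u = b" by simp
    have "16 * power_inv 8 u = 16 * c"
      unfolding power_inv_elementary u xyz z2 ..
    then show "power_inv 8 u = c" by simp
  qed
qed

lemma sum_powers_zero:
  fixes f :: "'a \<Rightarrow> complex"
  assumes "finite K" "\<And>y. (\<Sum>k\<in>K. f k * y ^ e k) = 0"
  shows "(\<Sum>k\<in>{k\<in>K. e k = n}. f k) = 0"
proof (cases "\<exists>k\<in>K. e k = n")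
  case True
  define N where "N = Max (e ` K)"
  have N: "e ` K \<subseteq> {..N}" using assms(1) by (auto simp: N_def)
  have "(\<Sum>i\<le>N. (\<Sum>k\<in>{k\<in>K. e k = i}. f k) * y ^ i) = 0" for y
  proof -
    have "(\<Sum>i\<le>N. (\<Sum>k\<in>{k\<in>K. e k = i}. f k) * y ^ i) = (\<Sum>i\<le>N. \<Sum>k\<in>{k\<in>K. e k = i}. f k * y ^ e k)"
      by (intro sum.cong refl) (auto simp: sum_distrib_right)
    also have "\<dots> = (\<Sum>k\<in>K. f k * y ^ e k)"
      by (rule sum.group[OF assms(1) finite_atMost N])
    finally show ?thesis using assms(2) by simp
  qed
  then have "\<forall>i\<le>N. (\<Sum>k\<in>{k\<in>K. e k = i}. f k) = 0"
    using polyfun_eq_0[of "\<lambda>i. \<Sum>k\<in>{k\<in>K. e k = i}. f k" N] by blast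
  moreover have "n \<le> N" using True N by blast
  ultimately show ?thesis by blast
next
  case False
  then have "{k\<in>K. e k = n} = {}" by blast
  then show ?thesis by (simp only: sum.empty)
qed

lemma monomials_independent:
  fixes f :: "'a \<Rightarrow> complex"
  assumes K: "finite K" and inj: "\<And>k l. k \<in> K \<Longrightarrow> l \<in> K \<Longrightarrow> a k = a l \<Longrightarrow> b k = b l \<Longrightarrow> c k = c l \<Longrightarrow> k = l"
    and zero: "\<And>x y z. (\<Sum>k\<in>K. f k * (x ^ a k * y ^ b k * z ^ c k)) = 0" and k: "k \<in> K"
  shows "f k = 0"
proof -
  have 1: "(\<Sum>l\<in>{l\<in>K. a l = a k}. f l * (y ^ b l * z ^ c l)) = 0" for y z
  proof (rule sum_powers_zero[OF K])
    fix x
    have "f l * (y ^ b l * z ^ c l) * x ^ a l = f l * (x ^ a l * y ^ b l * z ^ c l)" for l by (simp add: mult_ac)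
    then show "(\<Sum>l\<in>K. f l * (y ^ b l * z ^ c l) * x ^ a l) = 0" using zero[of x y z] by (simp only:)
  qed
  have 2: "(\<Sum>l\<in>{l\<in>{l\<in>K. a l = a k}. b l = b k}. f l * z ^ c l) = 0" for z
  proof (rule sum_powers_zero)
    fix y
    have "f l * z ^ c l * y ^ b l = f l * (y ^ b l * z ^ c l)" for l by (simp add: mult_ac)
    then show "(\<Sum>l\<in>{l\<in>K. a l = a k}. f l * z ^ c l * y ^ b l) = 0" using 1[of y z] by (simp only:)
  qed (simp add: K)
  have 3: "(\<Sum>l\<in>{l\<in>{l\<in>{l\<in>K. a l = a k}. b l = b k}. c l = c k}. f l) = 0"
    by (rule sum_powers_zero[OF _ 2]) (simp add: K)
  have "{l\<in>{l\<in>{l\<in>K. a l = a k}. b l = b k}. c l = c k} = {k}" using inj k by blast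
  then show ?thesis using 3 by simp
qed

section \<open>The domain of the operator\<close>

lemma open_H_domain: "open H_domain"
  unfolding H_domain_def forall_3
  by (simp, intro open_Collect_conj open_Collect_neq continuous_intros)

text \<open>Signed sums of distinct powers of 3 are nonzero.\<close>

lemma H_domain_nonempty: "(\<chi> i. if i = 1 then 1 else if i = 2 then 3 else 9) \<in> H_domain"
  unfolding H_domain_def forall_3 by simp

text \<open>Along a line from a point of this nonempty open set the polynomial is an entire function
  of one variable that vanishes near the origin.\<close>

lemma cpoly_zero_on_H_domain:
  assumes F: "cpoly F" and z: "\<And>u. u \<in> H_domain \<Longrightarrow> F u = 0"
  shows "F u = 0"
proof -
  obtain u0 where u0: "u0 \<in> H_domain" using H_domain_nonempty by blast
  let ?g = "\<lambda>t::complex. F (u0 + t *s (u - u0))"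
  have "(?g has_field_derivative dir_deriv (u - u0) F (u0 + t *s (u - u0))) (at t)" for t
    by (rule DERIV_along_line[OF analytic_cpoly[OF F open_UNIV] UNIV_I])
  then have hol: "?g holomorphic_on UNIV" by (auto simp: holomorphic_on_def field_differentiable_def)
  have o: "open ((\<lambda>t::complex. u0 + t *s (u - u0)) -` H_domain)"
    by (intro open_vimage open_H_domain continuous_intros)
  have "?g 1 = (\<lambda>t. 0) (1::complex)"
    by (rule analytic_continuation_open[OF o open_UNIV _ _ _ hol])
      (use u0 z in \<open>auto intro!: exI[of _ 0] connected_UNIV simp: vimage_def\<close>)
  then show ?thesis by simp
qed

definition mult_op :: "'n::finite func \<Rightarrow> 'n func \<Rightarrow> 'n func" where "mult_op b f x = b x * f x"

lemma diff_op_H: "diff_op_on H_domain (H_op c)"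
proof -
  note A = open_H_domain
  have P: "diff_op_on H_domain (\<lambda>f x. b x * partial i f x)" if "analytic_open b H_domain" for b i
    by (rule diff_op_mult[OF diff_op_partial[OF A diff_op_id[OF A]] that])
  have an: "analytic_open (\<lambda>x. k / h x) H_domain" if "analytic_open h H_domain" "\<And>x. x \<in> H_domain \<Longrightarrow> h x \<noteq> 0" for k h
    by (rule analytic_open_divide[OF analytic_open_const[OF A] that])
  note n = analytic_open_nth[OF A]
  have nz: "x $ i \<noteq> 0" if "x \<in> H_domain" for x i using that unfolding H_domain_def by blast
  have 1: "diff_op_on H_domain (\<lambda>f x. \<Sum>i\<in>UNIV. partial i (partial i f) x)"
    by (intro diff_op_sum A diff_op_partial diff_op_id)
  have 2: "diff_op_on H_domain (\<lambda>f x. \<Sum>i\<in>UNIV. (4 * c + 1) * partial i f x / x $ i)"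
  proof (intro diff_op_sum A)
    show "diff_op_on H_domain (\<lambda>f x. (4 * c + 1) * partial i f x / x $ i)" for i
      by (rule diff_op_cong[OF P[OF an[OF n[of i] nz], of "4 * c + 1" i]]) simp_all
  qed
  have 3: "diff_op_on H_domain (\<lambda>f x. \<Sum>(i, j)\<in>{(1, 2), (1, 3), (2, 3)}. \<Sum>s\<in>{1, -1}.
        2 * c * (partial i f x + s * partial j f x) / (x $ i + s * x $ j))"
    unfolding split_def
  proof (intro diff_op_sum A)
    fix p :: "3 \<times> 3" and s :: complex assume p: "p \<in> {(1, 2), (1, 3), (2, 3)}" and s: "s \<in> {1, -1}"
    let ?h = "\<lambda>x. x $ fst p + s * x $ snd p"
    have h: "analytic_open ?h H_domain" by (intro analytic_open_add analytic_open_mult n analytic_open_const A)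
    have h0: "?h x \<noteq> 0" if "x \<in> H_domain" for x
    proof -
      have "\<forall>(i, j)\<in>{(1, 2), (1, 3), (2, 3)}. \<forall>s\<in>{1, -1}. x $ i + s * x $ j \<noteq> 0"
        using that unfolding H_domain_def by blast
      from bspec[OF this p] s show ?thesis by (auto simp: split_def)
    qed
    show "diff_op_on H_domain (\<lambda>f x. 2 * c * (partial (fst p) f x + s * partial (snd p) f x) / (x $ fst p + s * x $ snd p))"
      by (rule diff_op_cong[OF diff_op_add[OF P[OF an[OF h h0], of "2 * c" "fst p"] P[OF an[OF h h0], of "2 * c * s" "snd p"]]])
        (simp_all add: add_divide_distrib distrib_left mult.assoc)
  qed
  have 4: "diff_op_on H_domain (\<lambda>f x. \<Sum>e2\<in>{1, -1}. \<Sum>e3\<in>{1, -1}.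
        2 * (partial 1 f x + e2 * partial 2 f x + e3 * partial 3 f x) / (x $ 1 + e2 * x $ 2 + e3 * x $ 3))"
  proof (intro diff_op_sum A)
    fix e2 e3 :: complex assume e: "e2 \<in> {1, -1}" "e3 \<in> {1, -1}"
    let ?h = "\<lambda>x :: complex ^ 3. x $ 1 + e2 * x $ 2 + e3 * x $ 3"
    have h: "analytic_open ?h H_domain" by (intro analytic_open_add analytic_open_mult n analytic_open_const A)
    have h0: "?h x \<noteq> 0" if "x \<in> H_domain" for x using that e unfolding H_domain_def by blast
    show "diff_op_on H_domain (\<lambda>f x. 2 * (partial 1 f x + e2 * partial 2 f x + e3 * partial 3 f x) / (x $ 1 + e2 * x $ 2 + e3 * x $ 3))"
      by (rule diff_op_cong[OF diff_op_add[OF diff_op_add[OF P[OF an[OF h h0], of 2 1] P[OF an[OF h h0], of "2 * e2" 2]]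
            P[OF an[OF h h0], of "2 * e3" 3]]])
        (simp_all add: add_divide_distrib distrib_left mult.assoc)
  qed
  show ?thesis
    by (rule diff_op_cong[OF diff_op_diff[OF A diff_op_diff[OF A diff_op_diff[OF A 1 2] 3] 4]]) (simp only: H_op_def)
qed

section \<open>Quantum integrability\<close>

lemma S_const_pol: "app (S \<alpha>) (const_pol k) = const_pol k"
  by (rule pol_eqI) (simp add: val_S val_simps)

lemma sc_power_mult: "sc a * T = T * sc a \<Longrightarrow> (sc a * T) ^ d = sc (a ^ d) * T ^ d"
proof (induction d)
  case (Suc d)
  have p: "sc b * T = T * sc b \<Longrightarrow> T * (sc b * U) = sc b * (T * U)" for b U by (simp only: mult.assoc[symmetric])
  have c: "sc (a ^ d) * T = T * sc (a ^ d)"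
    using Suc.prems
  proof (induction d)
    case (Suc d)
    have "sc (a ^ Suc d) * T = sc a * (sc (a ^ d) * T)" by (simp only: power_Suc sc_simps mult.assoc)
    also have "\<dots> = sc a * (T * sc (a ^ d))" by (simp only: Suc.IH[OF Suc.prems])
    also have "\<dots> = sc a * T * sc (a ^ d)" by (simp only: mult.assoc)
    also have "\<dots> = T * sc a * sc (a ^ d)" by (simp only: Suc.prems)
    finally show ?case by (simp only: power_Suc sc_simps mult.assoc)
  qed (simp add: sc_simps)
  have "(sc a * T) ^ Suc d = sc a * (T * (sc (a ^ d) * T ^ d))"
    by (simp only: power_Suc Suc.IH[OF Suc.prems] mult.assoc)
  also have "\<dots> = sc a * (sc (a ^ d) * (T * T ^ d))" by (simp only: p[OF c])
  finally show ?case by (simp only: power_Suc sc_simps mult.assoc)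
qed (simp add: sc_simps)

context F4_setting
begin

definition inv_pol :: "4 pol \<Rightarrow> bool" where
  "inv_pol P \<longleftrightarrow> (\<forall>\<alpha>\<in>F4. app (S \<alpha>) P = P)"

definition res :: "4 pol \<Rightarrow> 3 func" where "res P u = val P (\<phi> u)"

lemma inv_pol_val: "inv_pol P \<Longrightarrow> \<alpha> \<in> F4 \<Longrightarrow> val P (reflection \<alpha> x) = val P x"
  unfolding inv_pol_def using val_S by metis

lemma invariant_function_val: "inv_pol P \<Longrightarrow> invariant_function F4 Rp m UNIV (val P)"
  by unfold_locales (simp_all add: analytic_cpoly cpoly_val inv_pol_val)

text \<open>Multiply a Taylor polynomial by a polynomial that is 1 to order \<open>n\<close> at \<open>\<phi> u0\<close> and vanishes to
  order \<open>n\<close> at the other points of its orbit, then average over the group.\<close>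

lemma invariants_determine_jets:
  assumes u0: "u0 \<in> H_domain" and f: "analytic_open f V" and V: "u0 \<in> V"
  obtains P where "inv_pol P" "vanishes n (\<lambda>u. f u - res P u) u0"
proof -
  let ?W = "coxeter_group F4"
  define x0 where "x0 = \<phi> u0"
  obtain T where T: "cpoly T" "vanishes n (\<lambda>u. f u - T u) u0" using taylor_polynomial[OF f V] .
  define Z where "Z = (\<lambda>w. w x0) ` ?W - {x0}"
  have fZ: "finite Z" using finite_W by (simp add: Z_def)
  have "\<exists>l. cpoly l \<and> l z = 0 \<and> l x0 = 1" if "z \<in> Z" for z
  proof -
    have "z \<noteq> x0" using that by (simp add: Z_def)
    then obtain i where i: "z $ i \<noteq> x0 $ i" by (auto simp: vec_eq_iff)
    have "cpoly (\<lambda>y. (y $ i - z $ i) * (1 / (x0 $ i - z $ i)))"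
      by (intro cpoly_mult cpoly_diff cpoly_coord cpoly.const)
    then show ?thesis using i by (intro exI[of _ "\<lambda>y. (y $ i - z $ i) * (1 / (x0 $ i - z $ i))"]) simp
  qed
  then obtain l where l: "\<And>z. z \<in> Z \<Longrightarrow> cpoly (l z)" "\<And>z. z \<in> Z \<Longrightarrow> l z z = 0" "\<And>z. z \<in> Z \<Longrightarrow> l z x0 = 1"
    by metis
  \<comment> \<open>\<open>q0\<close> vanishes to order \<open>n\<close> on \<open>Z\<close> and is
    1 at \<open>x0\<close>. The polynomial \<open>q\<close> is still a multiple of
    \<open>q0\<close>, while \<open>1 - q = (1 - q0) ^ n\<close> makes it 1 to order
    \<open>n\<close> at \<open>x0\<close>.\<close>
  define q0 where "q0 = (\<lambda>y. \<Prod>z\<in>Z. l z y ^ n)"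
  define q where "q = (\<lambda>y. q0 y * (\<Sum>i<n. (1 - q0 y) ^ i))"
  have cq0: "cpoly q0" unfolding q0_def by (intro cpoly_prod cpoly_power l(1))
  have q: "1 - q y = (1 - q0 y) ^ n" for y
  proof -
    have "1 - (1 - q0 y) ^ n = (1 - (1 - q0 y)) * (\<Sum>i<n. (1 - q0 y) ^ i)" by (rule one_diff_power_eq)
    then have *: "1 - (1 - q0 y) ^ n = q y" by (simp only: q_def diff_diff_eq2 add_diff_cancel_left')
    show ?thesis unfolding *[symmetric] by (simp only: diff_diff_eq2 add_diff_cancel_left')
  qed
  have q01: "q0 x0 = 1" unfolding q0_def by (intro prod.neutral ballI) (simp add: l(3))
  \<comment> \<open>A linear left inverse of \<phi>, which turns the Taylor polynomial into a
    polynomial on the whole space.\<close>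
  define psi :: "complex ^ 4 \<Rightarrow> complex ^ 3" where "psi = (\<lambda>y. \<chi> i. bilin (\<phi> (axis i 1)) y)"
  have psi_lin: "Vector_Spaces.linear (*s) (*s) psi"
    by (rule clinearI) (simp_all add: psi_def vec_eq_iff bilin_simps)
  have psi: "psi (\<phi> u) = u" for u by (simp add: psi_def vec_eq_iff bilin_phi bilin_axis_left)
  define Q where "Q = (\<lambda>y. q y * T (psi y))"
  have cQ: "cpoly Q" unfolding Q_def q_def
    by (intro cpoly_mult cq0 cpoly_sum cpoly_power cpoly_diff cpoly.const cpoly_linear[OF psi_lin T(1)])
  \<comment> \<open>The stabilizer of \<open>x0\<close> fixes the whole mirror pointwise, so its
    elements contribute \<open>card St\<close> equal terms to the average on the mirror;
    \<open>k\<close> removes this factor.\<close>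
  define St where "St = {w\<in>?W. w x0 = x0}"
  have St: "finite St" "St \<noteq> {}"
    using finite_W coxeter_group.one[of F4] by (auto simp: St_def intro!: exI[of _ id])
  have b0: "bilin \<beta> (\<phi> u) = 0" for u using range_phi unfolding mirror_def by auto
  have St_phi: "w (\<phi> u) = \<phi> u" if "w \<in> St" for w u
  proof -
    have w: "w \<in> ?W" "w x0 = x0" using that by (simp_all add: St_def)
    have "w = id \<or> w = reflection \<beta>"
      by (rule stabilizer[OF root_F4 b0[of u0] H_domain_generic[OF u0] w(1) w(2)[unfolded x0_def]])
    then show ?thesis using reflection_fix[OF b0] by auto
  qed
  define k :: complex where "k = 1 / of_nat (card St)"
  have k: "of_nat (card St) * k = 1" using St by (simp add: k_def)
  define F where "F = (\<lambda>y. k * (\<Sum>w\<in>?W. Q (w y)))"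
  have cF: "cpoly F" unfolding F_def
    by (intro cpoly_mult cpoly.const cpoly_sum cpoly_linear[OF coxeter_group_linear cQ])
  define P where "P = Abs_pol F"
  have vP: "val P = F" unfolding P_def by (rule val_Abs_pol[OF cF])
  have "inv_pol P"
    unfolding inv_pol_def
  proof (intro ballI pol_eqI)
    fix \<alpha> y assume \<alpha>: "\<alpha> \<in> F4"
    have "bij_betw (\<lambda>w. w \<circ> reflection \<alpha>) ?W ?W"
    proof (rule bij_betwI[where g = "\<lambda>w. w \<circ> reflection \<alpha>"])
      show "(\<lambda>w. w \<circ> reflection \<alpha>) \<in> ?W \<rightarrow> ?W"
        using coxeter_group_comp[OF _ coxeter_group_reflection[OF \<alpha>]] by blast
      then show "(\<lambda>w. w \<circ> reflection \<alpha>) \<in> ?W \<rightarrow> ?W" .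
    qed (auto simp: fun_eq_iff reflection_reflection[OF nonisotropic[OF \<alpha>]])
    then have "(\<Sum>w\<in>?W. Q ((w \<circ> reflection \<alpha>) y)) = (\<Sum>w\<in>?W. Q (w y))"
      by (rule sum.reindex_bij_betw[where g = "\<lambda>w. Q (w y)"])
    then show "val (app (S \<alpha>) P) y = val P y" by (simp add: val_S vP F_def)
  qed
  moreover have "vanishes n (\<lambda>u. f u - res P u) u0"
  proof -
    have oV: "open V" using f by (rule analytic_open_open)
    have cphi: "cpoly (\<lambda>u. g (\<phi> u))" if "cpoly g" for g by (rule cpoly_linear[OF phi_linear that])
    have qT: "vanishes n (\<lambda>u. (1 - q0 (\<phi> u)) ^ n * T u) u0"
    proof (rule vanishes_mult_right[OF _ _ V])
      have "cpoly (\<lambda>u. 1 - q0 (\<phi> u))" by (intro cpoly_diff cpoly.const cphi cq0)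
      then have a: "analytic_open (\<lambda>u. 1 - q0 (\<phi> u)) V" by (rule analytic_cpoly[OF _ oV])
      have z: "1 - q0 (\<phi> u0) = 0" using q01 by (simp add: x0_def)
      show "analytic_open (\<lambda>u. (1 - q0 (\<phi> u)) ^ n) V" "vanishes n (\<lambda>u. (1 - q0 (\<phi> u)) ^ n) u0"
        using vanishes_power[of "\<lambda>u. 1 - q0 (\<phi> u)" V u0 n] a V z by blast+
      show "analytic_open T V" by (rule analytic_cpoly[OF T(1) oV])
    qed
    have rest: "vanishes n (\<lambda>u. - k * Q (w (\<phi> u))) u0" if w: "w \<in> ?W - St" for w
    proof -
      let ?z = "w x0"
      have z: "?z \<in> Z" using w by (auto simp: Z_def St_def)
      have lin: "Vector_Spaces.linear (*s) (*s) (w \<circ> \<phi>)"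
        using Vector_Spaces.linear_compose[OF phi_linear coxeter_group_linear] w by blast
      have cw: "cpoly (\<lambda>u. g (w (\<phi> u)))" if "cpoly g" for g
        using cpoly_linear[OF lin that] by simp
      \<comment> \<open>The cofactor of \<open>l ?z y ^ n\<close> in \<open>- k * Q y\<close>, where
        \<open>?z = w x0\<close>; that power makes the summand of \<open>w\<close> vanish to order
        \<open>n\<close> at \<open>u0\<close>.\<close>
      define r where "r = (\<lambda>y. (\<Prod>z\<in>Z - {?z}. l z y ^ n) * (\<Sum>i<n. (1 - q0 y) ^ i) * T (psi y) * (- k))"
      have cr: "cpoly r" unfolding r_def
        by (intro cpoly_mult cpoly_prod cpoly_power cpoly_sum cpoly_diff cpoly.const cq0 cpoly_linear[OF psi_lin T(1)] l(1)) simp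
      have "q0 y = l ?z y ^ n * (\<Prod>z\<in>Z - {?z}. l z y ^ n)" for y
        unfolding q0_def by (rule prod.remove[OF fZ z])
      then have Qr: "- k * Q y = l ?z y ^ n * r y" for y
        by (simp add: Q_def q_def r_def mult_ac)
      have "vanishes n (\<lambda>u. l ?z (w (\<phi> u)) ^ n * r (w (\<phi> u))) u0"
      proof (rule vanishes_mult_right[OF _ _ V])
        have a: "analytic_open (\<lambda>u. l ?z (w (\<phi> u))) V" by (rule analytic_cpoly[OF cw[OF l(1)[OF z]] oV])
        have z0: "l ?z (w (\<phi> u0)) = 0" using l(2)[OF z] by (simp add: x0_def)
        show "analytic_open (\<lambda>u. l ?z (w (\<phi> u)) ^ n) V" "vanishes n (\<lambda>u. l ?z (w (\<phi> u)) ^ n) u0"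
          using vanishes_power[of "\<lambda>u. l ?z (w (\<phi> u))" V u0 n] a V z0 by blast+
        show "analytic_open (\<lambda>u. r (w (\<phi> u))) V" by (rule analytic_cpoly[OF cw[OF cr] oV])
      qed
      then show ?thesis by (simp only: Qr)
    qed
    have an_rest: "analytic_open (\<lambda>u. - k * Q (w (\<phi> u))) V" if "w \<in> ?W" for w
    proof -
      have "cpoly (\<lambda>u. - k * Q ((w \<circ> \<phi>) u))"
        by (intro cpoly_mult cpoly.const cpoly_linear[OF Vector_Spaces.linear_compose[OF phi_linear coxeter_group_linear[OF that]] cQ])
      then show ?thesis using analytic_cpoly[OF _ oV] by simp
    qed
    have eq: "f u - res P u = ((f u - T u) + (1 - q0 (\<phi> u)) ^ n * T u) + (\<Sum>w\<in>?W - St. - k * Q (w (\<phi> u)))" for u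
    proof -
      have "(\<Sum>w\<in>?W. Q (w (\<phi> u))) = (\<Sum>w\<in>?W - St. Q (w (\<phi> u))) + (\<Sum>w\<in>St. Q (w (\<phi> u)))"
        by (rule sum.subset_diff) (auto simp: St_def finite_W)
      also have "(\<Sum>w\<in>St. Q (w (\<phi> u))) = of_nat (card St) * (q (\<phi> u) * T u)"
      proof -
        have "(\<Sum>w\<in>St. Q (w (\<phi> u))) = (\<Sum>w\<in>St. Q (\<phi> u))" by (intro sum.cong refl) (simp only: St_phi)
        then show ?thesis by (simp add: Q_def psi)
      qed
      finally have "res P u = k * (\<Sum>w\<in>?W - St. Q (w (\<phi> u))) + (of_nat (card St) * k) * (q (\<phi> u) * T u)"
        by (simp add: res_def vP F_def algebra_simps)
      moreover have "(\<Sum>w\<in>?W - St. - k * Q (w (\<phi> u))) = - (k * (\<Sum>w\<in>?W - St. Q (w (\<phi> u))))"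
        by (simp add: sum_distrib_left sum_negf)
      moreover have "(1 - q0 (\<phi> u)) ^ n * T u = T u - q (\<phi> u) * T u"
        unfolding q[symmetric] by (simp add: algebra_simps)
      ultimately show ?thesis unfolding k by simp
    qed
    have aT: "analytic_open T V" by (rule analytic_cpoly[OF T(1) oV])
    have a1: "analytic_open (\<lambda>u. f u - T u) V" by (rule analytic_open_diff[OF f aT])
    have "cpoly (\<lambda>u. (1 - q0 (\<phi> u)) ^ n * T u)"
      by (intro cpoly_mult cpoly_power cpoly_diff cpoly.const cphi cq0 T(1))
    then have a2: "analytic_open (\<lambda>u. (1 - q0 (\<phi> u)) ^ n * T u) V" by (rule analytic_cpoly[OF _ oV])
    have a3: "analytic_open (\<lambda>u. \<Sum>w\<in>?W - St. - k * Q (w (\<phi> u))) V"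
      by (rule analytic_open_sum[OF oV]) (rule an_rest, simp)
    have v3: "vanishes n (\<lambda>u. \<Sum>w\<in>?W - St. - k * Q (w (\<phi> u))) u0"
      by (rule vanishes_sum[OF oV V _ rest]) (rule an_rest, simp_all)
    show ?thesis unfolding eq
      by (rule vanishes_add[OF analytic_open_add[OF a1 a2] a3 V vanishes_add[OF a1 a2 V T(2) qT] v3])
  qed
  ultimately show thesis by (rule that)
qed

lemma diff_op_zero_test:
  assumes M: "diff_op_on H_domain M" and z: "\<And>P u. inv_pol P \<Longrightarrow> u \<in> H_domain \<Longrightarrow> M (res P) u = 0"
    and V: "V \<subseteq> H_domain" "analytic_open f V" "u \<in> V"
  shows "M f u = 0"
proof (rule diff_op_jet[OF M])
  fix n assume jet: "\<And>V f g x. V \<subseteq> H_domain \<Longrightarrow> analytic_open f V \<Longrightarrow> analytic_open g V \<Longrightarrow> x \<in> V \<Longrightarrow>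
    vanishes n (\<lambda>y. f y - g y) x \<Longrightarrow> M f x = M g x"
  have u: "u \<in> H_domain" using V by blast
  obtain P where P: "inv_pol P" "vanishes n (\<lambda>v. f v - res P v) u"
    using invariants_determine_jets[OF u V(2,3)] .
  have "cpoly (\<lambda>v. val P (\<phi> v))" by (rule cpoly_linear[OF phi_linear cpoly_val])
  then have "analytic_open (res P) V"
    unfolding res_def[abs_def] by (rule analytic_cpoly[OF _ analytic_open_open[OF V(2)]])
  then have "M f u = M (res P) u" by (rule jet[OF V(1,2) _ V(3) P(2)])
  then show ?thesis using z[OF P(1) u] by simp
qed

text \<open>The condition covers every \<open>g\<close> that agrees with \<open>res P\<close> on
  \<open>H_domain\<close> alone. Functions are total and the value of an operator is controlled only
  on the domain, so this freedom is what allows composition.\<close>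

definition restricts :: "(3 func \<Rightarrow> 3 func) \<Rightarrow> 4 pend \<Rightarrow> bool" where
  "restricts L T \<longleftrightarrow> (\<forall>P. inv_pol P \<longrightarrow> inv_pol (app T P) \<and>
     (\<forall>g. (\<forall>u\<in>H_domain. g u = res P u) \<longrightarrow> (\<forall>u\<in>H_domain. L g u = res (app T P) u)))"

lemma restrictsD:
  assumes "restricts L T" "inv_pol P"
  shows "inv_pol (app T P)" "(\<And>u. u \<in> H_domain \<Longrightarrow> g u = res P u) \<Longrightarrow> u \<in> H_domain \<Longrightarrow> L g u = res (app T P) u"
  using assms unfolding restricts_def by simp_all

lemma restrictsI:
  assumes "\<And>P. inv_pol P \<Longrightarrow> inv_pol (app T P)"
    "\<And>P g u. inv_pol P \<Longrightarrow> (\<And>u. u \<in> H_domain \<Longrightarrow> g u = res P u) \<Longrightarrow> u \<in> H_domain \<Longrightarrow> L g u = res (app T P) u"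
  shows "restricts L T"
  using assms unfolding restricts_def by simp

lemma inv_pol_add: "inv_pol P \<Longrightarrow> inv_pol Q \<Longrightarrow> inv_pol (P + Q)"
  and inv_pol_diff: "inv_pol P \<Longrightarrow> inv_pol Q \<Longrightarrow> inv_pol (P - Q)"
proof -
  have "app T (P - Q) = app T P - app T Q" for T :: "4 pend" and P Q
    using app_simps(7)[of T "P - Q" Q] by (simp add: eq_diff_eq)
  then show "inv_pol P \<Longrightarrow> inv_pol Q \<Longrightarrow> inv_pol (P - Q)" by (simp add: inv_pol_def)
qed (simp add: inv_pol_def app_simps)

lemma inv_pol_app: "(\<And>\<alpha>. \<alpha> \<in> F4 \<Longrightarrow> S \<alpha> * T = T * S \<alpha>) \<Longrightarrow> inv_pol P \<Longrightarrow> inv_pol (app T P)"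
  unfolding inv_pol_def by (metis app_simps(6))

lemma restricts_comp: "restricts L T \<Longrightarrow> restricts L' T' \<Longrightarrow> restricts (\<lambda>f. L (L' f)) (T * T')"
  by (rule restrictsI) (simp_all add: app_simps restrictsD)

lemma restricts_diff: "restricts L T \<Longrightarrow> restricts L' T' \<Longrightarrow> restricts (\<lambda>f u. L f u - L' f u) (T - T')"
  by (rule restrictsI) (simp_all add: app_simps restrictsD inv_pol_diff, simp add: res_def val_simps restrictsD)

lemma restricts_id: "restricts (\<lambda>f. f) 1"
  by (rule restrictsI) (simp_all add: app_simps)

lemma restricts_scale: "restricts L T \<Longrightarrow> restricts (\<lambda>f u. k * L f u) (sc k * T)"
proof (rule restrictsI)
  assume r: "restricts L T"
  have i: "inv_pol (app (sc k) P)" if "inv_pol P" for P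
    by (rule inv_pol_app[OF sc_S[symmetric] that])
  show "inv_pol (app (sc k * T) P)" if "inv_pol P" for P
    by (simp add: app_simps i restrictsD[OF r] that)
  show "k * L g u = res (app (sc k * T) P) u"
    if "inv_pol P" "\<And>u. u \<in> H_domain \<Longrightarrow> g u = res P u" "u \<in> H_domain" for P g u
    using restrictsD(2)[OF r that(1) that(2) that(3)] by (simp add: res_def app_simps val_sc)
qed

lemma restricts_zero: "restricts (\<lambda>f u. 0) 0"
  by (rule restrictsI) (simp_all add: app_simps inv_pol_def res_def val_simps,
    metis app_simps(7) add_cancel_right_right)

lemma restricts_sum:
  assumes "\<And>i. i \<in> I \<Longrightarrow> restricts (L i) (T i)"
  shows "restricts (\<lambda>f u. \<Sum>i\<in>I. L i f u) (\<Sum>i\<in>I. T i)"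
  using assms
proof (induction I rule: infinite_finite_induct)
  case (insert i I)
  have a: "restricts (\<lambda>f u. L f u + L' f u) (T + T')" if "restricts L T" "restricts L' T'" for L L' T T'
    using that by (intro restrictsI) (simp_all add: app_simps restrictsD inv_pol_add, simp add: res_def val_simps restrictsD)
  show ?case using a[of "L i" "T i" "\<lambda>f u. \<Sum>i\<in>I. L i f u" "\<Sum>i\<in>I. T i"] insert by simp
qed (simp_all add: restricts_zero)

lemma restricts_power: "restricts L T \<Longrightarrow> restricts (L ^^ n) (T ^ n)"
proof (induction n)
  case 0
  show ?case using restricts_id by (simp add: id_def)
next
  case (Suc n)
  then show ?case using restricts_comp[OF Suc.prems Suc.IH[OF Suc.prems]] by (simp add: comp_def)
qed

lemma restricts_H: "restricts (H_op c) Lap"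
proof (rule restrictsI)
  fix P assume P: "inv_pol P"
  show "inv_pol (app Lap P)" by (rule inv_pol_app[OF S_Lap P])
  fix g u assume g: "\<And>u. u \<in> H_domain \<Longrightarrow> g u = res P u" and u: "u \<in> H_domain"
  have "H_op c g u = H_op c (val P \<circ> \<phi>) u"
    by (rule H_op_cong[OF open_H_domain u]) (simp add: g res_def)
  also have "\<dots> = dunkl_laplacian F4 Rp m (val P) (\<phi> u)"
    by (rule dunkl_laplacian_eq_H[OF invariant_function_val[OF P] UNIV_I H_domain_generic[OF u], symmetric])
  finally show "H_op c g u = res (app Lap P) u" by (simp add: res_def val_Lap)
qed

text \<open>The orbit of \<beta> divided by \<open>p\<close>. With this scaling the pairing of
  \<open>A \<alpha>\<close> with \<open>\<phi> u\<close> is that of \<alpha> with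
  \<open>incl u\<close>, so \<open>XX d\<close> restricts to multiplication by
  \<open>power_inv d\<close> for either length of \<beta>.\<close>

definition frame_roots :: "(complex ^ 4) set" where "frame_roots = A ` short_roots"

lemma bij_frame_roots:
  assumes \<alpha>: "\<alpha> \<in> F4"
  shows "bij_betw (reflection \<alpha>) frame_roots frame_roots"
proof -
  have "reflection \<alpha> \<xi> \<in> frame_roots" if \<xi>: "\<xi> \<in> frame_roots" for \<xi>
  proof -
    obtain a where a: "a \<in> short_roots" "\<xi> = A a" using \<xi> by (auto simp: frame_roots_def)
    have "p *s \<xi> \<in> root_orbit F4 \<beta>" unfolding orbit using a by blast
    then obtain w where w: "w \<in> coxeter_group F4" "p *s \<xi> = w \<beta>" unfolding root_orbit_def by blast
    have "reflection \<alpha> (p *s \<xi>) = (reflection \<alpha> \<circ> w) \<beta>" using w(2) by simp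
    then have "reflection \<alpha> (p *s \<xi>) \<in> root_orbit F4 \<beta>"
      unfolding root_orbit_def using coxeter_group.step[OF \<alpha> w(1)] by blast
    then obtain b where b: "b \<in> short_roots" "reflection \<alpha> (p *s \<xi>) = p *s A b" unfolding orbit by blast
    have "p *s reflection \<alpha> \<xi> = p *s A b" using b(2) clinear_scale[OF reflection_linear] by metis
    then show ?thesis using pq(1) b(1) by (simp add: frame_roots_def)
  qed
  then show ?thesis
    by (intro bij_betwI[where g = "reflection \<alpha>"]) (auto simp: reflection_reflection[OF nonisotropic[OF \<alpha>]])
qed

text \<open>\<open>XX\<close> and \<open>DD\<close> are the \<open>p_d\<close> and
  \<open>D_d\<close> of the overview, as operators on polynomials.\<close>

definition XX :: "nat \<Rightarrow> 4 pend" where "XX d = (\<Sum>\<xi>\<in>frame_roots. X \<xi> ^ d)"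
definition DD :: "nat \<Rightarrow> 4 pend" where "DD d = (\<Sum>\<xi>\<in>frame_roots. D \<xi> ^ d)"

lemma S_power:
  assumes "\<And>\<xi>. S \<alpha> * Y \<xi> = Y (reflection \<alpha> \<xi>) * S \<alpha>"
  shows "S \<alpha> * Y \<xi> ^ d = Y (reflection \<alpha> \<xi>) ^ d * S \<alpha>"
proof (induction d)
  case (Suc d)
  have "S \<alpha> * Y \<xi> ^ Suc d = Y (reflection \<alpha> \<xi>) * (S \<alpha> * Y \<xi> ^ d)"
    by (simp only: power_Suc mult.assoc[symmetric] assms)
  also have "\<dots> = Y (reflection \<alpha> \<xi>) * (Y (reflection \<alpha> \<xi>) ^ d * S \<alpha>)" by (simp only: Suc.IH)
  finally show ?case by (simp only: power_Suc mult.assoc)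
qed simp

lemma S_power_sum:
  assumes "\<alpha> \<in> F4" "\<And>\<xi>. S \<alpha> * Y \<xi> = Y (reflection \<alpha> \<xi>) * S \<alpha>"
  shows "S \<alpha> * (\<Sum>\<xi>\<in>frame_roots. Y \<xi> ^ d) = (\<Sum>\<xi>\<in>frame_roots. Y \<xi> ^ d) * S \<alpha>"
proof -
  have "S \<alpha> * (\<Sum>\<xi>\<in>frame_roots. Y \<xi> ^ d) = (\<Sum>\<xi>\<in>frame_roots. Y (reflection \<alpha> \<xi>) ^ d) * S \<alpha>"
  proof -
    have "S \<alpha> * Y \<xi> ^ d = Y (reflection \<alpha> \<xi>) ^ d * S \<alpha>" for \<xi> by (rule S_power) (rule assms(2))
    then show ?thesis by (simp only: sum_distrib_left sum_distrib_right)
  qed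
  also have "(\<Sum>\<xi>\<in>frame_roots. Y (reflection \<alpha> \<xi>) ^ d) = (\<Sum>\<xi>\<in>frame_roots. Y \<xi> ^ d)"
    by (rule sum.reindex_bij_betw[OF bij_frame_roots[OF assms(1)]])
  finally show ?thesis .
qed

lemma S_XX: "\<alpha> \<in> F4 \<Longrightarrow> S \<alpha> * XX d = XX d * S \<alpha>"
  unfolding XX_def by (rule S_power_sum) (assumption, rule S_X)

lemma nilp_Lap_XX: "nilp Lap d (XX d) (sc (2 ^ d) * DD d)"
proof -
  have two: "(2 :: 4 pend) * D \<xi> = sc 2 * D \<xi>" for \<xi>
  proof -
    have "sc (of_nat 2) = (of_nat 2 :: 4 pend)" by (rule sc_of_nat)
    then show ?thesis by simp
  qed
  have "nilp Lap d (X \<xi> ^ d) (sc (2 ^ d) * D \<xi> ^ d)" for \<xi>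
    using nilp_power[OF nilp_Lap[of \<xi>], of d] unfolding two sc_power_mult[OF sc_D] by simp
  then have "nilp Lap d (\<Sum>\<xi>\<in>frame_roots. X \<xi> ^ d) (\<Sum>\<xi>\<in>frame_roots. sc (2 ^ d) * D \<xi> ^ d)"
    by (rule nilp_sum)
  then show ?thesis by (simp only: XX_def DD_def sum_distrib_left)
qed

text \<open>\<open>ad E\<close> sends \<open>D \<xi>\<close> to \<open>- X \<xi>\<close>; an even
  power removes the sign.\<close>

lemma nilp_E_DD:
  assumes "even d"
  shows "nilp E d (DD d) (XX d)"
proof -
  have "nilp E d (D \<xi> ^ d) (X \<xi> ^ d)" for \<xi>
    using nilp_power[OF nilp_E[of \<xi>], of d] by (simp add: power_minus_even[OF assms])
  then show ?thesis unfolding XX_def DD_def by (rule nilp_sum)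
qed

lemma nilp_E_Lap: "nilp E 2 Lap (\<Sum>i\<in>UNIV. X (e i) ^ 2)"
proof -
  have "nilp E 2 (D \<xi> ^ 2) (X \<xi> ^ 2)" for \<xi>
    using nilp_power[OF nilp_E[of \<xi>], of 2] by simp
  then have "nilp E 2 (\<Sum>i\<in>UNIV. D (e i) ^ 2) (\<Sum>i\<in>UNIV. X (e i) ^ 2)" by (rule nilp_sum)
  then show ?thesis by (simp only: Lap_def power2_eq_square)
qed

lemma val_X_power: "val (app (X \<xi> ^ d) P) x = bilin \<xi> x ^ d * val P x"
  by (induction d) (simp_all add: app_simps val_X)

lemma val_XX: "val (app (XX d) P) (\<phi> u) = power_inv d u * val P (\<phi> u)"
proof -
  have "val (app (XX d) P) (\<phi> u) = (\<Sum>\<xi>\<in>frame_roots. bilin \<xi> (\<phi> u) ^ d) * val P (\<phi> u)"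
    unfolding XX_def by (simp add: app_sum val_sum val_X_power sum_distrib_right)
  also have "(\<Sum>\<xi>\<in>frame_roots. bilin \<xi> (\<phi> u) ^ d) = power_inv d u"
    unfolding frame_roots_def power_inv_def \<phi>_def
    by (subst sum.reindex[OF inj_on_subset[OF inj_A subset_UNIV]]) (simp add: bil)
  finally show ?thesis .
qed

lemma val_r2: "val (app (\<Sum>i\<in>UNIV. X (e i) ^ 2) P) (\<phi> u) = bilin u u * val P (\<phi> u)"
proof -
  have "val (app (\<Sum>i\<in>UNIV. X (e i) ^ 2) P) (\<phi> u) = bilin (\<phi> u) (\<phi> u) * val P (\<phi> u)"
    unfolding app_sum val_sum val_X_power bilin_axis_left bilin_def[of "\<phi> u" "\<phi> u"] sum_distrib_right
    by (simp only: power2_eq_square)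
  then show ?thesis by (simp only: bilin_phi)
qed

lemma D_power_commute: "D \<xi> ^ a * D \<eta> ^ b = D \<eta> ^ b * D \<xi> ^ a"
  by (rule power_commuting_commutes[OF power_commuting_commutes[OF D_commute, symmetric]])

lemma DD_commute: "DD a * DD b = DD b * DD a"
proof -
  have "DD a * DD b = (\<Sum>\<xi>\<in>frame_roots. \<Sum>\<eta>\<in>frame_roots. D \<xi> ^ a * D \<eta> ^ b)"
    unfolding DD_def by (simp only: sum_product)
  also have "\<dots> = (\<Sum>\<eta>\<in>frame_roots. \<Sum>\<xi>\<in>frame_roots. D \<eta> ^ b * D \<xi> ^ a)"
    by (subst sum.swap) (simp only: D_power_commute[of _ a _ b])
  also have "\<dots> = DD b * DD a" unfolding DD_def by (simp only: sum_product)
  finally show ?thesis .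
qed

lemma Lap_DD: "Lap * DD a = DD a * Lap"
proof -
  have "Lap * D \<xi> ^ a = D \<xi> ^ a * Lap" for \<xi> by (rule power_commuting_commutes[symmetric, OF Lap_D[symmetric]])
  then show ?thesis unfolding DD_def by (simp only: sum_distrib_left sum_distrib_right)
qed

definition ad_H :: "(3 func \<Rightarrow> 3 func) \<Rightarrow> 3 func \<Rightarrow> 3 func" where
  "ad_H T f u = H_op c (T f) u - T (H_op c f) u"

definition integral_op :: "nat \<Rightarrow> 3 func \<Rightarrow> 3 func" where
  "integral_op d f u = 1 / (fact d * 2 ^ d) * (ad_H ^^ d) (mult_op (power_inv d)) f u"

lemma restricts_mult: "restricts (mult_op (power_inv d)) (XX d)"
  by (rule restrictsI) (simp_all add: inv_pol_app[OF S_XX] mult_op_def res_def val_XX)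

lemma restricts_ad:
  assumes "restricts L T"
  shows "restricts ((ad_H ^^ n) L) ((ad Lap ^^ n) T)"
proof (induction n)
  case (Suc n)
  have "restricts (\<lambda>f u. H_op c (((ad_H ^^ n) L) f) u - ((ad_H ^^ n) L) (H_op c f) u) (Lap * (ad Lap ^^ n) T - (ad Lap ^^ n) T * Lap)"
    by (rule restricts_diff[OF restricts_comp[OF restricts_H Suc.IH] restricts_comp[OF Suc.IH restricts_H]])
  moreover have "(\<lambda>f u. H_op c (((ad_H ^^ n) L) f) u - ((ad_H ^^ n) L) (H_op c f) u) = (ad_H ^^ Suc n) L"
    by (simp only: funpow.simps comp_apply ad_H_def[of "(ad_H ^^ n) L", abs_def])
  moreover have "(ad Lap ^^ Suc n) T = Lap * (ad Lap ^^ n) T - (ad Lap ^^ n) T * Lap"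
    by (simp only: funpow.simps comp_apply ad_def[of Lap "(ad Lap ^^ n) T"])
  ultimately show ?case by (simp only:)
qed (simp add: assms)

lemma restricts_integral: "restricts (integral_op d) (DD d)"
proof -
  have "restricts (\<lambda>f u. 1 / (fact d * 2 ^ d) * (ad_H ^^ d) (mult_op (power_inv d)) f u)
      (sc (1 / (fact d * 2 ^ d)) * (ad Lap ^^ d) (XX d))"
    by (rule restricts_scale[OF restricts_ad[OF restricts_mult]])
  moreover have "sc (1 / (fact d * 2 ^ d)) * (ad Lap ^^ d) (XX d) = DD d"
  proof -
    have "sc (1 / (fact d * 2 ^ d)) * (ad Lap ^^ d) (XX d) = sc (1 / (fact d * 2 ^ d)) * (sc (of_nat (fact d)) * (sc (2 ^ d) * DD d))"
      unfolding nilp_ad[OF nilp_Lap_XX] sc_of_nat ..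
    also have "\<dots> = sc (1 / (fact d * 2 ^ d) * of_nat (fact d) * 2 ^ d) * DD d"
      by (simp only: sc_simps mult.assoc)
    also have "1 / (fact d * 2 ^ d) * of_nat (fact d) * 2 ^ d = (1 :: complex)" by simp
    finally show ?thesis by (simp add: sc_simps)
  qed
  ultimately show ?thesis by (simp add: integral_op_def[abs_def])
qed

lemma diff_op_integral: "diff_op_on H_domain (integral_op d)"
proof -
  have p: "analytic_open (power_inv d) H_domain"
  proof -
    have "cpoly (\<lambda>u. bilin \<alpha> (incl u))" for \<alpha> by (rule cpoly_linear[OF incl_linear cpoly_bilin])
    then show ?thesis
      unfolding power_inv_def[abs_def] by (intro analytic_cpoly open_H_domain cpoly_sum cpoly_power)
  qed
  have M: "diff_op_on H_domain (mult_op (power_inv d))"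
    unfolding mult_op_def[abs_def] by (rule diff_op_mult[OF diff_op_id[OF open_H_domain] p])
  have "diff_op_on H_domain ((ad_H ^^ n) (mult_op (power_inv d)))" for n
  proof (induction n)
    case (Suc n)
    have "(ad_H ^^ Suc n) M = (\<lambda>f u. H_op c ((ad_H ^^ n) M f) u - (ad_H ^^ n) M (H_op c f) u)" for M
      by (simp only: funpow.simps comp_apply ad_H_def[of "(ad_H ^^ n) M", abs_def])
    then show ?case by (simp only:) (rule diff_op_diff[OF open_H_domain diff_op_comp[OF open_H_domain diff_op_H Suc.IH] diff_op_comp[OF open_H_domain Suc.IH diff_op_H]])
  qed (simp add: M)
  then show ?thesis
    unfolding integral_op_def[abs_def]
    by (intro diff_op_mult analytic_open_const open_H_domain)
qed

text \<open>The basic invariants of the group have degrees 2, 6, 8, 12; the first three suffice on the mirror.\<close>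

definition integrals :: "nat \<Rightarrow> 3 func \<Rightarrow> 3 func" where
  "integrals i = (if i = 0 then H_op c else if i = 1 then integral_op 6 else integral_op 8)"
definition lifts :: "nat \<Rightarrow> 4 pend" where
  "lifts i = (if i = 0 then Lap else if i = 1 then DD 6 else DD 8)"

lemma restricts_integrals: "restricts (integrals i) (lifts i)"
  by (simp add: integrals_def lifts_def restricts_H restricts_integral)

lemma diff_op_integrals: "diff_op_on H_domain (integrals i)"
  by (simp add: integrals_def diff_op_H diff_op_integral)

lemma lifts_commute: "lifts i * lifts j = lifts j * lifts i"
  by (simp add: lifts_def DD_commute Lap_DD)

lemma integrals_commute: "op_eq_on H_domain (integrals i \<circ> integrals j) (integrals j \<circ> integrals i)"
proof (rule op_eq_onI)
  fix V f u assume V: "V \<subseteq> H_domain" "analytic_open f V" "u \<in> V"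
  let ?M = "\<lambda>f u. integrals i (integrals j f) u - integrals j (integrals i f) u"
  have "diff_op_on H_domain ?M"
    by (rule diff_op_diff[OF open_H_domain diff_op_comp[OF open_H_domain diff_op_integrals diff_op_integrals]
      diff_op_comp[OF open_H_domain diff_op_integrals diff_op_integrals]])
  moreover have "restricts ?M (lifts i * lifts j - lifts j * lifts i)"
    by (rule restricts_diff[OF restricts_comp[OF restricts_integrals restricts_integrals]
      restricts_comp[OF restricts_integrals restricts_integrals]])
  then have r: "restricts ?M 0" by (simp add: lifts_commute[of i j])
  have "?M (res P) u = 0" if "inv_pol P" "u \<in> H_domain" for P u
  proof -
    have "?M (res P) u = res (app 0 P) u" by (rule restrictsD(2)[OF r that(1) refl that(2)])
    then show ?thesis by (simp only: res_def app_simps val_simps)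
  qed
  ultimately have "?M f u = 0" using V by (rule diff_op_zero_test)
  then show "(integrals i \<circ> integrals j) f u = (integrals j \<circ> integrals i) f u" by simp
qed

text \<open>\<open>E\<close> preserves invariant polynomials and acts on restrictions as
  multiplication by a function. Hence, if the images of all invariants under \<open>T\<close>
  restrict to zero, the same holds for \<open>ad E T\<close>; after \<open>n\<close> commutators
  only a nonzero multiple of \<open>Y\<close> is left.\<close>

lemma symbol_vanishes:
  assumes "nilp E n T Y" "\<And>P u. inv_pol P \<Longrightarrow> u \<in> H_domain \<Longrightarrow> res (app T P) u = 0"
    and "inv_pol P" "u \<in> H_domain"
  shows "res (app Y P) u = 0"
  using assms
proof (induction n arbitrary: T Y P u)
  case 0
  then show ?case by simp
next
  case (Suc n)
  have EP: "inv_pol (app E P)" if "inv_pol P" for P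
  proof -
    have "app (S \<alpha>) (app E P) = app E P" if \<alpha>: "\<alpha> \<in> F4" for \<alpha>
      by (rule pol_eqI) (simp add: val_S val_E bilin_reflection[OF nonisotropic[OF \<alpha>]] inv_pol_val[OF \<open>inv_pol P\<close> \<alpha>])
    then show ?thesis by (simp add: inv_pol_def)
  qed
  have "res (app (ad E T) P) u = 0" if "inv_pol P" "u \<in> H_domain" for P u
    using Suc.prems(2)[OF that] Suc.prems(2)[OF EP[OF that(1)] that(2)]
    by (simp add: ad_def app_simps res_def val_simps val_E)
  then have "res (app (of_nat (Suc n) * Y) P) u = 0"
    using Suc.prems(1) unfolding nilp.simps by (intro Suc.IH[OF _ _ Suc.prems(3,4)])
  then have "of_nat (Suc n) * res (app Y P) u = 0"
    unfolding sc_of_nat[symmetric] by (simp only: app_simps res_def val_sc)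
  then show ?case using of_nat_neq_0[of n, where 'a = complex] by (simp only: mult_eq_0_iff simp_thms)
qed

definition symbol :: "(nat \<Rightarrow> nat) \<Rightarrow> 4 pend" where
  "symbol k = (\<Sum>i\<in>UNIV. X (e i) ^ 2) ^ k 0 * (XX 6 ^ k 1 * XX 8 ^ k 2)"
text \<open>The number of Dunkl operators multiplied in each term of the monomial, hence the number
  of commutators with \<open>E\<close> that reduce it to a multiplication operator.\<close>

definition weight :: "(nat \<Rightarrow> nat) \<Rightarrow> nat" where "weight k = 2 * k 0 + (6 * k 1 + 8 * k 2)"
definition lift_monomial :: "(nat \<Rightarrow> nat) \<Rightarrow> 4 pend" where
  "lift_monomial k = Lap ^ k 0 * (DD 6 ^ k 1 * DD 8 ^ k 2)"

lemma nilp_monomial: "nilp E (weight k) (lift_monomial k) (symbol k)"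
  unfolding weight_def lift_monomial_def symbol_def
  by (rule nilp_mult[OF nilp_power[OF nilp_E_Lap] nilp_mult[OF nilp_power[OF nilp_E_DD] nilp_power[OF nilp_E_DD]]]) simp_all

lemma restricts_monomial: "restricts (op_monomial integrals 3 k) (lift_monomial k)"
proof -
  have "op_monomial integrals 3 k = (\<lambda>f. (integrals 0 ^^ k 0) ((integrals 1 ^^ k 1) ((integrals 2 ^^ k 2) f)))"
    by (simp add: op_monomial_def upt_rec numeral_2_eq_2 fun_eq_iff)
  moreover have "lift_monomial k = lifts 0 ^ k 0 * (lifts 1 ^ k 1 * lifts 2 ^ k 2)"
    by (simp add: lift_monomial_def lifts_def)
  ultimately show ?thesis
    by (simp only:) (rule restricts_comp[OF restricts_power[OF restricts_integrals]
      restricts_comp[OF restricts_power[OF restricts_integrals] restricts_power[OF restricts_integrals]]])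
qed

lemma val_symbol:
  "val (app (symbol k) P) (\<phi> u) = bilin u u ^ k 0 * power_inv 6 u ^ k 1 * power_inv 8 u ^ k 2 * val P (\<phi> u)"
proof -
  have p: "val (app (T ^ n) P) (\<phi> u) = h ^ n * val P (\<phi> u)"
    if "\<And>P. val (app T P) (\<phi> u) = h * val P (\<phi> u)" for T h n P
    by (induction n) (simp_all add: app_simps that)
  show ?thesis unfolding symbol_def app_simps p[OF val_r2] p[OF val_XX] by (simp only: mult.assoc)
qed

theorem integrals_independent: "algebraically_independent_ops H_domain 3 integrals"
  unfolding algebraically_independent_ops_def
proof (intro allI impI)
  fix P :: "(nat \<Rightarrow>\<^sub>0 nat) \<Rightarrow>\<^sub>0 complex"
  let ?K = "Poly_Mapping.keys P" and ?c = "Poly_Mapping.lookup P"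
  let ?l = "Poly_Mapping.lookup :: (nat \<Rightarrow>\<^sub>0 nat) \<Rightarrow> nat \<Rightarrow> nat"
  let ?op = "\<lambda>f x. \<Sum>k\<in>?K. ?c k * op_monomial integrals 3 (?l k) f x"
  assume "(\<forall>k\<in>?K. Poly_Mapping.keys k \<subseteq> {..<3}) \<and> op_eq_on H_domain ?op (\<lambda>f x. 0)"
  then have keys: "\<And>k. k \<in> ?K \<Longrightarrow> Poly_Mapping.keys k \<subseteq> {..<3}" and zero: "op_eq_on H_domain ?op (\<lambda>f x. 0)" by blast+
  show "P = 0"
  proof (rule ccontr)
    assume "P \<noteq> 0"
    then have ne: "?K \<noteq> {}" by simp
    define N where "N = Max ((\<lambda>k. weight (?l k)) ` ?K)"
    have le: "weight (?l k) \<le> N" if "k \<in> ?K" for k unfolding N_def using that by (intro Max_ge) auto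
    obtain k0 where k0: "k0 \<in> ?K" "weight (?l k0) = N"
    proof -
      have "N \<in> (\<lambda>k. weight (?l k)) ` ?K" unfolding N_def using ne by (intro Max_in) auto
      then show thesis using that by blast
    qed
    define T where "T = (\<Sum>k\<in>?K. sc (?c k) * lift_monomial (?l k))"
    \<comment> \<open>\<open>N\<close> commutators with \<open>E\<close> annihilate the monomials of
      weight below \<open>N\<close> and turn those of weight \<open>N\<close> into \<open>N!\<close>
      times their symbols.\<close>
    define Y where "Y = (\<Sum>k\<in>?K. sc (?c k) * (if weight (?l k) = N then symbol (?l k) else 0))"
    have E_sc: "E * sc a = sc a * E" for a by (rule pend_val_eqI) (simp add: app_simps val_sc val_E)
    have "nilp E N T Y"
      unfolding T_def Y_def
    proof (rule nilp_sum, rule nilp_scale[OF E_sc])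
      fix k assume k: "k \<in> ?K"
      show "nilp E N (lift_monomial (?l k)) (if weight (?l k) = N then symbol (?l k) else 0)"
        using nilp_monomial[of "?l k"] nilp_lower[OF nilp_monomial[of "?l k"], of N] le[OF k] by auto
    qed
    moreover have "restricts ?op T"
      unfolding T_def by (rule restricts_sum[OF restricts_scale[OF restricts_monomial]])
    then have "res (app T Q) u = 0" if "inv_pol Q" "u \<in> H_domain" for Q u
    proof -
      have an: "analytic_open (res Q) H_domain"
        unfolding res_def[abs_def] by (rule analytic_cpoly[OF cpoly_linear[OF phi_linear cpoly_val] open_H_domain])
      have "?op (res Q) u = 0" by (rule op_eq_onD[OF zero subset_refl an that(2)])
      then show ?thesis using restrictsD(2)[OF \<open>restricts ?op T\<close> that(1) refl that(2)] by simp
    qed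
    \<comment> \<open>Applied to the constant 1, the multiplication operator \<open>Y\<close>
      becomes the polynomial itself.\<close>
    moreover have one: "inv_pol (const_pol 1)" unfolding inv_pol_def by (simp add: S_const_pol)
    ultimately have Y0: "res (app Y (const_pol 1)) u = 0" if "u \<in> H_domain" for u
      using that by (rule symbol_vanishes)
    let ?K' = "{k\<in>?K. weight (?l k) = N}"
    let ?F = "\<lambda>u. \<Sum>k\<in>?K'. ?c k * (bilin u u ^ ?l k 0 * power_inv 6 u ^ ?l k 1 * power_inv 8 u ^ ?l k 2)"
    have resY: "res (app Y (const_pol 1)) u = ?F u" for u
    proof -
      have "res (app Y (const_pol 1)) u = (\<Sum>k\<in>?K. if weight (?l k) = N
          then ?c k * (bilin u u ^ ?l k 0 * power_inv 6 u ^ ?l k 1 * power_inv 8 u ^ ?l k 2) else 0)"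
        unfolding Y_def res_def app_sum val_sum
        by (intro sum.cong refl) (simp add: app_simps val_sc val_symbol val_simps)
      then show ?thesis by (simp only: sum.inter_filter[OF finite_keys])
    qed
    have cres: "cpoly (res (app Y (const_pol 1)))"
      unfolding res_def[abs_def] by (rule cpoly_linear[OF phi_linear cpoly_val])
    \<comment> \<open>The preimages provided by \<open>invariants_surjective\<close> may lie outside
      \<open>H_domain\<close>, so the vanishing is first extended to all \<open>u\<close>.\<close>
    have F0: "?F u = 0" for u
      using cpoly_zero_on_H_domain[OF cres Y0, of u] unfolding resY .
    have "?c k0 = 0"
    proof (rule monomials_independent[where K = ?K' and a = "\<lambda>k. ?l k 0" and b = "\<lambda>k. ?l k 1" and c = "\<lambda>k. ?l k 2"])
      show "finite ?K'" by simp
      show "k0 \<in> ?K'" using k0 by simp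
      fix k l assume kl: "k \<in> ?K'" "l \<in> ?K'" "?l k 0 = ?l l 0" "?l k 1 = ?l l 1" "?l k 2 = ?l l 2"
      show "k = l"
      proof (rule poly_mapping_eqI)
        fix i :: nat
        show "?l k i = ?l l i"
        proof (cases "i < 3")
          case True
          then have "i = 0 \<or> i = 1 \<or> i = 2" by linarith
          then show ?thesis using kl(3-5) by auto
        next
          case False
          then have "i \<notin> Poly_Mapping.keys k" "i \<notin> Poly_Mapping.keys l" using keys[of k] keys[of l] kl(1,2) by auto
          then show ?thesis by (simp add: in_keys_iff)
        qed
      qed
    next
      fix x y z :: complex
      obtain u where u: "bilin u u = x" "power_inv 6 u = y" "power_inv 8 u = z" by (rule invariants_surjective)
      show "(\<Sum>k\<in>?K'. ?c k * (x ^ ?l k 0 * y ^ ?l k 1 * z ^ ?l k 2)) = 0"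
        using F0[of u] unfolding u .
    qed
    then show False using k0(1) by (simp add: in_keys_iff)
  qed
qed

theorem H_quantum_integrable: "quantum_integrable_on H_domain (H_op c)"
  unfolding quantum_integrable_on_def
proof (intro exI conjI)
  show "integrals 0 = H_op c" by (simp add: integrals_def)
  show "\<forall>i<CARD(3). diff_op_on H_domain (integrals i)" using diff_op_integrals by blast
  show "\<forall>i<CARD(3). \<forall>j<CARD(3). op_eq_on H_domain (integrals i \<circ> integrals j) (integrals j \<circ> integrals i)"
    using integrals_commute by blast
  show "algebraically_independent_ops H_domain CARD(3) integrals" using integrals_independent by simp
qed

end

lemma positive_system_half:
  assumes "positive_system F4 Rp"
  shows "Rp \<subseteq> F4" "\<alpha> \<in> F4 \<Longrightarrow> - \<alpha> \<in> Rp \<longleftrightarrow> \<alpha> \<notin> Rp"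
proof -
  obtain v :: "real ^ 4" where v: "\<And>\<alpha>. \<alpha> \<in> F4 \<Longrightarrow> (\<Sum>i\<in>UNIV. Re (\<alpha> $ i) * v $ i) \<noteq> 0"
    and Rp: "Rp = {\<alpha>\<in>F4. (\<Sum>i\<in>UNIV. Re (\<alpha> $ i) * v $ i) > 0}"
    using assms unfolding positive_system_def by blast
  show "Rp \<subseteq> F4" unfolding Rp by blast
  assume \<alpha>: "\<alpha> \<in> F4"
  have "(\<Sum>i\<in>UNIV. Re ((- \<alpha>) $ i) * v $ i) = - (\<Sum>i\<in>UNIV. Re (\<alpha> $ i) * v $ i)" by (simp add: sum_negf)
  then show "- \<alpha> \<in> Rp \<longleftrightarrow> \<alpha> \<notin> Rp"
    unfolding Rp using v[OF \<alpha>] \<alpha> F4.neg_root[OF \<alpha>] by auto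
qed

text \<open>Each entry of \<open>(16, 8, 4, 2)\<close> exceeds the sum of the later ones, while the
  nonzero coordinates of a root all have the same modulus; the leading term therefore cannot be
  cancelled.\<close>

lemma F4_regular_vector: "\<exists>v. \<forall>\<alpha>\<in>F4. bilin \<alpha> v \<noteq> 0"
proof -
  let ?v = "root_vec (16, 8, 4, 2)"
  have "\<forall>t\<in>set (short4 @ long4). dot4 t (16, 8, 4, 2) \<noteq> 0" by code_simp
  then have "bilin (root_vec t) ?v \<noteq> 0" if "t \<in> set (short4 @ long4)" for t
    using that by (simp add: bilin_root_vec)
  then have "bilin \<alpha> ?v \<noteq> 0" if "\<alpha> \<in> F4" for \<alpha>
    using that by (elim F4_root_cases) (auto simp: bilin_simps)
  then show ?thesis by blast
qed

theorem theorem10: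
  fixes c :: complex and m :: "complex ^ 4 \<Rightarrow> complex"
    and \<beta> :: "complex ^ 4" and Rp :: "(complex ^ 4) set"
  assumes "positive_system F4 Rp"
    and "multiplicity_function F4 m"
    and "\<beta> \<in> F4"
    and "m \<beta> = 1 / 2"
    and "\<forall>\<alpha>\<in>F4. \<alpha> \<notin> root_orbit F4 \<beta> \<longrightarrow> m \<alpha> = c"
  shows "(\<exists>\<phi> :: complex ^ 3 \<Rightarrow> complex ^ 4. orthonormal_coordinates \<phi> (mirror \<beta>) \<and>
            restricted_operator_has_form F4 Rp m \<beta> \<phi> (H_op c))
         \<and> quantum_integrable_on H_domain (H_op c)"
proof -
  obtain A p q where frame: "F4_frame \<beta> A p q" using assms(3) by (rule F4_frame_exists)
  have mult: "m (w \<alpha>) = m \<alpha>" if "w \<in> coxeter_group F4" "\<alpha> \<in> F4" for w \<alpha>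
    using assms(2) that unfolding multiplicity_function_def by blast
  have "dunkl_system F4 Rp m"
  proof (rule dunkl_system.intro[OF F4.reflection_stable_axioms], rule dunkl_system_axioms.intro)
    show "F4 \<noteq> {}" using assms(3) by blast
    show "m (reflection \<alpha> \<gamma>) = m \<gamma>" if "\<alpha> \<in> F4" "\<gamma> \<in> F4" for \<alpha> \<gamma>
      by (rule mult[OF coxeter_group_reflection[OF that(1)] that(2)])
  qed (use positive_system_half[OF assms(1)] F4_regular_vector in blast)+
  moreover have "m \<alpha> = 1 / 2" if "\<alpha> \<in> root_orbit F4 \<beta>" for \<alpha>
    using that mult[OF _ assms(3)] assms(4) unfolding root_orbit_def by auto
  ultimately interpret F4_setting \<beta> A p q Rp m c
    using frame assms(3,5) by (intro F4_setting.intro F4_setting_axioms.intro) auto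
  show ?thesis
    using orthonormal_coordinates_phi restricted_form H_quantum_integrable by blast
qed

end
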